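(* Let $c\in\mathbb{R}$ satisfy $|c|>c_\star$. Then there exists $a_c>0$ such that for every $a\in\mathbb{R}$ with $|a|\le a_c$ there are smooth $2\pi$-periodic functions $\boldsymbol{\psi}_c^a:\mathbb{R}\to\mathbb{R}^2$ and frequencies $\omega_c^a\in\mathbb{R}$ such that $$\mathbf{p}_c^a(X)=\begin{pmatrix} p_1(X) \\ p_2(X) \end{pmatrix}:=a\,\boldsymbol{\nu}_1^c(\omega_c^aX)+a^2\boldsymbol{\psi}_c^a(\omega_c^aX)$$ solves the traveling wave system $$\begin{cases} c^2p_1''=\mathcal{V}_1'(S^1p_2-p_1)-\mathcal{V}_2'(p_1-S^{-1}p_2) \\ c^2m\,p_2''=\mathcal{V}_2'(S^1p_1-p_2)-\mathcal{V}_1'(p_2-S^{-1}p_1) \end{cases}$$ on $\mathbb{R}$, and the following hold. (i) The leading-order term $\boldsymbol{\nu}_1^c$ is the explicit smooth $2\pi$-periodic function given in the context. (ii) $\langle\boldsymbol{\nu}_1^c,\boldsymbol{\psi}_c^a\rangle=0$ for all $|a|\le a_c$, and $\sup_{|a|\le a_c}\|\boldsymbol{\psi}_c^a\|_{H^r_{\mathrm{per}}}<\infty$ for each $r\ge0$. (iii) $\omega_c^a=\omega_c+a\,\xi_c^a$, where $\omega_c>0$ is the critical frequency defined in the context and $\sup_{|a|\le a_c}|\xi_c^a|<\infty$.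
   Context: Material data: fix real numbers $m>0$, $\kappa>0$, $\beta$, put $w:=1/m$, and assume $w>1$ or $\kappa>1$. The spring potentials $\mathcal{V}_1,\mathcal{V}_2\in C^\infty(\mathbb{R})$ are real-valued with $\mathcal{V}_1'(r)=r+r^2+O(r^3)$ and $\mathcal{V}_2'(r)=\kappa r+\beta r^2+O(r^3)$ as $r\to0$. Notation: $(S^\theta p)(X):=p(X+\theta)$. $\langle\boldsymbol{\phi},\boldsymbol{\eta}\rangle:=\frac1{2\pi}\int_{-\pi}^{\pi}\boldsymbol{\phi}(x)\cdot\boldsymbol{\eta}(x)\,dx$ is the $L^2_{\mathrm{per}}$ inner product of $2\pi$-periodic $\mathbb{R}^2$-valued functions, and $\|\boldsymbol{\phi}\|_{H^r_{\mathrm{per}}}^2=\sum_{k\in\mathbb{Z}}(1+k^2)^r|\hat{\boldsymbol{\phi}}(k)|^2$ is the usual norm on the Sobolev space of $2\pi$-periodic functions ($\hat{\boldsymbol{\phi}}(k)$ is the $k$th Fourier coefficient). Speed of sound: $c_\star:=\sqrt{\dfrac{4\kappa w}{(1+\kappa)(1+w)}}$. Critical frequency: put $\tilde\varrho(K):=\sqrt{(1+w)^2(1-\kappa)^2+4\kappa\big((1-w)^2+4w\cos^2K\big)}$ and $\tilde\lambda_+(K):=\frac{(1+\kappa)(1+w)}{2}+\frac{\tilde\varrho(K)}{2}$. For $|c|>c_\star$ it is known that there is a unique $\omega_c>0$ such that $c^2K^2=\tilde\lambda_+(K)$ for real $K$ if and only if $K=\pm\omega_c$. Leading-order profile: let $\boldsymbol{\mu}_c:=\begin{pmatrix}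 e^{i\omega_c}+\kappa e^{-i\omega_c} \\ 1+\kappa-c^2\omega_c^2 \end{pmatrix}\in\mathbb{C}^2$, $\mathcal{N}_c:=\sqrt2\,|\boldsymbol{\mu}_c|$ (Euclidean norm), and $\boldsymbol{\nu}_1^c(x):=\frac{1}{\mathcal{N}_c}\big(e^{-ix}\overline{\boldsymbol{\mu}_c}+e^{ix}\boldsymbol{\mu}_c\big)$. *)

theory Defs
  imports "HOL-Analysis.Analysis" "HOL-Library.Landau_Symbols"
begin

section \<open>Smooth and periodic functions\<close>

definition smooth :: "(real \<Rightarrow> 'a::real_normed_vector) \<Rightarrow> bool" where
  "smooth f \<longleftrightarrow>
     (\<exists>D. D (0::nat) = f \<and> (\<forall>n x. (D n has_vector_derivative D (Suc n) x) (at x)))"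

definition periodic_2pi :: "(real \<Rightarrow> 'a) \<Rightarrow> bool" where
  "periodic_2pi f \<longleftrightarrow> (\<forall>x. f (x + 2 * pi) = f x)"

definition inner_per :: "(real \<Rightarrow> real ^ 2) \<Rightarrow> (real \<Rightarrow> real ^ 2) \<Rightarrow> real" where
  "inner_per \<phi> \<eta> = 1 / (2 * pi) * integral {- pi..pi} (\<lambda>x. \<phi> x \<bullet> \<eta> x)"

definition fourier_coeff :: "(real \<Rightarrow> real ^ 2) \<Rightarrow> int \<Rightarrow> complex ^ 2" where
  "fourier_coeff \<phi> k =
     (\<chi> j. 1 / (2 * pi) *
        integral {- pi..pi} (\<lambda>x. complex_of_real (\<phi> x $ j) * exp (- \<i> * of_int k * of_real x)))"

definition sobolev_term :: "real \<Rightarrow> (real \<Rightarrow> real ^ 2) \<Rightarrow> int \<Rightarrow> real" where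
  "sobolev_term r \<phi> k = (1 + (of_int k)\<^sup>2) powr r * (norm (fourier_coeff \<phi> k))\<^sup>2"

text \<open>
  An infinite sum over a non-summable family is \<open>0\<close> in HOL, so finiteness of the
  Sobolev norm is the separate predicate \<open>finite_sobolev\<close>.
\<close>

definition finite_sobolev :: "real \<Rightarrow> (real \<Rightarrow> real ^ 2) \<Rightarrow> bool" where
  "finite_sobolev r \<phi> \<longleftrightarrow> sobolev_term r \<phi> summable_on UNIV"

definition sobolev_norm :: "real \<Rightarrow> (real \<Rightarrow> real ^ 2) \<Rightarrow> real" where
  "sobolev_norm r \<phi> = sqrt (\<Sum>\<^sub>\<infinity>k\<in>UNIV. sobolev_term r \<phi> k)"

section \<open>Speed of sound and critical frequency\<close>

definition c_star :: "real \<Rightarrow> real \<Rightarrow> real" where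
  "c_star \<kappa> w = sqrt (4 * \<kappa> * w / ((1 + \<kappa>) * (1 + w)))"

definition rho :: "real \<Rightarrow> real \<Rightarrow> real \<Rightarrow> real" where
  "rho \<kappa> w K =
     sqrt ((1 + w)\<^sup>2 * (1 - \<kappa>)\<^sup>2 + 4 * \<kappa> * ((1 - w)\<^sup>2 + 4 * w * (cos K)\<^sup>2))"

definition lambda_plus :: "real \<Rightarrow> real \<Rightarrow> real \<Rightarrow> real" where
  "lambda_plus \<kappa> w K = (1 + \<kappa>) * (1 + w) / 2 + rho \<kappa> w K / 2"

definition is_critical_freq :: "real \<Rightarrow> real \<Rightarrow> real \<Rightarrow> real \<Rightarrow> bool" where
  "is_critical_freq \<kappa> w c \<omega> \<longleftrightarrow>
     0 < \<omega> \<and> (\<forall>K. c\<^sup>2 * K\<^sup>2 = lambda_plus \<kappa> w K \<longleftrightarrow> K = \<omega> \<or> K = - \<omega>)"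

definition omega_crit :: "real \<Rightarrow> real \<Rightarrow> real \<Rightarrow> real" where
  "omega_crit \<kappa> w c = (THE \<omega>. is_critical_freq \<kappa> w c \<omega>)"

text \<open>The description operator is justified: \<open>lambda_plus\<close> grows no faster than
  \<open>(c_star \<kappa> w)\<^sup>2 * K\<^sup>2\<close>, hence meets the parabola \<open>c\<^sup>2 * K\<^sup>2\<close> exactly once for \<open>K > 0\<close>.\<close>

lemma lambda_plus_growth:
  fixes \<kappa> w K L :: real
  assumes "\<kappa> > 0" "w > 0" "0 \<le> K" "K \<le> L"
  shows "lambda_plus \<kappa> w L - lambda_plus \<kappa> w K \<le> (c_star \<kappa> w)\<^sup>2 * (L\<^sup>2 - K\<^sup>2)"
proof -
  define A where "A = (1 + \<kappa>) * (1 + w)"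
  define B where "B = (1 + w)\<^sup>2 * (1 - \<kappa>)\<^sup>2 + 4 * \<kappa> * (1 - w)\<^sup>2"
  have A: "A > 0" using assms by (simp add: A_def)
  have B: "B \<ge> 0" using assms by (simp add: B_def)
  have AB: "A\<^sup>2 = B + 16 * \<kappa> * w"
    by (simp add: A_def B_def power2_eq_square algebra_simps)
  have rho_eq: "rho \<kappa> w x = sqrt (B + 16 * \<kappa> * w * \<bar>cos x\<bar>\<^sup>2)" for x
    by (simp add: rho_def B_def algebra_simps)
  have rho_sq: "(rho \<kappa> w x)\<^sup>2 = B + 16 * \<kappa> * w * \<bar>cos x\<bar>\<^sup>2" for x
    using assms B by (simp add: rho_eq)
  have rho_ge: "rho \<kappa> w x \<ge> A * \<bar>cos x\<bar>" for x
  proof -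
    have "(A * \<bar>cos x\<bar>)\<^sup>2 = B * (cos x)\<^sup>2 + 16 * \<kappa> * w * \<bar>cos x\<bar>\<^sup>2"
      by (simp add: power_mult_distrib AB algebra_simps)
    also have "\<dots> \<le> B + 16 * \<kappa> * w * \<bar>cos x\<bar>\<^sup>2"
      using B by (simp add: mult_left_le cos_squared_eq)
    finally show ?thesis unfolding rho_eq by (rule real_le_rsqrt)
  qed
  have cs: "(c_star \<kappa> w)\<^sup>2 = 4 * \<kappa> * w / A"
    using assms by (simp add: c_star_def A_def)
  have cos_le: "\<bar>cos L\<bar> - \<bar>cos K\<bar> \<le> (L\<^sup>2 - K\<^sup>2) / 2"
  proof -
    have "\<bar>cos L\<bar> - \<bar>cos K\<bar> \<le> \<bar>cos L - cos K\<bar>" by linarith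
    also have "\<dots> = 2 * (\<bar>sin ((L + K) / 2)\<bar> * \<bar>sin ((K - L) / 2)\<bar>)"
      by (simp add: cos_diff_cos abs_mult)
    also have "\<dots> \<le> 2 * (\<bar>(L + K) / 2\<bar> * \<bar>(K - L) / 2\<bar>)"
      by (intro mult_left_mono mult_mono abs_sin_x_le_abs_x) auto
    also have "\<dots> = 2 * ((L + K) / 2 * ((L - K) / 2))"
      using assms by simp
    also have "\<dots> = (L\<^sup>2 - K\<^sup>2) / 2"
      by (simp add: power2_eq_square field_simps)
    finally show ?thesis .
  qed
  have LK: "L\<^sup>2 - K\<^sup>2 \<ge> 0" using assms by (simp add: power_mono)
  show ?thesis
  proof (cases "\<bar>cos L\<bar> \<le> \<bar>cos K\<bar>")
    case True
    then have "\<bar>cos L\<bar>\<^sup>2 \<le> \<bar>cos K\<bar>\<^sup>2" by (intro power_mono) auto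
    then have "rho \<kappa> w L \<le> rho \<kappa> w K"
      unfolding rho_eq using assms by (intro real_sqrt_le_mono) simp
    moreover have "0 \<le> (c_star \<kappa> w)\<^sup>2 * (L\<^sup>2 - K\<^sup>2)" using LK by simp
    ultimately show ?thesis by (simp add: lambda_plus_def)
  next
    case False
    let ?s = "\<bar>cos L\<bar> + \<bar>cos K\<bar>" and ?d = "\<bar>cos L\<bar> - \<bar>cos K\<bar>"
    have s: "?s > 0" using False by linarith
    have "(rho \<kappa> w L - rho \<kappa> w K) * (rho \<kappa> w L + rho \<kappa> w K) = 16 * \<kappa> * w * ?d * ?s"
      using rho_sq[of L] rho_sq[of K] by (simp add: power2_eq_square algebra_simps)
    moreover have ge: "rho \<kappa> w L + rho \<kappa> w K \<ge> A * ?s"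
      using rho_ge[of L] rho_ge[of K] by (simp add: algebra_simps)
    moreover have "rho \<kappa> w L - rho \<kappa> w K \<ge> 0"
    proof -
      have "\<bar>cos K\<bar>\<^sup>2 \<le> \<bar>cos L\<bar>\<^sup>2" using False by (intro power_mono) auto
      then show ?thesis
        unfolding rho_eq using assms by simp
    qed
    ultimately have "(rho \<kappa> w L - rho \<kappa> w K) * (A * ?s) \<le> 16 * \<kappa> * w * ?d * ?s"
      using mult_left_mono[OF ge, of "rho \<kappa> w L - rho \<kappa> w K"] by linarith
    then have "((rho \<kappa> w L - rho \<kappa> w K) * A) * ?s \<le> (16 * \<kappa> * w * ?d) * ?s"
      by (simp only: mult.assoc)
    then have "(rho \<kappa> w L - rho \<kappa> w K) * A \<le> 16 * \<kappa> * w * ?d"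
      using s by (rule mult_right_le_imp_le)
    also have "\<dots> \<le> 16 * \<kappa> * w * ((L\<^sup>2 - K\<^sup>2) / 2)"
      using cos_le assms by (intro mult_left_mono) auto
    finally have "(rho \<kappa> w L - rho \<kappa> w K) / 2 \<le> 4 * \<kappa> * w / A * (L\<^sup>2 - K\<^sup>2)"
      using A by (simp add: field_simps)
    then show ?thesis unfolding cs by (simp add: lambda_plus_def diff_divide_distrib)
  qed
qed

lemma ex1_critical_freq:
  fixes \<kappa> w c :: real
  assumes "\<kappa> > 0" "w > 0" "\<bar>c\<bar> > c_star \<kappa> w"
  shows "\<exists>!\<omega>. is_critical_freq \<kappa> w c \<omega>"
proof -
  define A where "A = (1 + \<kappa>) * (1 + w)"
  define F where "F K = c\<^sup>2 * K\<^sup>2 - lambda_plus \<kappa> w K" for K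
  have A: "A > 0" using assms by (simp add: A_def)
  have cs0: "c_star \<kappa> w \<ge> 0" using assms by (simp add: c_star_def)
  then have c: "\<bar>c\<bar> > 0" using assms by linarith
  have cc: "(c_star \<kappa> w)\<^sup>2 < c\<^sup>2"
    using assms(3) cs0 by (metis power2_abs power_strict_mono zero_less_numeral)
  have even: "F (- K) = F K" for K
    by (simp add: F_def lambda_plus_def rho_def)
  have rho0: "rho \<kappa> w K \<ge> 0" for K
    using assms by (simp add: rho_def)
  have rhoA: "rho \<kappa> w K \<le> A" for K
  proof -
    have "4 * \<kappa> * ((1 - w)\<^sup>2 + 4 * w * (cos K)\<^sup>2) \<le> 4 * \<kappa> * ((1 - w)\<^sup>2 + 4 * w * 1)"
      using assms by (intro mult_left_mono add_left_mono) (auto simp: cos_squared_eq)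
    then have "(1 + w)\<^sup>2 * (1 - \<kappa>)\<^sup>2 + 4 * \<kappa> * ((1 - w)\<^sup>2 + 4 * w * (cos K)\<^sup>2) \<le> A\<^sup>2"
      by (simp add: A_def power2_eq_square algebra_simps)
    then show ?thesis unfolding rho_def using A by (intro real_le_lsqrt) auto
  qed
  have mono: "F K < F L" if "0 \<le> K" "K < L" for K L
  proof -
    have "K\<^sup>2 < L\<^sup>2" using that by (intro power_strict_mono) auto
    then have "(c_star \<kappa> w)\<^sup>2 * (L\<^sup>2 - K\<^sup>2) < c\<^sup>2 * (L\<^sup>2 - K\<^sup>2)"
      using cc by (intro mult_strict_right_mono) auto
    with lambda_plus_growth[of \<kappa> w K L] assms that
    show ?thesis by (simp add: F_def algebra_simps)
  qed
  have F0: "F 0 < 0"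
    using A rho0[of 0] by (simp add: F_def lambda_plus_def A_def)
  define M where "M = sqrt A / \<bar>c\<bar>"
  have M: "M > 0" using A c by (simp add: M_def)
  have "c\<^sup>2 * M\<^sup>2 = A" using A c by (simp add: M_def power_divide)
  then have FM: "F M \<ge> 0" using rhoA[of M] by (simp add: F_def lambda_plus_def A_def)
  have "continuous_on {0..M} F"
    unfolding F_def lambda_plus_def rho_def by (intro continuous_intros) auto
  then obtain \<omega> where \<omega>: "0 \<le> \<omega>" "F \<omega> = 0"
    using IVT'[of F 0 0 M] F0 FM M by auto
  have pos: "\<omega> > 0" using \<omega> F0 by (cases "\<omega> = 0") auto
  have uniq: "K = \<omega>" if "0 \<le> K" "F K = 0" for K
    using mono[of K \<omega>] mono[of \<omega> K] that \<omega> by (cases K \<omega> rule: linorder_cases) auto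
  have "F K = 0 \<longleftrightarrow> K = \<omega> \<or> K = - \<omega>" for K
  proof (cases "0 \<le> K")
    case True
    then show ?thesis using uniq[of K] \<omega> pos by auto
  next
    case False
    then show ?thesis using uniq[of "- K"] even[of K] even[of \<omega>] \<omega> pos by auto
  qed
  then have "is_critical_freq \<kappa> w c \<omega>"
    using pos by (auto simp: is_critical_freq_def F_def)
  then show ?thesis
  proof (rule ex1I)
    fix \<omega>' assume "is_critical_freq \<kappa> w c \<omega>'"
    then have "\<omega>' > 0" "F \<omega>' = 0" by (auto simp: is_critical_freq_def F_def)
    then show "\<omega>' = \<omega>" by (intro uniq) auto
  qed
qed

lemma is_critical_freq_omega_crit:
  assumes "\<kappa> > 0" "w > 0" "\<bar>c\<bar> > c_star \<kappa> w"
  shows "is_critical_freq \<kappa> w c (omega_crit \<kappa> w c)"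
  unfolding omega_crit_def by (rule theI'[OF ex1_critical_freq[OF assms]])

section \<open>Leading-order profile\<close>

definition mu :: "real \<Rightarrow> real \<Rightarrow> real \<Rightarrow> complex ^ 2" where
  "mu \<kappa> w c = (let \<omega> = omega_crit \<kappa> w c in
     vector [exp (\<i> * of_real \<omega>) + of_real \<kappa> * exp (- \<i> * of_real \<omega>),
             of_real (1 + \<kappa> - c\<^sup>2 * \<omega>\<^sup>2)])"

definition nu_complex :: "real \<Rightarrow> real \<Rightarrow> real \<Rightarrow> real \<Rightarrow> complex ^ 2" where
  "nu_complex \<kappa> w c x =
     (1 / (sqrt 2 * norm (mu \<kappa> w c))) *\<^sub>R
       (exp (- \<i> * of_real x) *s (\<chi> j. cnj (mu \<kappa> w c $ j)) + exp (\<i> * of_real x) *s mu \<kappa> w c)"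

text \<open>The components of \<open>nu_complex\<close> are real, so taking real parts only changes the type.\<close>

definition nu :: "real \<Rightarrow> real \<Rightarrow> real \<Rightarrow> real \<Rightarrow> real ^ 2" where
  "nu \<kappa> w c x = (\<chi> j. Re (nu_complex \<kappa> w c x $ j))"

lemma nu_complex_real: "nu_complex \<kappa> w c x = (\<chi> j. of_real (nu \<kappa> w c x $ j))"
proof -
  have "Im (nu_complex \<kappa> w c x $ j) = 0" for j
    by (simp add: nu_complex_def Im_exp Re_exp)
  then show ?thesis
    by (simp add: vec_eq_iff nu_def complex_eq_iff)
qed

section \<open>The traveling wave system\<close>

definition shift :: "real \<Rightarrow> (real \<Rightarrow> 'a) \<Rightarrow> real \<Rightarrow> 'a" where
  "shift \<theta> p X = p (X + \<theta>)"

definition solves_tw ::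
  "real \<Rightarrow> (real \<Rightarrow> real) \<Rightarrow> (real \<Rightarrow> real) \<Rightarrow> real \<Rightarrow> (real \<Rightarrow> real ^ 2) \<Rightarrow> bool" where
  "solves_tw m V1 V2 c p \<longleftrightarrow>
     (let p1 = (\<lambda>X. p X $ 1); p2 = (\<lambda>X. p X $ 2) in
      \<exists>q1 q2 s1 s2. \<forall>X.
        (p1 has_real_derivative q1 X) (at X) \<and> (q1 has_real_derivative s1 X) (at X) \<and>
        (p2 has_real_derivative q2 X) (at X) \<and> (q2 has_real_derivative s2 X) (at X) \<and>
        c\<^sup>2 * s1 X = deriv V1 (shift 1 p2 X - p1 X) - deriv V2 (p1 X - shift (- 1) p2 X) \<and>
        c\<^sup>2 * m * s2 X = deriv V2 (shift 1 p1 X - p2 X) - deriv V1 (p2 X - shift (- 1) p1 X))"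

end

theory Submission
  imports Defs
begin

text \<open>
  The proof is a Lyapunov--Schmidt reduction in the space of continuous periodic functions.
  Writing the profile as \<open>a \<nu> + a\<^sup>2 \<psi>\<close> with frequency \<open>\<omega>0 + a \<xi>\<close>, the linearization is
  inverted by Fourier multipliers of size \<open>O(1 / n\<^sup>2)\<close> off its three-dimensional kernel (the constant
  vector \<open>(1, 1)\<close> and the mode \<open>n = 1\<close> along \<open>\<mu>\<close>), which turns the projected equation for \<open>\<psi>\<close>
  into a contraction. Solving it at once for all \<open>(\<xi>, x)\<close> makes the solution continuous in \<open>\<xi>\<close>.
  Two of the three remaining real equations hold automatically, because the system is the
  Euler--Lagrange equation of an action invariant under translations of space and of phase. The third
  one changes sign between \<open>\<xi> = R\<close> and \<open>\<xi> = - R\<close>, since the eigenvalue curve crosses the parabola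
  \<open>c\<^sup>2 K\<^sup>2\<close> transversally at \<open>\<omega>0\<close>, so the intermediate value theorem provides \<open>\<xi>\<close>.
  Bootstrapping in the differential equation bounds all derivatives of \<open>\<psi>\<close> uniformly in \<open>a\<close>.
\<close>

section \<open>Fourier coefficients of periodic functions\<close>

text \<open>Shifts by the unknown frequency cannot be differentiated in that frequency without
  losing a derivative of the profile, so the reduction is arranged to need only continuity in \<xi>;
  accordingly \<xi> comes without uniqueness or regularity in \<open>a\<close>. After division by
  \<open>a\<^sup>2\<close> the residual of \<nu> carries a factor 1 / a, but it is Lipschitz in the
  frequency and vanishes at \<omega>0, so it stays bounded for frequencies \<omega>0 + a \<xi>. The
  nonlinear terms are quadratic, hence also bounded, and depend on \<psi> with a Lipschitz constant
  of order \<open>a\<close>. The order of the constants matters. In the remaining scalar equation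
  the nonlinear contribution is bounded independently of the window [-R, R] for \<xi>, up to terms
  that vanish with \<open>a\<close>, while the dispersive term at its ends grows linearly in R. So R
  is fixed first, then the radius of the ball for \<psi>, and the range of \<open>a\<close> last.
  Beyond the definition of \<omega>0, supersonic speed enters through one quartic lower bound for
  the determinant of the symbol: it excludes resonances at n \<ge> 2, gives the decay of the inverse
  and yields transversality.\<close>

lemma periodic_antiderivative:
  fixes F :: "real \<Rightarrow> 'a::euclidean_space"
  assumes F: "continuous_on UNIV F" and per: "\<And>x. F (x + 2 * pi) = F x"
  obtains P where "\<And>x. (P has_vector_derivative F x) (at x)"
    and "\<And>x. P (x + 2 * pi) = P x + integral {- pi..pi} F"
proof -
  obtain P where P: "\<And>x. (P has_vector_derivative F x) (at x)"
    using einterval_antiderivative[of "-\<infinity>" "\<infinity>" F] F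
    by (auto simp: continuous_on_eq_continuous_at)
  have "((\<lambda>x. P (x + 2 * pi) - P x) has_vector_derivative 0) (at x)" for x
  proof -
    have "((\<lambda>x. x + 2 * pi) has_vector_derivative 1) (at x)"
      by (auto intro!: derivative_eq_intros)
    from vector_diff_chain_at[OF this P]
    have "((\<lambda>x. P (x + 2 * pi)) has_vector_derivative F x) (at x)"
      by (simp add: o_def per)
    from has_vector_derivative_diff[OF this P[of x]] show ?thesis by simp
  qed
  then have "(\<lambda>x. P (x + 2 * pi) - P x) x = (\<lambda>x. P (x + 2 * pi) - P x) y" for x y
    using has_vector_derivative_zero_constant[of UNIV "\<lambda>x. P (x + 2 * pi) - P x"]
    by (metis UNIV_I convex_UNIV has_vector_derivative_at_within)
  from this[of _ "- pi"] have "P (x + 2 * pi) - P x = P pi - P (- pi)" for x by simp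
  moreover have "integral {- pi..pi} F = P pi - P (- pi)"
    using P by (intro integral_unique fundamental_theorem_of_calculus)
       (auto intro: has_vector_derivative_at_within)
  ultimately have "P (x + 2 * pi) = P x + integral {- pi..pi} F" for x
    by (metis diff_eq_eq add.commute)
  with P show ?thesis using that by blast
qed

lemma periodic_integral_shift:
  fixes F :: "real \<Rightarrow> 'a::euclidean_space"
  assumes F: "continuous_on UNIV F" and per: "\<And>x. F (x + 2 * pi) = F x"
  shows "integral {- pi..pi} (\<lambda>x. F (x + \<theta>)) = integral {- pi..pi} F"
proof -
  obtain P where P: "\<And>x. (P has_vector_derivative F x) (at x)"
    and per: "\<And>x. P (x + 2 * pi) = P x + integral {- pi..pi} F"
    using periodic_antiderivative[OF assms] by blast
  have "integral {- pi..pi} (\<lambda>x. F (x + \<theta>)) = integral {- pi + \<theta>..pi + \<theta>} F"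
    using integral_shift[of "- pi" \<theta> pi F] F
    by (simp add: o_def continuous_on_subset)
  also have "\<dots> = P (pi + \<theta>) - P (- pi + \<theta>)"
    using P by (intro integral_unique fundamental_theorem_of_calculus)
       (auto intro: has_vector_derivative_at_within)
  also have "pi + \<theta> = - pi + \<theta> + 2 * pi" by simp
  finally show ?thesis unfolding per by simp
qed

lemma periodic_integral_deriv:
  fixes F :: "real \<Rightarrow> 'a::banach"
  assumes "\<And>x. (F has_vector_derivative F' x) (at x)" and "\<And>x. F (x + 2 * pi) = F x"
  shows "integral {- pi..pi} F' = 0"
proof -
  have "(F' has_integral F pi - F (- pi)) {- pi..pi}"
    using assms(1)
    by (intro fundamental_theorem_of_calculus) (auto intro: has_vector_derivative_at_within)
  then show ?thesis
    using assms(2)[of "- pi"] by (simp add: integral_unique)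
qed

text \<open>One component of \<open>fourier_coeff\<close>, written with \<open>cis\<close>;
  \<open>fourier_coeff_nth\<close> links the two.\<close>

definition fc :: "(real \<Rightarrow> real) \<Rightarrow> int \<Rightarrow> complex" where
  "fc f k = 1 / (2 * pi) * integral {- pi..pi} (\<lambda>x. of_real (f x) * cis (- (k * x)))"

lemma cis_int_periodic: "cis (real_of_int k * (x + 2 * pi)) = cis (k * x)"
proof -
  have "cis (real_of_int k * (x + 2 * pi)) = cis (k * x) * cis (2 * pi * k)"
    by (simp add: cis_mult algebra_simps)
  then show ?thesis by simp
qed

lemma cis_int_periodic': "cis (- (real_of_int k * (x + 2 * pi))) = cis (- (k * x))"
  using cis_int_periodic[of "- k" x] by simp

lemma continuous_on_cis_compose [continuous_intros]:
  "continuous_on S f \<Longrightarrow> continuous_on S (\<lambda>x. cis (f x))"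
  unfolding cis_conv_exp by (intro continuous_intros)

lemma integral_of_real_complex:
  "f integrable_on S \<Longrightarrow> integral S (\<lambda>x. of_real (f x) :: complex) = of_real (integral S f)"
  using integral_linear[of f S "of_real :: real \<Rightarrow> complex"] bounded_linear_of_real
  by (simp add: o_def)

lemma fc_integrable:
  assumes "continuous_on UNIV f"
  shows "(\<lambda>x. of_real (f x) * cis (- (real_of_int k * x))) integrable_on {- pi..pi}"
  using assms by (intro integrable_continuous_real continuous_intros)
    (auto intro: continuous_on_subset)

lemma fc_add:
  assumes "continuous_on UNIV f" "continuous_on UNIV g"
  shows "fc (\<lambda>x. f x + g x) k = fc f k + fc g k"
  using assms unfolding fc_def
  by (simp add: distrib_right distrib_left integral_add fc_integrable)

lemma fc_diff:
  assumes "continuous_on UNIV f" "continuous_on UNIV g"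
  shows "fc (\<lambda>x. f x - g x) k = fc f k - fc g k"
  using assms unfolding fc_def
  by (simp add: left_diff_distrib right_diff_distrib integral_diff fc_integrable)

lemma fc_scale: "fc (\<lambda>x. c * f x) k = of_real c * fc f k"
  unfolding fc_def
  by (simp add: mult.assoc)

lemma fc_bound:
  assumes "continuous_on UNIV f" "\<And>x. \<bar>f x\<bar> \<le> M"
  shows "norm (fc f k) \<le> M"
proof -
  have "norm (integral {- pi..pi} (\<lambda>x. of_real (f x) * cis (- (real_of_int k * x)))) \<le> M * (pi - (- pi))"
    using assms by (intro integral_bound continuous_intros)
      (auto intro: continuous_on_subset simp: norm_mult)
  then show ?thesis
    by (simp add: fc_def norm_mult norm_divide field_simps)
qed

lemma fc_shift:
  assumes f: "continuous_on UNIV f" and per: "\<And>x. f (x + 2 * pi) = f x"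
  shows "fc (\<lambda>x. f (x + \<theta>)) k = cis (k * \<theta>) * fc f k"
proof -
  let ?F = "\<lambda>x. of_real (f x) * cis (- (real_of_int k * x))"
  have "of_real (f (x + \<theta>)) * cis (- (real_of_int k * x)) = cis (k * \<theta>) * ?F (x + \<theta>)" for x
    by (simp add: cis_mult algebra_simps)
  then have "integral {- pi..pi} (\<lambda>x. of_real (f (x + \<theta>)) * cis (- (real_of_int k * x)))
      = cis (k * \<theta>) * integral {- pi..pi} (\<lambda>x. ?F (x + \<theta>))"
    by (simp only: integral_mult_right)
  also have "integral {- pi..pi} (\<lambda>x. ?F (x + \<theta>)) = integral {- pi..pi} ?F"
    by (rule periodic_integral_shift)
       (intro continuous_intros f, simp add: per cis_int_periodic')
  finally show ?thesis by (simp add: fc_def)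
qed

lemma has_vector_derivative_cis_scaled:
  "((\<lambda>x. cis (a * x)) has_vector_derivative (\<i> * a * cis (a * x))) (at x within S)"
proof -
  have "((\<lambda>z. exp (\<i> * (of_real a * z))) has_field_derivative
      (\<i> * a * exp (\<i> * (of_real a * of_real x)))) (at (of_real x))"
    by (rule derivative_eq_intros refl | simp)+
  from has_vector_derivative_real_field[OF this] show ?thesis
    by (simp add: cis_conv_exp has_vector_derivative_at_within)
qed

lemma fc_deriv:
  assumes f: "\<And>x. (f has_real_derivative f' x) (at x)"
    and f': "continuous_on UNIV f'" and per: "\<And>x. f (x + 2 * pi) = f x"
  shows "fc f' k = \<i> * k * fc f k"
proof -
  let ?e = "\<lambda>x. cis (- (real_of_int k * x))"
  have cont: "continuous_on UNIV f"
    using f by (meson DERIV_continuous_on has_field_derivative_at_within)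
  have D: "((\<lambda>x. of_real (f x) * ?e x) has_vector_derivative
      of_real (f' x) * ?e x - (\<i> * k) * (of_real (f x) * ?e x)) (at x)" for x
  proof -
    have 1: "((\<lambda>x. of_real (f x) :: complex) has_vector_derivative of_real (f' x)) (at x)"
      using f[of x] by (simp add: has_real_derivative_iff_has_vector_derivative
        has_vector_derivative_of_real)
    show ?thesis
      using has_vector_derivative_mult[OF 1 has_vector_derivative_cis_scaled[of "- real_of_int k" x UNIV]]
      by (simp add: algebra_simps)
  qed
  have "integral {- pi..pi} (\<lambda>x. of_real (f' x) * ?e x - (\<i> * k) * (of_real (f x) * ?e x)) = 0"
    by (rule periodic_integral_deriv[OF D]) (simp add: per cis_int_periodic')
  then have "integral {- pi..pi} (\<lambda>x. of_real (f' x) * ?e x) =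
      (\<i> * k) * integral {- pi..pi} (\<lambda>x. of_real (f x) * ?e x)"
    using fc_integrable[OF cont, of k] fc_integrable[OF f', of k]
    by (subst (asm) integral_diff) (auto intro!: integrable_on_mult_right)
  then show ?thesis by (simp add: fc_def algebra_simps)
qed

lemma fc_cnj: "fc f (- k) = cnj (fc f k)"
  by (simp add: fc_def integral_cnj cis_cnj)

text \<open>Since (1 + cos x) / 2 = 1/2 + (cis x + cis (- x)) / 4, multiplication by it mixes only
  the modes k - 1, k and k + 1. The vanishing of all coefficients is therefore preserved, and the
  induction has to run over all k at once.\<close>

lemma fc_cis_power_zero:
  fixes f :: "real \<Rightarrow> real"
  assumes f: "continuous_on UNIV f" and z: "\<And>k. fc f k = 0"
  shows "integral {- pi..pi} (\<lambda>x. of_real (f x * ((1 + cos x) / 2) ^ n) * cis (- (real_of_int k * x))) = 0"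
proof (induction n arbitrary: k)
  case 0
  then show ?case using z[of k] by (simp add: fc_def)
next
  case (Suc n)
  let ?G = "\<lambda>k x. of_real (f x * ((1 + cos x) / 2) ^ n) * cis (- (real_of_int k * x)) :: complex"
  have int: "?G k integrable_on {- pi..pi}" for k
    using f by (intro integrable_continuous_real continuous_intros) (auto intro: continuous_on_subset)
  have "of_real (f x * ((1 + cos x) / 2) ^ Suc n) * cis (- (real_of_int k * x)) =
      (1/2) * ?G k x + ((1/4) * ?G (k - 1) x + (1/4) * ?G (k + 1) x)" for x
  proof -
    have c: "of_real (cos x) = (cis x + cis (- x)) / 2"
      by (simp add: complex_eq_iff)
    have "(1/2) * ?G k x + ((1/4) * ?G (k - 1) x + (1/4) * ?G (k + 1) x) =
      of_real (f x * ((1 + cos x) / 2) ^ n) * (1/2 * cis (- (real_of_int k * x)) +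
       1/4 * (cis (- (real_of_int k * x)) * cis x) + 1/4 * (cis (- (real_of_int k * x)) * cis (- x)))"
      unfolding cis_mult by (simp add: algebra_simps)
    also have "\<dots> = of_real (f x * ((1 + cos x) / 2) ^ n) * cis (- (real_of_int k * x)) * ((1 + of_real (cos x)) / 2)"
      unfolding c by (simp add: algebra_simps)
    finally show ?thesis by simp
  qed
  then have "integral {- pi..pi} (\<lambda>x. of_real (f x * ((1 + cos x) / 2) ^ Suc n) * cis (- (real_of_int k * x))) =
    integral {- pi..pi} (\<lambda>x. (1/2) * ?G k x + ((1/4) * ?G (k - 1) x + (1/4) * ?G (k + 1) x))"
    by presburger
  also have "\<dots> = (1/2) * integral {- pi..pi} (?G k) + ((1/4) * integral {- pi..pi} (?G (k - 1)) + (1/4) * integral {- pi..pi} (?G (k + 1)))"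
    using int by (simp only: integral_add integrable_add integrable_on_mult_right integral_mult_right)
  also have "\<dots> = 0" by (simp only: Suc.IH mult_zero_right add_0_left)
  finally show ?case .
qed

text \<open>Testing against the powers of \<open>(1 + cos x) / 2\<close>, which concentrate at \<open>0\<close>.\<close>

lemma fourier_unique_0:
  fixes f :: "real \<Rightarrow> real"
  assumes f: "continuous_on UNIV f" and z: "\<And>k. fc f k = 0"
  shows "f 0 \<le> 0"
proof (rule ccontr)
  assume "\<not> f 0 \<le> 0"
  define e where "e = f 0 / 2"
  have e: "e > 0" using \<open>\<not> f 0 \<le> 0\<close> by (simp add: e_def)
  let ?t = "\<lambda>x::real. (1 + cos x) / 2"
  obtain d0 where d0: "d0 > 0" "\<And>x::real. \<bar>x\<bar> < d0 \<Longrightarrow> \<bar>f x - f 0\<bar> < e"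
    using f[unfolded continuous_on_iff, rule_format, of 0 e] e
    by (auto simp: dist_real_def)
  define d where "d = min (d0 / 2) 1"
  have d: "d > 0" "d \<le> 1" "d < d0" using d0 by (auto simp: d_def)
  have fge: "f x \<ge> e" if "\<bar>x\<bar> \<le> d" for x :: real
    using d0(2)[of x] that d unfolding e_def by linarith
  have "compact (f ` {- pi..pi})"
    using f by (intro compact_continuous_image) (auto intro: continuous_on_subset)
  then obtain M where M: "M > 0" "\<And>x::real. x \<in> {- pi..pi} \<Longrightarrow> \<bar>f x\<bar> \<le> M"
    using compact_imp_bounded bounded_pos by (metis image_eqI real_norm_def)
  \<comment> \<open>The weight is at most \<open>r\<close> outside [-d, d] and at least
    \<open>r'\<close> on [0, d/2]; halving d is what makes \<open>r < r'\<close> strict.\<close>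
  define r r' where "r = ?t d" and "r' = ?t (d / 2)"
  have pi1: "1 < pi" using pi_gt3 by simp
  have rr: "0 < r" "r < r'"
  proof -
    have "cos d < cos (d / 2)" using d pi1 by (intro cos_monotone_0_pi) auto
    then show "r < r'" by (simp add: r_def r'_def)
    have "cos d > 0" using d pi_gt3 by (intro cos_gt_zero_pi) auto
    then show "0 < r" by (simp add: r_def)
  qed
  have ut: "0 \<le> ?t x" for x :: real
  proof -
    have "0 \<le> 1 + cos x" using cos_ge_minus_one[of x] by linarith
    then show ?thesis by simp
  qed
  have tle: "?t x \<le> r" if "x \<in> {- pi..pi}" "\<bar>x\<bar> > d" for x
  proof -
    have "cos \<bar>x\<bar> \<le> cos d" using that d by (intro cos_monotone_0_pi_le) auto
    then show ?thesis by (simp add: r_def)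
  qed
  \<comment> \<open>For |x| \<le> d the integrand is at least \<open>e\<close> times the weight;
    elsewhere replacing it by that costs at most \<open>(M + e) * r ^ n\<close>. The total integral
    vanishes, so the mass of the weight is O(\<open>r ^ n\<close>), although [0, d/2] alone
    contributes an amount of order \<open>r' ^ n\<close>.\<close>
  have key: "e * (d / 2) * r' ^ n \<le> 2 * pi * ((M + e) * r ^ n)" for n
  proof -
    let ?p = "\<lambda>x. ?t x ^ n"
    have int: "?p integrable_on {a..b}" for a b :: real
      by (intro integrable_continuous_real continuous_intros) auto
    have intf: "(\<lambda>x. f x * ?p x) integrable_on {- pi..pi}"
      using f by (intro integrable_continuous_real continuous_intros) (auto intro: continuous_on_subset)
    have "integral {- pi..pi} (\<lambda>x. of_real (f x * ?p x) :: complex) = 0"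
      using fc_cis_power_zero[OF f z, of n 0] by simp
    then have 0: "integral {- pi..pi} (\<lambda>x. f x * ?p x) = 0"
      using intf by (simp add: integral_of_real_complex del: of_real_mult)
    have pw: "e * ?p x - (M + e) * r ^ n \<le> f x * ?p x" if x: "x \<in> {- pi..pi}" for x
    proof (cases "\<bar>x\<bar> \<le> d")
      case True
      then have "e * ?p x \<le> f x * ?p x"
        using fge ut by (intro mult_right_mono) auto
      moreover have "(M + e) * r ^ n \<ge> 0" using M e rr by simp
      ultimately show ?thesis by linarith
    next
      case False
      have p: "?p x \<le> r ^ n" using tle[of x] x False ut by (intro power_mono) auto
      have "- (f x * ?p x) \<le> M * ?p x"
        using M(2)[OF x] ut mult_right_mono[of "- f x" M "?p x"] by (simp add: abs_le_iff)
      then have "e * ?p x - f x * ?p x \<le> (M + e) * ?p x" by (simp add: algebra_simps)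
      also have "\<dots> \<le> (M + e) * r ^ n" using p M e by (intro mult_left_mono) auto
      finally show ?thesis by simp
    qed
    have "integral {- pi..pi} (\<lambda>x. e * ?p x - (M + e) * r ^ n) \<le> integral {- pi..pi} (\<lambda>x. f x * ?p x)"
      using pw intf int by (intro integral_le integrable_diff integrable_on_mult_right) auto
    moreover have "integral {- pi..pi} (\<lambda>x. e * ?p x - (M + e) * r ^ n) =
        e * integral {- pi..pi} ?p - 2 * pi * ((M + e) * r ^ n)"
      using int by (subst integral_diff) (auto intro!: integrable_on_mult_right)
    ultimately have 1: "e * integral {- pi..pi} ?p \<le> 2 * pi * ((M + e) * r ^ n)" using 0 by simp
    have "integral {0..d/2} (\<lambda>x. r' ^ n) \<le> integral {0..d/2} ?p"
    proof (intro integral_le int)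
      fix x assume x: "x \<in> {0..d/2}"
      have "cos (d/2) \<le> cos x" using x d pi1 by (intro cos_monotone_0_pi_le) auto
      then show "r' ^ n \<le> ?p x" using rr by (intro power_mono) (auto simp: r'_def)
    qed auto
    also have "\<dots> \<le> integral {- pi..pi} ?p"
      using d pi1 ut by (intro integral_subset_le int) auto
    finally have "d / 2 * r' ^ n \<le> integral {- pi..pi} ?p" using d by simp
    then have "e * (d / 2 * r' ^ n) \<le> e * integral {- pi..pi} ?p" using e by simp
    with 1 show ?thesis by simp
  qed
  have "(\<lambda>n. (r / r') ^ n) \<longlonglongrightarrow> 0" by (rule LIMSEQ_realpow_zero) (use rr in auto)
  then have "(\<lambda>n. 2 * pi * (M + e) * (r / r') ^ n) \<longlonglongrightarrow> 2 * pi * (M + e) * 0"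
    by (intro tendsto_mult tendsto_const)
  moreover have "e * (d / 2) \<le> 2 * pi * (M + e) * (r / r') ^ n" for n
  proof -
    have "e * (d / 2) * r' ^ n \<le> (2 * pi * (M + e) * (r / r') ^ n) * r' ^ n"
      using key[of n] rr by (simp add: power_divide)
    then show ?thesis using rr by (subst (asm) mult_le_cancel_right) auto
  qed
  ultimately have "e * (d / 2) \<le> 2 * pi * (M + e) * 0"
    by (intro LIMSEQ_le_const[of _ _ "e * (d / 2)"]) auto
  then show False using e d by (simp add: mult_le_0_iff)
qed

text \<open>Translates of f and of - f have vanishing coefficients too, so the one-sided bound at 0
  applies at every point with both signs. The modes n \<ge> 0 suffice because f is real.\<close>

lemma fourier_unique:
  assumes f: "continuous_on UNIV f" and per: "\<And>x. f (x + 2 * pi) = f x"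
    and z: "\<And>n::nat. fc f n = 0"
  shows "f x = 0"
proof -
  have z': "fc f k = 0" for k
  proof (cases "k \<ge> 0")
    case True then show ?thesis using z[of "nat k"] by simp
  next
    case False then show ?thesis using z[of "nat (- k)"] fc_cnj[of f "-k"] by simp
  qed
  have sh: "continuous_on UNIV (\<lambda>y. f (y + x))"
    using f by (intro continuous_on_compose2[OF f] continuous_intros) auto
  have "fc (\<lambda>y. f (y + x)) k = 0" for k
    using fc_shift[OF f per, of x k] z' by simp
  from fourier_unique_0[OF sh this] have 1: "f x \<le> 0" by simp
  have "fc (\<lambda>y. - f (y + x)) k = 0" for k
    using fc_scale[of "-1" "\<lambda>y. f (y + x)" k] fc_shift[OF f per, of x k] z' by simp
  from fourier_unique_0[OF _ this] sh have 2: "- f x \<le> 0" by (simp add: continuous_on_minus)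
  from 1 2 show ?thesis by simp
qed

section \<open>Fourier multipliers\<close>

lemma fc_const: "fc (\<lambda>_. c) (int n) = (if n = 0 then of_real c else 0)"
  using fc_deriv[of "\<lambda>_. c" "\<lambda>_. 0" "int n"] by (auto simp: fc_def scaleR_conv_of_real)

lemma fc_0_real: "fc f 0 = of_real (Re (fc f 0))"
  using fc_cnj[of f 0] by (simp add: complex_eq_iff)

text \<open>Turns an identity between coefficients into a classical second derivative. Series with
  coefficients of order 1 / n squared cannot be differentiated twice term by term; instead R is
  integrated twice, and by uniqueness the result differs from \<phi> by a constant.\<close>

lemma fc_second_antiderivative:
  assumes \<phi>: "continuous_on UNIV \<phi>" "\<And>x. \<phi> (x + 2 * pi) = \<phi> x"
    and R: "continuous_on UNIV R" "\<And>x. R (x + 2 * pi) = R x"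
    and fc: "\<And>n::nat. fc R n = - (of_nat n)\<^sup>2 * fc \<phi> n"
  obtains \<phi>' where "\<And>x. (\<phi> has_real_derivative \<phi>' x) (at x)"
    and "\<And>x. (\<phi>' has_real_derivative R x) (at x)"
proof -
  have int: "integral {- pi..pi} F = 0" if "fc F 0 = 0" "continuous_on UNIV F" for F :: "real \<Rightarrow> real"
  proof -
    have "F integrable_on {- pi..pi}"
      using that by (intro integrable_continuous_real) (auto intro: continuous_on_subset)
    then show ?thesis
      using that by (simp add: fc_def integral_of_real_complex)
  qed
  \<comment> \<open>Mean zero makes the antiderivative periodic; subtracting its own mean returns to
    the same class, so the step can be applied twice.\<close>
  have anti: "\<exists>P. (\<forall>x. (P has_real_derivative F x) (at x)) \<and> (\<forall>x. P (x + 2 * pi) = P x) \<and> fc P 0 = 0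
        \<and> continuous_on UNIV P"
    if F: "continuous_on UNIV F" "\<And>x. F (x + 2 * pi) = F x" "fc F 0 = 0" for F
  proof -
    obtain P where P: "\<And>x. (P has_vector_derivative F x) (at x)"
      and per: "\<And>x. P (x + 2 * pi) = P x + integral {- pi..pi} F"
      using periodic_antiderivative[OF F(1,2)] by blast
    have per: "P (x + 2 * pi) = P x" for x using per int[OF F(3,1)] by simp
    have d: "(P has_real_derivative F x) (at x)" for x
      using P by (simp add: has_real_derivative_iff_has_vector_derivative)
    have c: "continuous_on UNIV P"
      using d by (meson DERIV_continuous_on has_field_derivative_at_within)
    have "fc (\<lambda>x. P x - Re (fc P 0)) 0 = 0"
      using fc_diff[OF c, of "\<lambda>_. Re (fc P 0)" 0] fc_const[of "Re (fc P 0)" 0] fc_0_real[of P] by simp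
    moreover have "((\<lambda>x. P x - Re (fc P 0)) has_real_derivative F x) (at x)" for x
      using d[of x] by (auto intro!: derivative_eq_intros)
    ultimately show ?thesis using per c
      by (intro exI[of _ "\<lambda>x. P x - Re (fc P 0)"]) (auto intro!: continuous_intros)
  qed
  have "fc R 0 = 0" using fc[of 0] by simp
  from anti[OF R this] obtain S where S: "\<And>x. (S has_real_derivative R x) (at x)"
    "\<And>x. S (x + 2 * pi) = S x" "fc S 0 = 0" "continuous_on UNIV S" by blast
  from anti[OF S(4,2,3)] obtain W where W: "\<And>x. (W has_real_derivative S x) (at x)"
    "\<And>x. W (x + 2 * pi) = W x" "fc W 0 = 0" "continuous_on UNIV W" by blast
  have eq: "fc W n = fc \<phi> n" if "n > 0" for n :: nat
  proof -
    have "fc R n = \<i> * n * (\<i> * n * fc W n)"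
      using fc_deriv[OF S(1) R(1) S(2), of "int n"] fc_deriv[OF W(1) S(4) W(2), of "int n"] by simp
    then have "- (of_nat n)\<^sup>2 * fc W n = - (of_nat n)\<^sup>2 * fc \<phi> n"
      using fc[of n] by (auto simp: power2_eq_square algebra_simps)
    then show ?thesis using that by auto
  qed
  define c where "c = Re (fc (\<lambda>x. W x - \<phi> x) 0)"
  have "W x - \<phi> x - c = 0" for x
  proof (rule fourier_unique[where f = "\<lambda>x. W x - \<phi> x - c"])
    show "continuous_on UNIV (\<lambda>x. W x - \<phi> x - c)" using W \<phi> by (intro continuous_intros)
    show "W (x + 2 * pi) - \<phi> (x + 2 * pi) - c = W x - \<phi> x - c" for x using W \<phi> by simp
    fix n :: nat
    have "continuous_on UNIV (\<lambda>x. W x - \<phi> x)" using W \<phi> by (intro continuous_intros)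
    then have "fc (\<lambda>x. W x - \<phi> x - c) n = fc (\<lambda>x. W x - \<phi> x) n - fc (\<lambda>_. c) n"
      by (intro fc_diff) auto
    also have "\<dots> = 0"
      using eq[of n] fc_diff[OF W(4) \<phi>(1)] fc_0_real[of "\<lambda>x. W x - \<phi> x"]
      fc_const[of c n] by (cases "n = 0") (auto simp: c_def)
    finally show "fc (\<lambda>x. W x - \<phi> x - c) n = 0" .
  qed
  then have "\<phi> = (\<lambda>x. W x - c)" by (auto simp: fun_eq_iff algebra_simps)
  then have "(\<phi> has_real_derivative S x) (at x)" for x
    using W(1)[of x] by (auto intro!: derivative_eq_intros)
  with S(1) show ?thesis using that by blast
qed

lemma fc_continuous_param:
  assumes "continuous_on UNIV (\<lambda>(p :: 'a::topological_space, x). f p x)"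
  shows "continuous_on UNIV (\<lambda>p. fc (f p) k)"
proof -
  have "continuous_on (UNIV \<times> cbox (- pi) pi)
      (\<lambda>(p, x). of_real (f p x) * cis (- (real_of_int k * x)))"
    unfolding case_prod_beta
    by (intro continuous_intros continuous_on_subset[OF assms[unfolded case_prod_beta], THEN continuous_on_of_real]) auto
  then have "continuous_on UNIV (\<lambda>p. integral (cbox (- pi) pi) (\<lambda>x. of_real (f p x) * cis (- (real_of_int k * x))))"
    by (intro integral_continuous_on_param) (simp add: case_prod_beta)
  then show ?thesis
    unfolding fc_def by (intro continuous_intros) simp
qed

lemma fc_uniform_limit:
  assumes u: "uniform_limit UNIV f g sequentially" and c: "\<And>N. continuous_on UNIV (f N)"
  shows "(\<lambda>N. fc (f N) k) \<longlonglongrightarrow> fc g k"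
proof -
  have g: "continuous_on UNIV g" by (rule uniform_limit_theorem[OF _ u]) (auto simp: c)
  show ?thesis
  proof (rule LIMSEQ_I)
    fix e :: real assume e: "e > 0"
    then have "\<forall>\<^sub>F N in sequentially. \<forall>x. dist (f N x) (g x) < e / 2"
      using u uniform_limitD[OF u, of "e / 2"] by simp
    then obtain M where M: "\<And>N x. N \<ge> M \<Longrightarrow> \<bar>f N x - g x\<bar> < e / 2"
      by (auto simp: eventually_sequentially dist_real_def)
    have "norm (fc (f N) k - fc g k) < e" if "N \<ge> M" for N
    proof -
      have "norm (fc (\<lambda>x. f N x - g x) k) \<le> e / 2"
        using M[OF that] c g by (intro fc_bound continuous_intros) (auto intro: less_imp_le)
      then show ?thesis using e fc_diff[OF c g] by simp
    qed
    then show "\<exists>M. \<forall>N\<ge>M. norm (fc (f N) k - fc g k) < e" by blast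
  qed
qed

lemma integral_cis_int:
  "integral {- pi..pi} (\<lambda>x. cis (real_of_int j * x)) = (if j = 0 then 2 * pi else 0)"
proof (cases "j = 0")
  case False
  have "((\<lambda>x. cis (real_of_int j * x) / (\<i> * j)) has_vector_derivative cis (real_of_int j * x)) (at x)" for x :: real
    using has_vector_derivative_mult_left[OF has_vector_derivative_cis_scaled[of j x UNIV], of "1 / (\<i> * j)"]
      False by (simp add: field_simps)
  from periodic_integral_deriv[OF this] False show ?thesis
    by (simp only: cis_int_periodic) simp
qed (simp add: scaleR_conv_of_real)

text \<open>Re is half the sum with the conjugate, which puts w / 2 on mode n. For n = 0 both halves
  fall on the same mode and leave Re w.\<close>

lemma fc_monomial:
  "fc (\<lambda>x. Re (w * cis (real n * x))) (int k) =
     (if n = k then (if n = 0 then of_real (Re w) else w / 2) else 0)"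
proof -
  have int: "(\<lambda>x. c * cis (real_of_int j * x)) integrable_on {- pi..pi}" for c j
    by (intro integrable_continuous_real continuous_intros)
  have "of_real (Re (w * cis (real n * x))) * cis (- (real_of_int (int k) * x)) =
      (w / 2) * cis (real_of_int (int n - int k) * x) + (cnj w / 2) * cis (real_of_int (- int n - int k) * x)" for x
  proof -
    have r: "of_real (Re z) = (z + cnj z) / 2" for z by (simp add: complex_eq_iff)
    have "of_real (Re (w * cis (real n * x))) * cis (- (real_of_int (int k) * x)) =
      (w / 2) * (cis (real n * x) * cis (- (real k * x))) + (cnj w / 2) * (cis (- (real n * x)) * cis (- (real k * x)))"
      unfolding r by (simp add: cis_cnj algebra_simps add_divide_distrib)
    also have "\<dots> = (w / 2) * cis (real_of_int (int n - int k) * x) + (cnj w / 2) * cis (real_of_int (- int n - int k) * x)"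
    proof -
      have "real n * x + - (real k * x) = real_of_int (int n - int k) * x"
        "- (real n * x) + - (real k * x) = real_of_int (- int n - int k) * x"
        by (simp_all add: algebra_simps)
      then show ?thesis unfolding cis_mult by presburger
    qed
    finally show ?thesis .
  qed
  then have "fc (\<lambda>x. Re (w * cis (real n * x))) (int k) = 1 / (2 * pi) *
    ((w / 2) * (if int n - int k = 0 then 2 * pi else 0) + (cnj w / 2) * (if - int n - int k = 0 then 2 * pi else 0))"
    unfolding fc_def by (simp only: integral_add int integral_mult_right integral_cis_int)
  also have "\<dots> = (if n = k then (if n = 0 then of_real (Re w) else w / 2) else 0)"
    by (auto simp: field_simps complex_eq_iff)
  finally show ?thesis .
qed

section \<open>One-sided trigonometric series with quadratically decaying coefficients\<close>

definition ser :: "(nat \<Rightarrow> complex) \<Rightarrow> real \<Rightarrow> real" where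
  "ser z x = (\<Sum>n. Re (z n * cis (real n * x)))"

definition inv_sq_sum :: real where
  "inv_sq_sum = (\<Sum>n. 1 / (real n + 1)\<^sup>2)"

lemma summable_inv_sq: "summable (\<lambda>n. 1 / (real n + 1)\<^sup>2)"
proof -
  have "summable (\<lambda>n. inverse (real n ^ 2))"
    by (rule inverse_power_summable) simp
  then have "summable (\<lambda>n. inverse (real (Suc n) ^ 2))"
    by (subst summable_Suc_iff)
  then show ?thesis by (simp add: inverse_eq_divide add.commute)
qed

lemma inv_sq_sum_pos: "inv_sq_sum > 0"
  unfolding inv_sq_sum_def by (rule suminf_pos[OF summable_inv_sq]) simp

lemma ser_term_bound:
  assumes "\<And>n. norm (z n) \<le> B / (real n + 1)\<^sup>2"
  shows "\<bar>Re (z n * cis (real n * x))\<bar> \<le> B * (1 / (real n + 1)\<^sup>2)"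
  using abs_Re_le_cmod[of "z n * cis (real n * x)"] assms[of n] by (simp add: norm_mult)

lemma ser_summable:
  assumes "\<And>n. norm (z n) \<le> B / (real n + 1)\<^sup>2"
  shows "summable (\<lambda>n. Re (z n * cis (real n * x)))"
proof (rule summable_comparison_test'[OF summable_mult[OF summable_inv_sq, of B], of 0])
  show "norm (Re (z n * cis (real n * x))) \<le> B * (1 / (real n + 1)\<^sup>2)" for n
    unfolding real_norm_def by (rule ser_term_bound) (rule assms)
qed

lemma ser_bound:
  assumes "\<And>n. norm (z n) \<le> B / (real n + 1)\<^sup>2"
  shows "\<bar>ser z x\<bar> \<le> B * inv_sq_sum"
proof -
  have s: "summable (\<lambda>n. \<bar>Re (z n * cis (real n * x))\<bar>)"
  proof (rule summable_comparison_test'[OF summable_mult[OF summable_inv_sq, of B], of 0])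
    show "norm \<bar>Re (z n * cis (real n * x))\<bar> \<le> B * (1 / (real n + 1)\<^sup>2)" for n
      unfolding real_norm_def abs_idempotent by (rule ser_term_bound) (rule assms)
  qed
  have "\<bar>ser z x\<bar> \<le> (\<Sum>n. \<bar>Re (z n * cis (real n * x))\<bar>)"
    unfolding ser_def using s by (rule summable_rabs)
  also have "\<dots> \<le> (\<Sum>n. B * (1 / (real n + 1)\<^sup>2))"
    by (rule suminf_le[OF ser_term_bound[OF assms] s summable_mult[OF summable_inv_sq]])
  also have "\<dots> = B * inv_sq_sum"
    unfolding inv_sq_sum_def using summable_inv_sq by (rule suminf_mult)
  finally show ?thesis .
qed

lemma ser_diff:
  assumes "\<And>n. norm (z n) \<le> B / (real n + 1)\<^sup>2" "\<And>n. norm (w n) \<le> B' / (real n + 1)\<^sup>2"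
  shows "ser (\<lambda>n. z n - w n) x = ser z x - ser w x"
proof -
  have "Re ((z n - w n) * cis (real n * x)) = Re (z n * cis (real n * x)) - Re (w n * cis (real n * x))" for n
    by (simp add: left_diff_distrib)
  then show ?thesis
    unfolding ser_def
    using suminf_diff[OF ser_summable[of z B x] ser_summable[of w B' x]] assms by presburger
qed

lemma ser_uniform_limit:
  assumes "\<And>p n. norm (z p n) \<le> B / (real n + 1)\<^sup>2"
  shows "uniform_limit UNIV (\<lambda>N p. \<Sum>n<N. Re (z p n * cis (real n * X p))) (\<lambda>p. ser (z p) (X p)) sequentially"
  unfolding ser_def
proof (rule Weierstrass_m_test)
  show "summable (\<lambda>n. B * (1 / (real n + 1)\<^sup>2))" by (rule summable_mult[OF summable_inv_sq])
  show "norm (Re (z p n * cis (real n * X p))) \<le> B * (1 / (real n + 1)\<^sup>2)" for n p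
    unfolding real_norm_def by (rule ser_term_bound) (rule assms)
qed

lemma ser_continuous:
  fixes z :: "'p::topological_space \<Rightarrow> nat \<Rightarrow> complex"
  assumes "\<And>p n. norm (z p n) \<le> B / (real n + 1)\<^sup>2"
    and "\<And>n. continuous_on UNIV (\<lambda>p. z p n)" and "continuous_on UNIV X"
  shows "continuous_on UNIV (\<lambda>p. ser (z p) (X p))"
proof (rule uniform_limit_theorem[OF _ ser_uniform_limit[OF assms(1)]])
  show "\<forall>\<^sub>F N in sequentially. continuous_on UNIV (\<lambda>p. \<Sum>n<N. Re (z p n * cis (real n * X p)))"
    using assms(2,3)
    by (intro always_eventually allI continuous_on_sum continuous_on_Re continuous_on_mult
      continuous_on_cis_compose continuous_on_const) auto
qed simp

lemma ser_periodic: "ser z (x + 2 * pi) = ser z x"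
proof -
  have "cis (real n * (x + 2 * pi)) = cis (real n * x)" for n
    using cis_int_periodic[of "int n" x] by simp
  then show ?thesis by (simp only: ser_def)
qed

text \<open>The k-th coefficient of the partial sums is constant once N > k, and coefficients pass
  to uniform limits.\<close>

lemma fc_ser:
  assumes "\<And>n. norm (z n) \<le> B / (real n + 1)\<^sup>2"
  shows "fc (ser z) (int k) = (if k = 0 then of_real (Re (z 0)) else z k / 2)"
proof -
  let ?f = "\<lambda>N x. \<Sum>n<N. Re (z n * cis (real n * x))"
  have c: "continuous_on UNIV (?f N)" for N by (intro continuous_intros)
  have eq: "fc (?f N) k = (\<Sum>n<N. fc (\<lambda>x. Re (z n * cis (real n * x))) k)" for N
  proof (induction N)
    case 0 then show ?case using fc_const[of 0 k] by simp
  next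
    case (Suc N)
    have "fc (\<lambda>x. ?f N x + Re (z N * cis (real N * x))) k = fc (?f N) k + fc (\<lambda>x. Re (z N * cis (real N * x))) k"
      by (intro fc_add continuous_intros)
    with Suc show ?case by simp
  qed
  then have "fc (?f N) k = (if k = 0 then of_real (Re (z 0)) else z k / 2)" if "N > k" for N
    unfolding eq fc_monomial using that by simp
  then have "(\<lambda>N. fc (?f N) k) \<longlonglongrightarrow> (if k = 0 then of_real (Re (z 0)) else z k / 2)"
    by (intro tendsto_eventually eventually_sequentiallyI[of "Suc k"]) auto
  moreover have "(\<lambda>N. fc (?f N) k) \<longlonglongrightarrow> fc (ser z) k"
    using ser_uniform_limit[of "\<lambda>_. z" B "\<lambda>x. x"] assms by (intro fc_uniform_limit c) simp
  ultimately show ?thesis by (rule LIMSEQ_unique[THEN sym])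
qed

text \<open>A real function is determined by its modes \<open>n \<ge> 0\<close>; the conjugate modes account for the
  factor \<open>2\<close>. The value \<open>g 0\<close> must be real for \<open>g\<close> to act as a multiplier on the mean.\<close>

definition multop :: "(nat \<Rightarrow> complex) \<Rightarrow> (real \<Rightarrow> real) \<Rightarrow> real \<Rightarrow> real" where
  "multop g f = ser (\<lambda>n. (if n = 0 then 1 else 2) * g n * fc f n)"

lemma multop_coeff_bound:
  fixes g w :: "nat \<Rightarrow> complex"
  assumes "\<And>n. norm (g n) \<le> C / (real n + 1)\<^sup>2" "norm (w n) \<le> M"
  shows "norm ((if n = 0 then 1 else 2) * g n * w n) \<le> (2 * C * M) / (real n + 1)\<^sup>2"
proof -
  have "norm ((if n = 0 then 1 else 2) * g n * w n) \<le> 2 * (C / (real n + 1)\<^sup>2) * M"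
    unfolding norm_mult using assms(1)[of n] assms(2) order_trans[OF norm_ge_zero assms(1)[of n]]
    by (intro mult_mono) auto
  then show ?thesis by simp
qed

lemma multop_bound:
  assumes "\<And>n. norm (g n) \<le> C / (real n + 1)\<^sup>2" "continuous_on UNIV f" "\<And>x. \<bar>f x\<bar> \<le> M"
  shows "\<bar>multop g f x\<bar> \<le> 2 * C * M * inv_sq_sum"
  unfolding multop_def
  by (rule ser_bound, rule multop_coeff_bound[OF assms(1) fc_bound[OF assms(2,3)]])

lemma multop_diff:
  assumes "\<And>n. norm (g n) \<le> C / (real n + 1)\<^sup>2" "continuous_on UNIV f" "\<And>x. \<bar>f x\<bar> \<le> M"
    "continuous_on UNIV f'" "\<And>x. \<bar>f' x\<bar> \<le> M'"
  shows "multop g f x - multop g f' x = multop g (\<lambda>x. f x - f' x) x"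
  unfolding multop_def
  by (subst ser_diff[symmetric, OF multop_coeff_bound[OF assms(1) fc_bound[OF assms(2,3)]]
        multop_coeff_bound[OF assms(1) fc_bound[OF assms(4,5)]]])
     (simp add: fc_diff assms algebra_simps)

lemma multop_periodic: "multop g f (x + 2 * pi) = multop g f x"
  by (simp add: multop_def ser_periodic)

text \<open>The bound C is uniform in p, so the series converges uniformly in (p, x) jointly. With p
  = \<xi> this is what makes the fixed point map act on continuous functions of the pair (\<xi>, x),
  although the multipliers themselves move with the frequency.\<close>

lemma multop_continuous:
  fixes g :: "'p::topological_space \<Rightarrow> nat \<Rightarrow> complex"
  assumes "\<And>p n. norm (g p n) \<le> C / (real n + 1)\<^sup>2" "\<And>n. continuous_on UNIV (\<lambda>p. g p n)"
    and f: "continuous_on UNIV (\<lambda>(p, x). f p x)" and "\<And>p x. \<bar>f p x\<bar> \<le> M"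
  shows "continuous_on UNIV (\<lambda>(p, x). multop (g p) (f p) x)"
proof -
  have f': "continuous_on UNIV (f p)" for p
    using continuous_on_compose2[OF f, of UNIV "\<lambda>x. (p, x)"]
    by (simp add: continuous_on_Pair)
  have g2: "continuous_on UNIV (\<lambda>q. g (fst q) n)" for n
    by (rule continuous_on_compose2[OF assms(2)]) (auto intro: continuous_intros)
  have f2: "continuous_on UNIV (\<lambda>q. fc (f (fst q)) n)" for n
    by (rule continuous_on_compose2[OF fc_continuous_param[OF f]]) (auto intro: continuous_intros)
  show ?thesis
    unfolding multop_def case_prod_beta
    by (rule ser_continuous, rule multop_coeff_bound[OF assms(1) fc_bound[OF f' assms(4)]])
       (intro continuous_intros g2 f2)+
qed

lemma fc_multop:
  assumes "\<And>n. norm (g n) \<le> C / (real n + 1)\<^sup>2" "continuous_on UNIV f" "\<And>x. \<bar>f x\<bar> \<le> M" "Im (g 0) = 0"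
  shows "fc (multop g f) (int n) = g n * fc f n"
proof -
  have "Re (g 0 * fc f 0) = Re (g 0) * Re (fc f 0)" using assms(4) by simp
  moreover have "g 0 = of_real (Re (g 0))" using assms(4) by (simp add: complex_eq_iff)
  ultimately have "of_real (Re (g 0 * fc f 0)) = g 0 * fc f 0" using fc_0_real[of f] by (metis of_real_mult)
  then show ?thesis
    unfolding multop_def
    by (subst fc_ser[OF multop_coeff_bound[OF assms(1) fc_bound[OF assms(2,3)]]]) auto
qed

section \<open>Families with uniformly bounded derivatives\<close>

text \<open>A bound in \<open>C^n\<close>, uniform over the family indexed by A; later the index is
  the amplitude \<open>a\<close>. Derivatives are existentially quantified so that closure
  properties can exhibit explicit ones; \<open>ubd_deriv\<close> returns to
  \<open>deriv\<close>.\<close>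

primrec ubd :: "nat \<Rightarrow> 'i set \<Rightarrow> ('i \<Rightarrow> real \<Rightarrow> real) \<Rightarrow> bool" where
  "ubd 0 A f = (\<exists>C. \<forall>i\<in>A. \<forall>x. \<bar>f i x\<bar> \<le> C)"
| "ubd (Suc n) A f = ((\<exists>C. \<forall>i\<in>A. \<forall>x. \<bar>f i x\<bar> \<le> C) \<and>
     (\<exists>f'. (\<forall>i\<in>A. \<forall>x. (f i has_real_derivative f' i x) (at x)) \<and> ubd n A f'))"

lemma ubd_bound: "ubd n A f \<Longrightarrow> \<exists>C. \<forall>i\<in>A. \<forall>x. \<bar>f i x\<bar> \<le> C"
  by (cases n) auto

lemma ubd_0I: "(\<And>i x. i \<in> A \<Longrightarrow> \<bar>f i x\<bar> \<le> C) \<Longrightarrow> ubd 0 A f"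
  by (subst ubd.simps(1)) blast

lemma ubd_SucI:
  "(\<And>i x. i \<in> A \<Longrightarrow> (f i has_real_derivative f' i x) (at x)) \<Longrightarrow>
   (\<And>i x. i \<in> A \<Longrightarrow> \<bar>f i x\<bar> \<le> C) \<Longrightarrow> ubd n A f' \<Longrightarrow> ubd (Suc n) A f"
  by (subst ubd.simps(2)) blast

lemma ubd_SucE:
  assumes "ubd (Suc n) A f"
  obtains f' where "\<forall>i\<in>A. \<forall>x. (f i has_real_derivative f' i x) (at x)" "ubd n A f'"
  using assms by (subst (asm) ubd.simps(2)) blast

lemma ubd_Suc_imp: "ubd (Suc n) A f \<Longrightarrow> ubd n A f"
proof (induction n arbitrary: f)
  case (Suc n)
  from Suc.prems obtain f' where "\<forall>i\<in>A. \<forall>x. (f i has_real_derivative f' i x) (at x)" "ubd (Suc n) A f'"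
    and "\<exists>C. \<forall>i\<in>A. \<forall>x. \<bar>f i x\<bar> \<le> C"
    by (subst (asm) ubd.simps(2)) blast
  with Suc.IH[of f'] show ?case by (subst ubd.simps(2)) blast
qed auto

lemma ubd_cong:
  assumes "\<And>i. i \<in> A \<Longrightarrow> f i = g i"
  shows "ubd n A f \<Longrightarrow> ubd n A g"
  using assms by (cases n) fastforce+

lemma ubd_const: "(\<And>i. i \<in> A \<Longrightarrow> \<bar>k i\<bar> \<le> C) \<Longrightarrow> ubd n A (\<lambda>i x. k i)"
proof (induction n arbitrary: k C)
  case (Suc n)
  show ?case
    by (rule ubd_SucI[where f' = "\<lambda>i x. 0" and C = C]) (use Suc.prems Suc.IH[of "\<lambda>_. 0" 0] in auto)
qed auto

lemma ubd_add: "ubd n A f \<Longrightarrow> ubd n A g \<Longrightarrow> ubd n A (\<lambda>i x. f i x + g i x)"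
proof (induction n arbitrary: f g)
  case 0
  then obtain C D where "\<forall>i\<in>A. \<forall>x. \<bar>f i x\<bar> \<le> C" "\<forall>i\<in>A. \<forall>x. \<bar>g i x\<bar> \<le> D" by auto
  then have "\<forall>i\<in>A. \<forall>x. \<bar>f i x + g i x\<bar> \<le> C + D" by (meson abs_triangle_ineq add_mono order_trans)
  then show ?case by (intro ubd_0I[where C = "C + D"]) blast
next
  case (Suc n)
  obtain C D where b: "\<forall>i\<in>A. \<forall>x. \<bar>f i x\<bar> \<le> C" "\<forall>i\<in>A. \<forall>x. \<bar>g i x\<bar> \<le> D"
    using ubd_bound[OF Suc.prems(1)] ubd_bound[OF Suc.prems(2)] by blast
  obtain f' where d1: "\<forall>i\<in>A. \<forall>x. (f i has_real_derivative f' i x) (at x)" "ubd n A f'"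
    by (rule ubd_SucE[OF Suc.prems(1)])
  obtain g' where d2: "\<forall>i\<in>A. \<forall>x. (g i has_real_derivative g' i x) (at x)" "ubd n A g'"
    by (rule ubd_SucE[OF Suc.prems(2)])
  have b': "\<bar>f i x + g i x\<bar> \<le> C + D" if "i \<in> A" for i x
  proof -
    have "\<bar>f i x\<bar> \<le> C" "\<bar>g i x\<bar> \<le> D" using b that by blast+
    then show ?thesis by linarith
  qed
  show ?case
    by (rule ubd_SucI[OF DERIV_add b' Suc.IH[OF d1(2) d2(2)]]) (use d1 d2 in blast)+
qed

lemma ubd_mult: "ubd n A f \<Longrightarrow> ubd n A g \<Longrightarrow> ubd n A (\<lambda>i x. f i x * g i x)"
proof (induction n arbitrary: f g)
  case 0
  then obtain C D where b: "\<forall>i\<in>A. \<forall>x. \<bar>f i x\<bar> \<le> C" "\<forall>i\<in>A. \<forall>x. \<bar>g i x\<bar> \<le> D" by auto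
  have "\<bar>f i x * g i x\<bar> \<le> C * D" if "i \<in> A" for i x
  proof -
    have "\<bar>f i x\<bar> \<le> C" "\<bar>g i x\<bar> \<le> D" using b that by blast+
    then show ?thesis unfolding abs_mult by (intro mult_mono) auto
  qed
  then show ?case by (intro ubd_0I[where C = "C * D"]) blast
next
  case (Suc n)
  obtain C D where b: "\<forall>i\<in>A. \<forall>x. \<bar>f i x\<bar> \<le> C" "\<forall>i\<in>A. \<forall>x. \<bar>g i x\<bar> \<le> D"
    using ubd_bound[OF Suc.prems(1)] ubd_bound[OF Suc.prems(2)] by blast
  have b': "\<bar>f i x * g i x\<bar> \<le> C * D" if "i \<in> A" for i x
  proof -
    have "\<bar>f i x\<bar> \<le> C" "\<bar>g i x\<bar> \<le> D" using b that by blast+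
    then show ?thesis unfolding abs_mult by (intro mult_mono) auto
  qed
  obtain f' where d1: "\<forall>i\<in>A. \<forall>x. (f i has_real_derivative f' i x) (at x)" "ubd n A f'"
    by (rule ubd_SucE[OF Suc.prems(1)])
  obtain g' where d2: "\<forall>i\<in>A. \<forall>x. (g i has_real_derivative g' i x) (at x)" "ubd n A g'"
    by (rule ubd_SucE[OF Suc.prems(2)])
  have u: "ubd n A (\<lambda>i x. f' i x * g i x + g' i x * f i x)"
    by (rule ubd_add[OF Suc.IH[OF d1(2) ubd_Suc_imp[OF Suc.prems(2)]] Suc.IH[OF d2(2) ubd_Suc_imp[OF Suc.prems(1)]]])
  show ?case
    by (rule ubd_SucI[OF DERIV_mult b' u]) (use d1 d2 in blast)+
qed

lemma ubd_scale:
  assumes "\<And>i. i \<in> A \<Longrightarrow> \<bar>k i\<bar> \<le> C" "ubd n A f"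
  shows "ubd n A (\<lambda>i x. k i * f i x)"
  by (rule ubd_mult[OF ubd_const[of A k C] assms(2)]) (use assms(1) in auto)

lemma ubd_minus: "ubd n A f \<Longrightarrow> ubd n A (\<lambda>i x. - f i x)"
  using ubd_scale[of A "\<lambda>_. -1" 1 n f] by simp

lemma ubd_diff: "ubd n A f \<Longrightarrow> ubd n A g \<Longrightarrow> ubd n A (\<lambda>i x. f i x - g i x)"
  using ubd_add[OF _ ubd_minus, of n A f g] by simp

lemma ubd_shift: "ubd n A f \<Longrightarrow> ubd n A (\<lambda>i x. f i (x + \<theta> i))"
proof (induction n arbitrary: f)
  case 0
  then obtain C where "\<forall>i\<in>A. \<forall>x. \<bar>f i x\<bar> \<le> C" by auto
  then show ?case by (intro ubd_0I[where C = C]) blast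
next
  case (Suc n)
  obtain C where b: "\<forall>i\<in>A. \<forall>x. \<bar>f i x\<bar> \<le> C" using ubd_bound[OF Suc.prems(1)] by blast
  obtain f' where d: "\<forall>i\<in>A. \<forall>x. (f i has_real_derivative f' i x) (at x)" "ubd n A f'"
    by (rule ubd_SucE[OF Suc.prems(1)])
  show ?case
    by (rule ubd_SucI[OF DERIV_shift[THEN iffD1] _ Suc.IH[OF d(2)], where C = C]) (use d b in blast)+
qed

lemma ubd_cos_sin: "ubd n A (\<lambda>i x. cos x) \<and> ubd n A (\<lambda>i x. sin x)"
proof (induction n)
  case 0
  have "\<forall>i\<in>A. \<forall>x. \<bar>cos x\<bar> \<le> (1::real)" "\<forall>i\<in>A. \<forall>x. \<bar>sin x\<bar> \<le> (1::real)" by simp_all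
  then show ?case by (metis ubd.simps(1))
next
  case (Suc n)
  have "ubd (Suc n) A (\<lambda>i x. cos x)"
    by (rule ubd_SucI[where C = 1, OF _ _ ubd_minus[OF conjunct2[OF Suc]]])
       (auto intro!: derivative_eq_intros)
  moreover have "ubd (Suc n) A (\<lambda>i x. sin x)"
    by (rule ubd_SucI[where C = 1, OF _ _ conjunct1[OF Suc]])
       (auto intro!: derivative_eq_intros)
  ultimately show ?case by blast
qed

text \<open>The chain rule replaces \<open>D k\<close> by \<open>D (Suc k)\<close>, so the claim is
  proved for all k simultaneously. The outer functions may depend on the index and need bounds only
  on the range [-S, S] of the inner ones.\<close>

lemma ubd_comp:
  assumes D: "\<And>k i s. i \<in> A \<Longrightarrow> (D k i has_real_derivative D (Suc k) i s) (at s)"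
    and bd: "\<And>k. \<exists>C. \<forall>i\<in>A. \<forall>s. \<bar>s\<bar> \<le> S \<longrightarrow> \<bar>D k i s\<bar> \<le> C"
    and f: "\<And>i x. i \<in> A \<Longrightarrow> \<bar>f i x\<bar> \<le> S"
  shows "ubd n A f \<Longrightarrow> ubd n A (\<lambda>i x. D k i (f i x))"
proof (induction n arbitrary: k)
  case 0
  obtain C where "\<forall>i\<in>A. \<forall>s. \<bar>s\<bar> \<le> S \<longrightarrow> \<bar>D k i s\<bar> \<le> C" using bd by blast
  then have "\<forall>i\<in>A. \<forall>x. \<bar>D k i (f i x)\<bar> \<le> C" using f by blast
  then show ?case by (intro ubd_0I[where C = C]) blast
next
  case (Suc n)
  obtain f' where d: "\<forall>i\<in>A. \<forall>x. (f i has_real_derivative f' i x) (at x)" "ubd n A f'"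
    by (rule ubd_SucE[OF Suc.prems(1)])
  obtain C where C: "\<forall>i\<in>A. \<forall>s. \<bar>s\<bar> \<le> S \<longrightarrow> \<bar>D k i s\<bar> \<le> C" using bd by blast
  have "ubd n A (\<lambda>i x. D (Suc k) i (f i x) * f' i x)"
    by (rule ubd_mult[OF Suc.IH[OF ubd_Suc_imp[OF Suc.prems]] d(2)])
  then show ?case
  proof (rule ubd_SucI[where C = C, rotated 2])
    show "((\<lambda>x. D k i (f i x)) has_real_derivative D (Suc k) i (f i x) * f' i x) (at x)" if "i \<in> A" for i x
      using DERIV_chain2[of "D k i" "D (Suc k) i (f i x)" "f i" x "f' i x" UNIV] D d that by auto
    show "\<bar>D k i (f i x)\<bar> \<le> C" if "i \<in> A" for i x using C f that by auto
  qed
qed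

text \<open>Used to add the amplitude 0, at which the profile is set to zero: uniform bounds are
  first obtained on the punctured range, where division by \<open>a\<close> is possible.\<close>

lemma ubd_insert_zero:
  assumes "\<And>x. f i0 x = 0"
  shows "ubd n A f \<Longrightarrow> ubd n (insert i0 A) f"
  using assms
proof (induction n arbitrary: f)
  case 0
  then obtain C where "\<forall>i\<in>A. \<forall>x. \<bar>f i x\<bar> \<le> C" by auto
  then have "\<forall>i\<in>insert i0 A. \<forall>x. \<bar>f i x\<bar> \<le> max C 0" using 0 by (auto simp: le_max_iff_disj)
  then show ?case by (intro ubd_0I[where C = "max C 0"]) blast
next
  case (Suc n)
  obtain C where C: "\<forall>i\<in>A. \<forall>x. \<bar>f i x\<bar> \<le> C" using ubd_bound[OF Suc.prems(1)] by blast
  obtain f' where d: "\<forall>i\<in>A. \<forall>x. (f i has_real_derivative f' i x) (at x)" "ubd n A f'"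
    by (rule ubd_SucE[OF Suc.prems(1)])
  have z: "((f i0) has_real_derivative 0) (at x)" for x
    using Suc.prems(2) DERIV_const[of 0] by (metis ext)
  have z': "\<forall>i\<in>A. \<forall>x. (f i has_real_derivative (if i = i0 then 0 else f' i x)) (at x)"
    using d z by auto
  have "f' i0 x = 0" if "i0 \<in> A" for x using d z that DERIV_unique by blast
  then have e: "ubd n A (\<lambda>i x. if i = i0 then 0 else f' i x)"
    using d(2) by (intro ubd_cong[OF _ d(2)]) (auto simp: fun_eq_iff)
  show ?case
    by (rule ubd_SucI[where C = "max C 0", OF _ _ Suc.IH[OF e]])
       (use C z z' Suc.prems(2) in \<open>auto simp: le_max_iff_disj\<close>)
qed

text \<open>An interpolation inequality controls the first derivative: the mean value theorem on an
  interval of length 1 finds a point where |f'| \<le> 2 C, and f' changes by at most D from there.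
  Hence a bounded family gains two orders from its second derivative.\<close>

lemma ubd_second:
  assumes d: "\<And>i x. i \<in> A \<Longrightarrow> (f i has_real_derivative f' i x) (at x)"
    "\<And>i x. i \<in> A \<Longrightarrow> (f' i has_real_derivative f'' i x) (at x)"
    and f: "ubd 0 A f" and f'': "ubd n A f''"
  shows "ubd (Suc (Suc n)) A f"
proof -
  obtain C where C: "\<And>i x. i \<in> A \<Longrightarrow> \<bar>f i x\<bar> \<le> C" using f by auto
  obtain D where D: "\<And>i x. i \<in> A \<Longrightarrow> \<bar>f'' i x\<bar> \<le> D" using ubd_bound[OF f''] by auto
  have "\<bar>f' i x\<bar> \<le> 2 * C + D" if i: "i \<in> A" for i x
  proof -
    obtain z where z: "x < z" "z < x + 1" "f i (x + 1) - f i x = (x + 1 - x) * f' i z"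
      using MVT2[of x "x + 1" "f i" "f' i"] d(1)[OF i] by auto
    obtain y where y: "x < y" "y < z" "f' i z - f' i x = (z - x) * f'' i y"
      using MVT2[of x z "f' i" "f'' i"] d(2)[OF i] z by auto
    have "\<bar>(z - x) * f'' i y\<bar> \<le> 1 * D"
      unfolding abs_mult using z D[OF i, of y] by (intro mult_mono) auto
    then show ?thesis using z y C[OF i, of x] C[OF i, of "x + 1"] by (simp add: abs_le_iff)
  qed
  then show ?thesis
    using C by (intro ubd_SucI[where f = f, OF d(1)] ubd_SucI[where f = f', OF d(2)] f'') auto
qed

lemma ubd_deriv:
  assumes "\<And>n. ubd n A f"
  shows "\<And>n. ubd n A (\<lambda>i. deriv (f i))"
    and "\<And>i x. i \<in> A \<Longrightarrow> (f i has_real_derivative deriv (f i) x) (at x)"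
proof -
  have *: "\<exists>f'. (\<forall>i\<in>A. \<forall>x. (f i has_real_derivative f' i x) (at x)) \<and> ubd n A f'" for n
    using assms[of "Suc n"] by simp
  show d: "(f i has_real_derivative deriv (f i) x) (at x)" if "i \<in> A" for i x
    using *[of 0] that DERIV_imp_deriv by metis
  show "ubd n A (\<lambda>i. deriv (f i))" for n
  proof -
    obtain f' where f': "\<forall>i\<in>A. \<forall>x. (f i has_real_derivative f' i x) (at x)" "ubd n A f'"
      using * by blast
    then have "f' i = deriv (f i)" if "i \<in> A" for i
      using that by (auto simp: fun_eq_iff intro!: DERIV_imp_deriv[symmetric])
    from ubd_cong[OF this f'(2)] show ?thesis .
  qed
qed

lemma ubd_smooth:
  assumes "\<And>n. ubd n A f" "i \<in> A"
  shows "smooth (f i)"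
proof -
  have *: "(\<And>n. ubd n A f) \<Longrightarrow> ((deriv ^^ n) (f i) has_real_derivative (deriv ^^ Suc n) (f i) x) (at x)" for n x f
  proof (induction n arbitrary: f)
    case 0
    then show ?case using ubd_deriv(2)[of A f i] assms(2) by simp
  next
    case (Suc n)
    show ?case
      using Suc.IH[of "\<lambda>i. deriv (f i)"] ubd_deriv(1)[OF Suc.prems]
      by (simp add: funpow_swap1)
  qed
  show ?thesis
    unfolding smooth_def
    using *[OF assms(1)]
    by (intro exI[of _ "\<lambda>n. (deriv ^^ n) (f i)"]) (auto simp: has_real_derivative_iff_has_vector_derivative)
qed

text \<open>Each derivative multiplies the k-th coefficient by \<i> k, so the bound on coefficients
  of the n-th derivative transfers back, uniformly in the family.\<close>

lemma fourier_decay: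
  assumes "\<And>n. ubd n A f" and "\<And>i x. i \<in> A \<Longrightarrow> f i (x + 2 * pi) = f i x"
  shows "\<exists>C. \<forall>i\<in>A. \<forall>k. \<bar>real_of_int k\<bar> ^ n * norm (fc (f i) k) \<le> C"
  using assms
proof (induction n arbitrary: f)
  case 0
  obtain C where C: "\<And>i x. i \<in> A \<Longrightarrow> \<bar>f i x\<bar> \<le> C" using 0(1)[of 0] by auto
  have "continuous_on UNIV (f i)" if "i \<in> A" for i
    using ubd_deriv(2)[OF 0(1) that] by (meson DERIV_continuous_on has_field_derivative_at_within)
  then show ?case using fc_bound C by (intro exI[of _ C]) auto
next
  case (Suc n)
  let ?f' = "\<lambda>i. deriv (f i)"
  note d = ubd_deriv(2)[OF Suc.prems(1)] and u = ubd_deriv(1)[OF Suc.prems(1)]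
  have per: "?f' i (x + 2 * pi) = ?f' i x" if "i \<in> A" for i x
  proof -
    have "((\<lambda>x. f i (x + 2 * pi)) has_real_derivative ?f' i (x + 2 * pi)) (at x)"
      using d[OF that, of "x + 2 * pi"] by (simp add: DERIV_shift)
    then have "(f i has_real_derivative ?f' i (x + 2 * pi)) (at x)"
      using Suc.prems(2)[OF that] by simp
    then show ?thesis using d[OF that] DERIV_unique by blast
  qed
  obtain C where C: "\<And>i k. i \<in> A \<Longrightarrow> \<bar>real_of_int k\<bar> ^ n * norm (fc (?f' i) k) \<le> C"
    using Suc.IH[OF u per] by blast
  have "\<bar>real_of_int k\<bar> ^ Suc n * norm (fc (f i) k) \<le> C" if i: "i \<in> A" for i k
  proof -
    have "continuous_on UNIV (?f' i)"
      using ubd_deriv(2)[OF u i] by (meson DERIV_continuous_on has_field_derivative_at_within)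
    then have "fc (?f' i) k = \<i> * k * fc (f i) k"
      by (intro fc_deriv d[OF i] Suc.prems(2)[OF i])
    then have "norm (fc (?f' i) k) = \<bar>real_of_int k\<bar> * norm (fc (f i) k)"
      by (simp add: norm_mult)
    then show ?thesis using C[OF i, of k] by (simp add: mult_ac)
  qed
  then show ?case by blast
qed

section \<open>Uniform Sobolev bounds from uniform derivative bounds\<close>

lemma fourier_coeff_nth: "fourier_coeff \<phi> k $ j = fc (\<lambda>x. \<phi> x $ j) k"
  by (simp add: fourier_coeff_def fc_def cis_conv_exp mult_ac)

lemma summable_on_int_inv_sq: "(\<lambda>k::int. C / (1 + (real_of_int k)\<^sup>2)) summable_on UNIV"
proof -
  have s: "(\<lambda>n::nat. 1 / (1 + (real n)\<^sup>2)) summable_on UNIV"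
  proof (subst summable_on_UNIV_nonneg_real_iff)
    show "summable (\<lambda>n::nat. 1 / (1 + (real n)\<^sup>2))"
    proof (rule summable_comparison_test'[OF summable_mult[OF summable_inv_sq, of 2], of 0])
      fix n :: nat
      have "(real n + 1)\<^sup>2 \<le> 2 * (1 + (real n)\<^sup>2)"
        using sum_squares_bound[of "real n" 1] by (simp add: power2_eq_square algebra_simps)
      then show "norm (1 / (1 + (real n)\<^sup>2)) \<le> 2 * (1 / (real n + 1)\<^sup>2)"
        by (simp add: field_simps add_pos_nonneg)
    qed
  qed simp
  have 1: "(\<lambda>k::int. 1 / (1 + (real_of_int k)\<^sup>2)) summable_on range int"
    using s by (subst summable_on_reindex) (auto simp: o_def)
  have 2: "(\<lambda>k::int. 1 / (1 + (real_of_int k)\<^sup>2)) summable_on range (\<lambda>n. - int n)"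
    using s by (subst summable_on_reindex) (auto simp: o_def inj_on_def)
  have "(UNIV :: int set) = range int \<union> range (\<lambda>n. - int n)"
    by (auto simp: image_iff) (metis int_cases2)
  then have "(\<lambda>k::int. 1 / (1 + (real_of_int k)\<^sup>2)) summable_on UNIV"
    using summable_on_union[OF 1 2] by simp
  from summable_on_cmult_right[OF this, of C] show ?thesis by simp
qed

definition vec2 :: "real \<Rightarrow> real \<Rightarrow> real ^ 2" where
  "vec2 u v = u *\<^sub>R axis 1 1 + v *\<^sub>R axis 2 1"

lemma vec2_nth [simp]: "vec2 u v $ 1 = u" "vec2 u v $ 2 = v"
  by (simp_all add: vec2_def axis_def)

lemma smooth_vec2:
  assumes "smooth f" "smooth g"
  shows "smooth (\<lambda>x. vec2 (f x) (g x))"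
proof -
  obtain F where F: "F 0 = f" "\<And>n x. (F n has_vector_derivative F (Suc n) x) (at x)"
    using assms(1) unfolding smooth_def by blast
  obtain G where G: "G 0 = g" "\<And>n x. (G n has_vector_derivative G (Suc n) x) (at x)"
    using assms(2) unfolding smooth_def by blast
  show ?thesis
    unfolding smooth_def vec2_def
    using F G
    by (intro exI[of _ "\<lambda>n x. F n x *\<^sub>R axis 1 1 + G n x *\<^sub>R axis 2 1"] conjI allI
      has_vector_derivative_add bounded_linear.has_vector_derivative[OF bounded_linear_scaleR_left]) auto
qed

text \<open>Choosing \<open>N \<ge> r + 1\<close> leaves a spare factor
  \<open>1 + k\<^sup>2\<close>, so the Sobolev terms are dominated by a fixed multiple of the
  summable \<open>1 / (1 + k\<^sup>2)\<close> for the whole family.\<close>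

lemma sobolev_bounded:
  assumes f: "\<And>n. ubd n A f" "\<And>i x. i \<in> A \<Longrightarrow> f i (x + 2 * pi) = f i x"
    and g: "\<And>n. ubd n A g" "\<And>i x. i \<in> A \<Longrightarrow> g i (x + 2 * pi) = g i x"
  shows "\<forall>i\<in>A. finite_sobolev r (\<lambda>x. vec2 (f i x) (g i x))"
    and "bdd_above ((\<lambda>i. sobolev_norm r (\<lambda>x. vec2 (f i x) (g i x))) ` A)"
proof -
  let ?v = "\<lambda>i x. vec2 (f i x) (g i x)"
  define N where "N = nat \<lceil>r + 1\<rceil>"
  have N: "r + 1 \<le> real N" unfolding N_def by linarith
  have key: "\<exists>C. \<forall>i\<in>A. \<forall>k. (1 + (real_of_int k)\<^sup>2) ^ N * (norm (fc (h i) k))\<^sup>2 \<le> C"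
    if h: "\<And>n. ubd n A h" "\<And>i x. i \<in> A \<Longrightarrow> h i (x + 2 * pi) = h i x" for h
  proof -
    obtain C0 where C0: "\<forall>i\<in>A. \<forall>k. norm (fc (h i) k) \<le> C0"
      using fourier_decay[OF h, of 0] by auto
    obtain CN where CN: "\<forall>i\<in>A. \<forall>k. \<bar>real_of_int k\<bar> ^ N * norm (fc (h i) k) \<le> CN"
      using fourier_decay[OF h, of N] by auto
    have "(1 + (real_of_int k)\<^sup>2) ^ N * (norm (fc (h i) k))\<^sup>2 \<le> 2 ^ N * (C0\<^sup>2 + CN\<^sup>2)" if i: "i \<in> A" for i k
    proof -
      let ?m = "norm (fc (h i) k)" and ?k = "real_of_int k"
      \<comment> \<open>If |k| \<le> 1 the left side is at most \<open>2 ^ N\<close>; otherwise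
        \<open>1 + k\<^sup>2 \<le> 2 * k\<^sup>2\<close>. This reduces the weight to the decay
        estimates of orders 0 and N.\<close>
      have a: "(1 + ?k\<^sup>2) ^ N \<le> 2 ^ N * (1 + (\<bar>?k\<bar> ^ N)\<^sup>2)"
      proof (cases "\<bar>?k\<bar> \<le> 1")
        case True
        then have "?k\<^sup>2 \<le> 1" using abs_square_le_1 by blast
        then have "(1 + ?k\<^sup>2) ^ N \<le> 2 ^ N * 1" by (simp add: power_mono)
        also have "\<dots> \<le> 2 ^ N * (1 + (\<bar>?k\<bar> ^ N)\<^sup>2)" by (intro mult_left_mono) auto
        finally show ?thesis .
      next
        case False
        then have "1 \<le> ?k\<^sup>2" by (metis abs_square_le_1 linear)
        then have "(1 + ?k\<^sup>2) ^ N \<le> (2 * ?k\<^sup>2) ^ N" by (intro power_mono) auto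
        also have "\<dots> = 2 ^ N * (\<bar>?k\<bar> ^ N)\<^sup>2"
          by (simp add: power_mult_distrib power_even_abs flip: power_mult) (simp add: mult.commute power_mult)
        also have "\<dots> \<le> 2 ^ N * (1 + (\<bar>?k\<bar> ^ N)\<^sup>2)" by (intro mult_left_mono) auto
        finally show ?thesis .
      qed
      have "?m\<^sup>2 \<le> C0\<^sup>2" using C0 i by (intro power_mono) auto
      moreover have "(\<bar>?k\<bar> ^ N * ?m)\<^sup>2 \<le> CN\<^sup>2" using CN i by (intro power_mono) auto
      ultimately have b: "(1 + (\<bar>?k\<bar> ^ N)\<^sup>2) * ?m\<^sup>2 \<le> C0\<^sup>2 + CN\<^sup>2"
        by (simp add: power_mult_distrib distrib_right)
      have "(1 + ?k\<^sup>2) ^ N * ?m\<^sup>2 \<le> (2 ^ N * (1 + (\<bar>?k\<bar> ^ N)\<^sup>2)) * ?m\<^sup>2"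
        using a by (rule mult_right_mono) simp
      also have "\<dots> = 2 ^ N * ((1 + (\<bar>?k\<bar> ^ N)\<^sup>2) * ?m\<^sup>2)" by simp
      also have "\<dots> \<le> 2 ^ N * (C0\<^sup>2 + CN\<^sup>2)" using b by (intro mult_left_mono) auto
      finally show ?thesis .
    qed
    then show ?thesis by blast
  qed
  obtain C where C: "\<forall>i\<in>A. \<forall>k. (1 + (real_of_int k)\<^sup>2) ^ N * (norm (fc (f i) k))\<^sup>2 \<le> C"
    using key[OF f] by blast
  obtain D where D: "\<forall>i\<in>A. \<forall>k. (1 + (real_of_int k)\<^sup>2) ^ N * (norm (fc (g i) k))\<^sup>2 \<le> D"
    using key[OF g] by blast
  have t: "sobolev_term r (?v i) k \<le> (C + D) / (1 + (real_of_int k)\<^sup>2)" if i: "i \<in> A" for i k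
  proof -
    let ?q = "1 + (real_of_int k)\<^sup>2"
    have q: "?q \<ge> 1" by simp
    have n: "(norm (fourier_coeff (?v i) k))\<^sup>2 = (norm (fc (f i) k))\<^sup>2 + (norm (fc (g i) k))\<^sup>2"
      by (simp add: norm_vec_def L2_set_def fourier_coeff_nth UNIV_2 sum_nonneg)
    have "?q powr r * ?q \<le> ?q ^ N"
    proof -
      have "?q powr r * ?q = ?q powr (r + 1)" using q by (simp add: powr_add)
      also have "\<dots> \<le> ?q powr (real N)" using q N by (intro powr_mono) auto
      finally show ?thesis using q by (subst (asm) powr_realpow) (auto intro: add_pos_nonneg)
    qed
    then have "?q powr r * ?q * (norm (fourier_coeff (?v i) k))\<^sup>2 \<le> ?q ^ N * (norm (fourier_coeff (?v i) k))\<^sup>2"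
      by (rule mult_right_mono) simp
    also have "\<dots> \<le> C + D" using C D i unfolding n distrib_left by (intro add_mono) auto
    finally have "?q * sobolev_term r (?v i) k \<le> C + D" by (simp add: sobolev_term_def mult_ac)
    moreover have "?q > 0" using q by linarith
    ultimately show ?thesis by (simp only: pos_le_divide_eq mult.commute)
  qed
  have nn: "0 \<le> sobolev_term r (?v i) k" for i k by (simp add: sobolev_term_def)
  show fs: "\<forall>i\<in>A. finite_sobolev r (?v i)"
    unfolding finite_sobolev_def
    using t nn by (intro ballI summable_on_comparison_test[OF summable_on_int_inv_sq[of "C + D"]]) auto
  have "sobolev_norm r (?v i) \<le> sqrt (\<Sum>\<^sub>\<infinity>k\<in>UNIV. (C + D) / (1 + (real_of_int k)\<^sup>2))" if "i \<in> A" for i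
    unfolding sobolev_norm_def
    using fs that t by (intro real_sqrt_le_mono infsum_mono summable_on_int_inv_sq) (auto simp: finite_sobolev_def)
  then show "bdd_above ((\<lambda>i. sobolev_norm r (?v i)) ` A)"
    by (auto simp: bdd_above_def)
qed

section \<open>The dispersion relation\<close>

text \<open>On the Fourier mode \<open>n\<close> at frequency \<open>\<omega>\<close>, with \<open>K = n * \<omega>\<close>, the linearization at \<open>0\<close> is the Hermitian
  matrix with rows \<open>(A K, - E K)\<close> and \<open>(- cnj (E K), B K)\<close>; multiplying the second equation by \<open>m\<close>
  instead of \<open>w\<close> is what makes it Hermitian.\<close>

definition symA :: "real \<Rightarrow> real \<Rightarrow> real \<Rightarrow> real" where
  "symA \<kappa> c K = 1 + \<kappa> - c\<^sup>2 * K\<^sup>2"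

definition symB :: "real \<Rightarrow> real \<Rightarrow> real \<Rightarrow> real \<Rightarrow> real" where
  "symB m \<kappa> c K = 1 + \<kappa> - m * c\<^sup>2 * K\<^sup>2"

definition symE :: "real \<Rightarrow> real \<Rightarrow> complex" where
  "symE \<kappa> K = cis K + of_real \<kappa> * cis (- K)"

definition symdet :: "real \<Rightarrow> real \<Rightarrow> real \<Rightarrow> real \<Rightarrow> real" where
  "symdet m \<kappa> c K = symA \<kappa> c K * symB m \<kappa> c K - (norm (symE \<kappa> K))\<^sup>2"

lemma symE_Re_Im: "Re (symE \<kappa> K) = (1 + \<kappa>) * cos K" "Im (symE \<kappa> K) = (1 - \<kappa>) * sin K"
  by (simp_all add: symE_def algebra_simps)

lemma norm_symE_sq: "(norm (symE \<kappa> K))\<^sup>2 = ((1 + \<kappa>) * cos K)\<^sup>2 + ((1 - \<kappa>) * sin K)\<^sup>2"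
  by (simp add: cmod_power2 symE_Re_Im)

lemma norm_symE_sq': "(norm (symE \<kappa> K))\<^sup>2 = (1 + \<kappa>)\<^sup>2 - 4 * \<kappa> * (sin K)\<^sup>2"
  unfolding norm_symE_sq by (simp add: power_mult_distrib cos_squared_eq) (simp add: power2_eq_square algebra_simps)

lemma symE_0: "symE \<kappa> 0 = of_real (1 + \<kappa>)"
  by (simp add: symE_def complex_eq_iff)

lemma symE_bound: "\<kappa> > 0 \<Longrightarrow> norm (symE \<kappa> K) \<le> 1 + \<kappa>"
  unfolding symE_def by (rule order_trans[OF norm_triangle_ineq]) (simp add: norm_mult)

lemma norm_cis_diff: "norm (cis x - cis y) \<le> \<bar>x - y\<bar>"
proof -
  have "(norm (cis x - cis y))\<^sup>2 = (cos x - cos y)\<^sup>2 + (sin x - sin y)\<^sup>2"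
    by (simp add: cmod_power2)
  also have "\<dots> = 2 - 2 * cos (x - y)"
    by (simp add: cos_diff power2_diff sin_squared_eq algebra_simps)
  also have "\<dots> = (2 * sin ((x - y) / 2))\<^sup>2"
  proof -
    define t where "t = (x - y) / 2"
    have "x - y = 2 * t" by (simp add: t_def)
    then show ?thesis using cos_double_sin[of t] by (simp add: power_mult_distrib)
  qed
  finally have "norm (cis x - cis y) = \<bar>2 * sin ((x - y) / 2)\<bar>"
    by (metis norm_ge_zero abs_of_nonneg power2_eq_iff_nonneg abs_ge_zero power2_abs)
  also have "\<dots> \<le> \<bar>x - y\<bar>"
    using abs_sin_x_le_abs_x[of "(x - y) / 2"] by (simp add: abs_mult)
  finally show ?thesis .
qed

lemma symE_lipschitz:
  assumes "\<kappa> > 0"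
  shows "norm (symE \<kappa> x - symE \<kappa> y) \<le> (1 + \<kappa>) * \<bar>x - y\<bar>"
proof -
  have "norm (symE \<kappa> x - symE \<kappa> y) = norm ((cis x - cis y) + of_real \<kappa> * (cis (- x) - cis (- y)))"
    by (simp add: symE_def algebra_simps)
  also have "\<dots> \<le> \<bar>x - y\<bar> + \<kappa> * \<bar>- x - (- y)\<bar>"
    using norm_cis_diff[of x y] norm_cis_diff[of "- x" "- y"] assms
    by (intro norm_triangle_le add_mono) (auto simp: norm_mult)
  finally show ?thesis by (simp add: algebra_simps abs_minus_commute)
qed

text \<open>The right side is the discriminant of the matrix with rows (1 + \<kappa>, - E) and (- w
  cnj E, w (1 + \<kappa>)), whose larger eigenvalue is \<open>lambda_plus\<close>.\<close>

lemma rho_sq: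
  assumes "\<kappa> > 0" "w > 0"
  shows "(rho \<kappa> w K)\<^sup>2 = (1 + \<kappa>)\<^sup>2 * (1 - w)\<^sup>2 + 4 * w * (norm (symE \<kappa> K))\<^sup>2"
proof -
  have "(rho \<kappa> w K)\<^sup>2 = (1 + w)\<^sup>2 * (1 - \<kappa>)\<^sup>2 + 4 * \<kappa> * ((1 - w)\<^sup>2 + 4 * w * (cos K)\<^sup>2)"
    unfolding rho_def using assms by simp
  also have "\<dots> = (1 + \<kappa>)\<^sup>2 * (1 - w)\<^sup>2 + 4 * w * (norm (symE \<kappa> K))\<^sup>2"
    unfolding norm_symE_sq' sin_squared_eq by (simp add: power2_eq_square algebra_simps)
  finally show ?thesis .
qed

text \<open>Up to the factor m, the determinant is the characteristic polynomial at
  \<open>c\<^sup>2 * K\<^sup>2\<close> of the matrix whose eigenvalues are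
  \<open>lambda_plus\<close> and the trace (1 + \<kappa>) (1 + w) minus it.\<close>

lemma symdet_factor:
  assumes "\<kappa> > 0" "w > 0" "m = 1 / w"
  shows "symdet m \<kappa> c K = m * (c\<^sup>2 * K\<^sup>2 - lambda_plus \<kappa> w K) *
    (c\<^sup>2 * K\<^sup>2 - ((1 + \<kappa>) * (1 + w) - lambda_plus \<kappa> w K))"
proof -
  let ?S = "(1 + \<kappa>) * (1 + w)" and ?x = "c\<^sup>2 * K\<^sup>2" and ?r = "rho \<kappa> w K"
  have mw: "m * w = 1" "m > 0" using assms by simp_all
  have "(?x - lambda_plus \<kappa> w K) * (?x - (?S - lambda_plus \<kappa> w K)) = ?x\<^sup>2 - ?S * ?x + (?S\<^sup>2 - ?r\<^sup>2) / 4"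
    unfolding lambda_plus_def by (simp add: power2_eq_square algebra_simps) (simp add: field_simps)
  also have "(?S\<^sup>2 - ?r\<^sup>2) / 4 = w * ((1 + \<kappa>)\<^sup>2 - (norm (symE \<kappa> K))\<^sup>2)"
    unfolding rho_sq[OF assms(1,2)] by (simp add: power2_eq_square field_simps)
  finally have *: "m * ((?x - lambda_plus \<kappa> w K) * (?x - (?S - lambda_plus \<kappa> w K))) =
    m * (?x\<^sup>2 - ?S * ?x + w * ((1 + \<kappa>)\<^sup>2 - (norm (symE \<kappa> K))\<^sup>2))" by simp
  also have "\<dots> = m * ?x\<^sup>2 - (1 + \<kappa>) * (m + m * w) * ?x + m * w * ((1 + \<kappa>)\<^sup>2 - (norm (symE \<kappa> K))\<^sup>2)"
    by (simp add: algebra_simps)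
  also have "\<dots> = (1 + \<kappa> - ?x) * (1 + \<kappa> - m * ?x) - (norm (symE \<kappa> K))\<^sup>2"
    unfolding mw by (simp add: power2_eq_square algebra_simps)
  finally show ?thesis by (simp add: symdet_def symA_def symB_def mult.assoc)
qed

text \<open>The lower (acoustic) branch stays below the sound parabola. With A the trace and r =
  \<open>rho\<close>, (A - r) (A + r) = 16 \<kappa> w (1 + |cos K|) (1 - |cos K|); here A + r \<ge>
  A (1 + |cos K|) cancels one factor, and 1 - |cos K| is at most half of K squared.\<close>

lemma lambda_plus_drop:
  fixes \<kappa> w K :: real
  assumes "\<kappa> > 0" "w > 0"
  shows "(1 + \<kappa>) * (1 + w) - lambda_plus \<kappa> w K \<le> (c_star \<kappa> w)\<^sup>2 * K\<^sup>2"
proof -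
  let ?A = "(1 + \<kappa>) * (1 + w)" and ?r = "rho \<kappa> w K"
  have A: "?A > 0" using assms by simp
  have r0: "?r \<ge> 0" using assms by (simp add: rho_def)
  have rsq: "?r\<^sup>2 = ?A\<^sup>2 - 16 * \<kappa> * w * (sin K)\<^sup>2"
    unfolding rho_sq[OF assms] norm_symE_sq' by (simp add: power2_eq_square algebra_simps)
  have ssq: "(sin K)\<^sup>2 \<le> 1" by (simp add: abs_square_le_1)
  have kw: "16 * \<kappa> * w \<le> ?A\<^sup>2"
  proof -
    have "4 * \<kappa> \<le> (1 + \<kappa>)\<^sup>2" "4 * w \<le> (1 + w)\<^sup>2"
      using sum_squares_bound[of 1 \<kappa>] sum_squares_bound[of 1 w] by (simp_all add: power2_eq_square algebra_simps)
    then have "(4 * \<kappa>) * (4 * w) \<le> (1 + \<kappa>)\<^sup>2 * (1 + w)\<^sup>2" using assms by (intro mult_mono) auto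
    then show ?thesis by (simp add: power_mult_distrib mult_ac)
  qed
  have rge: "?r \<ge> ?A * \<bar>cos K\<bar>"
  proof -
    have "(?A * \<bar>cos K\<bar>)\<^sup>2 = ?A\<^sup>2 - ?A\<^sup>2 * (sin K)\<^sup>2"
      by (simp only: power_mult_distrib power2_abs cos_squared_eq right_diff_distrib mult_1_right)
    also have "\<dots> \<le> ?A\<^sup>2 - 16 * \<kappa> * w * (sin K)\<^sup>2"
      using kw by (simp add: mult_right_mono)
    finally show ?thesis using r0 unfolding rsq[symmetric] by (rule power2_le_imp_le)
  qed
  have sin_le: "(sin K)\<^sup>2 \<le> (1 + \<bar>cos K\<bar>) * (K\<^sup>2 / 2)"
  proof -
    have "1 - cos K = 2 * (sin (K / 2))\<^sup>2" using cos_double_sin[of "K / 2"] by simp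
    moreover have "(sin (K / 2))\<^sup>2 \<le> (K / 2)\<^sup>2" using abs_sin_x_le_abs_x[of "K / 2"] by (rule abs_le_square_iff[THEN iffD1])
    ultimately have "1 - \<bar>cos K\<bar> \<le> K\<^sup>2 / 2" by (simp add: power_divide)
    then have "(1 + \<bar>cos K\<bar>) * (1 - \<bar>cos K\<bar>) \<le> (1 + \<bar>cos K\<bar>) * (K\<^sup>2 / 2)" by (intro mult_left_mono) auto
    moreover have "(1 + \<bar>cos K\<bar>) * (1 - \<bar>cos K\<bar>) = (sin K)\<^sup>2"
      by (simp add: sin_squared_eq algebra_simps power2_eq_square)
    ultimately show ?thesis by simp
  qed
  have rA: "?r \<le> ?A"
    by (rule power2_le_imp_le) (use A assms in \<open>simp_all add: rsq\<close>)
  have "(?A - ?r) * (?A * (1 + \<bar>cos K\<bar>)) \<le> (?A - ?r) * (?A + ?r)"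
    using rge rA by (intro mult_left_mono) (auto simp: algebra_simps)
  also have "\<dots> = 16 * \<kappa> * w * (sin K)\<^sup>2"
    using rsq by (simp add: power2_eq_square algebra_simps)
  also have "\<dots> \<le> 16 * \<kappa> * w * ((1 + \<bar>cos K\<bar>) * (K\<^sup>2 / 2))"
    using sin_le assms by (intro mult_left_mono) auto
  finally have "((?A - ?r) * ?A) * (1 + \<bar>cos K\<bar>) \<le> (8 * \<kappa> * w * K\<^sup>2) * (1 + \<bar>cos K\<bar>)"
    by (simp only: mult_ac) 
  then have "(?A - ?r) * ?A \<le> 8 * \<kappa> * w * K\<^sup>2"
    by (rule mult_right_le_imp_le) (simp add: add_pos_nonneg)
  then have "(?A - ?r) / 2 \<le> 4 * \<kappa> * w / ?A * K\<^sup>2"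
    using A by (simp add: field_simps)
  moreover have "(c_star \<kappa> w)\<^sup>2 = 4 * \<kappa> * w / ?A" using assms by (simp add: c_star_def)
  moreover have "?A - lambda_plus \<kappa> w K = (?A - ?r) / 2" unfolding lambda_plus_def by (simp add: field_simps)
  ultimately show ?thesis by simp
qed

text \<open>Above \<omega> the factor of the upper branch grows because \<open>lambda_plus\<close>
  grows no faster than the sound parabola and the factor vanishes at \<omega>; the factor of the
  lower branch is bounded below by \<open>lambda_plus_drop\<close>. Both gain the margin between
  \<open>c\<^sup>2\<close> and \<open>(c_star \<kappa> w)\<^sup>2\<close>.\<close>

lemma symdet_lower_bound:
  fixes m \<kappa> w c :: real
  assumes "\<kappa> > 0" "w > 0" "m = 1 / w" "\<bar>c\<bar> > c_star \<kappa> w"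
    and \<omega>: "0 < \<omega>" "c\<^sup>2 * \<omega>\<^sup>2 = lambda_plus \<kappa> w \<omega>" and K: "\<omega> \<le> K"
  shows "m * (c\<^sup>2 - (c_star \<kappa> w)\<^sup>2)\<^sup>2 * (K\<^sup>2 * (K\<^sup>2 - \<omega>\<^sup>2)) \<le> symdet m \<kappa> c K"
proof -
  let ?s = "(c_star \<kappa> w)\<^sup>2"
  have cs0: "c_star \<kappa> w \<ge> 0" using assms by (simp add: c_star_def)
  then have cc: "?s < c\<^sup>2" using assms(4) by (metis power2_abs power_strict_mono zero_less_numeral)
  have 1: "(c\<^sup>2 - ?s) * (K\<^sup>2 - \<omega>\<^sup>2) \<le> c\<^sup>2 * K\<^sup>2 - lambda_plus \<kappa> w K"
    using lambda_plus_growth[of \<kappa> w \<omega> K] assms by (simp add: algebra_simps)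
  have 2: "(c\<^sup>2 - ?s) * K\<^sup>2 \<le> c\<^sup>2 * K\<^sup>2 - ((1 + \<kappa>) * (1 + w) - lambda_plus \<kappa> w K)"
    using lambda_plus_drop[of \<kappa> w K] assms by (simp add: algebra_simps)
  have "\<omega>\<^sup>2 \<le> K\<^sup>2" using K \<omega> by (intro power_mono) auto
  then have "((c\<^sup>2 - ?s) * (K\<^sup>2 - \<omega>\<^sup>2)) * ((c\<^sup>2 - ?s) * K\<^sup>2) \<le> (c\<^sup>2 * K\<^sup>2 - lambda_plus \<kappa> w K) *
      (c\<^sup>2 * K\<^sup>2 - ((1 + \<kappa>) * (1 + w) - lambda_plus \<kappa> w K))"
    using 1 2 cc order_trans[OF mult_nonneg_nonneg 1] by (intro mult_mono) auto
  then have "m * (((c\<^sup>2 - ?s) * (K\<^sup>2 - \<omega>\<^sup>2)) * ((c\<^sup>2 - ?s) * K\<^sup>2)) \<le> symdet m \<kappa> c K"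
    unfolding symdet_factor[OF assms(1-3)] mult.assoc using assms(2,3) by (intro mult_left_mono) auto
  then show ?thesis by (simp add: power2_eq_square mult_ac)
qed

text \<open>The larger eigenvalue is at least the larger diagonal entry. If w > 1, that entry w (1 +
  \<kappa>) already exceeds 1 + \<kappa>; otherwise \<kappa> > 1 makes E nonzero and the
  off-diagonal part gives strictness. At \<omega>0 this says that the second component of \<mu> is
  negative.\<close>

lemma lambda_plus_gt:
  assumes "\<kappa> > 0" "w > 0" "w > 1 \<or> \<kappa> > 1"
  shows "1 + \<kappa> < lambda_plus \<kappa> w K"
proof (cases "w > 1")
  case True
  have "((1 + \<kappa>) * (w - 1))\<^sup>2 \<le> (rho \<kappa> w K)\<^sup>2"
    unfolding rho_sq[OF assms(1,2)] using assms by (simp add: power_mult_distrib power2_commute)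
  then have "(1 + \<kappa>) * (w - 1) \<le> rho \<kappa> w K"
    by (rule power2_le_imp_le) (use assms in \<open>simp add: rho_def\<close>)
  moreover have "(1 + \<kappa>) * 1 < (1 + \<kappa>) * w" using True assms by (intro mult_strict_left_mono) auto
  ultimately show ?thesis unfolding lambda_plus_def by (simp add: field_simps)
next
  case False
  then have k: "\<kappa> > 1" "w \<le> 1" using assms by auto
  have "(norm (symE \<kappa> K))\<^sup>2 > 0"
  proof -
    have "(norm (symE \<kappa> K))\<^sup>2 \<ge> (1 + \<kappa>)\<^sup>2 - 4 * \<kappa> * 1"
      unfolding norm_symE_sq' using assms by (intro diff_left_mono mult_left_mono) (auto simp: abs_square_le_1)
    moreover have "(1 + \<kappa>)\<^sup>2 - 4 * \<kappa> * 1 = (\<kappa> - 1)\<^sup>2" by (simp add: power2_eq_square algebra_simps)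
    moreover have "(\<kappa> - 1)\<^sup>2 > 0" using k by simp
    ultimately show ?thesis by linarith
  qed
  then have "((1 + \<kappa>) * (1 - w))\<^sup>2 < (rho \<kappa> w K)\<^sup>2"
    unfolding rho_sq[OF assms(1,2)] using assms by (simp add: power_mult_distrib)
  then have "(1 + \<kappa>) * (1 - w) < rho \<kappa> w K"
    by (rule power2_less_imp_less) (use assms in \<open>simp add: rho_def\<close>)
  then show ?thesis unfolding lambda_plus_def by (simp add: field_simps)
qed

section \<open>Inverting the linearization off its kernel\<close>

text \<open>What the reduction retains of the dispersion relation: \<mu> has a nonzero second
  component, the symbol is singular at \<omega>0, and beyond \<omega>0 its determinant has a quartic
  lower bound with a simple zero.\<close>

locale dimer =
  fixes m \<kappa> c \<omega>0 :: real
  assumes m: "m > 0" and \<kappa>: "\<kappa> > 0" and c: "c \<noteq> 0" and \<omega>0: "\<omega>0 > 0"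
    and A0: "symA \<kappa> c \<omega>0 < 0" and det0: "symdet m \<kappa> c \<omega>0 = 0"
    and det_lower: "\<exists>\<delta>>0. \<forall>K\<ge>\<omega>0. \<delta> * (K\<^sup>2 * (K\<^sup>2 - \<omega>0\<^sup>2)) \<le> symdet m \<kappa> c K"
begin

abbreviation "A \<equiv> symA \<kappa> c"
abbreviation "B \<equiv> symB m \<kappa> c"
abbreviation "E \<equiv> symE \<kappa>"
abbreviation "dt \<equiv> symdet m \<kappa> c"
abbreviation "Ac \<equiv> symA \<kappa> c \<omega>0"
abbreviation "Ec \<equiv> symE \<kappa> \<omega>0"

definition Q :: "real \<Rightarrow> real" where
  "Q \<omega> = Ac\<^sup>2 * A \<omega> + 2 * Ac * Re (E \<omega> * cnj Ec) + (norm Ec)\<^sup>2 * B \<omega>"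

text \<open>The quadratic form of the symbol on \<mu>. It vanishes at \<omega>0, and its sign change
  there drives the bifurcation equation.\<close>

definition h :: "real \<Rightarrow> real" where
  "h \<omega> = (norm Ec)\<^sup>2 * A \<omega> - 2 * Ac * Re (E \<omega> * cnj Ec) + Ac\<^sup>2 * B \<omega>"

text \<open>For \<open>n \<ge> 2\<close> this is the inverse of the symbol. For \<open>n = 0\<close> and \<open>n = 1\<close> it inverts the compression to the
  complement of \<open>(1, 1)\<close> and of \<open>\<mu> = (Ec, Ac)\<close>, spanned by \<open>(1, -1)\<close> and \<open>(- Ac, cnj Ec)\<close>; on the latter the
  symbol has the quadratic form \<open>Q\<close>.\<close>

definition g11 :: "real \<Rightarrow> nat \<Rightarrow> complex" where
  "g11 \<omega> n = (if n = 0 then 1 / (4 * (1 + \<kappa>)) else if n = 1 then of_real (Ac\<^sup>2 / Q \<omega>)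
     else of_real (B (n * \<omega>) / dt (n * \<omega>)))"

definition g12 :: "real \<Rightarrow> nat \<Rightarrow> complex" where
  "g12 \<omega> n = (if n = 0 then - 1 / (4 * (1 + \<kappa>)) else if n = 1 then - Ac * Ec / Q \<omega>
     else E (n * \<omega>) / dt (n * \<omega>))"

definition g21 :: "real \<Rightarrow> nat \<Rightarrow> complex" where
  "g21 \<omega> n = (if n = 0 then - 1 / (4 * (1 + \<kappa>)) else if n = 1 then - Ac * cnj Ec / Q \<omega>
     else cnj (E (n * \<omega>)) / dt (n * \<omega>))"

definition g22 :: "real \<Rightarrow> nat \<Rightarrow> complex" where
  "g22 \<omega> n = (if n = 0 then 1 / (4 * (1 + \<kappa>)) else if n = 1 then of_real ((norm Ec)\<^sup>2 / Q \<omega>)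
     else of_real (A (n * \<omega>) / dt (n * \<omega>)))"

section \<open>Nondegeneracy of the symbol near the critical frequency\<close>

lemma AB0: "Ac * B \<omega>0 = (norm Ec)\<^sup>2"
  using det0 by (simp add: symdet_def)

lemma B0: "B \<omega>0 \<le> 0"
proof (rule ccontr)
  assume "\<not> ?thesis"
  then have "Ac * B \<omega>0 < 0" using A0 by (simp add: mult_neg_pos)
  then show False using AB0 by (simp add: not_le[symmetric])
qed

text \<open>At \<omega>0 the Hermitian symbol has determinant 0 and trace Ac +
  \<open>B \<omega>0\<close> < 0, so the complement of \<mu> is the eigenspace of the trace;
  \<open>Q\<close> is the trace times the squared length Ac (Ac + \<open>B \<omega>0\<close>) of the
  complementary vector.\<close>

lemma Q0: "Q \<omega>0 < 0"
proof -
  have "Re (Ec * cnj Ec) = (norm Ec)\<^sup>2" by (simp only: complex_norm_square[symmetric] Re_complex_of_real)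
  then have "Q \<omega>0 = Ac * (Ac + B \<omega>0)\<^sup>2"
    unfolding Q_def AB0[symmetric] by (simp add: power2_eq_square algebra_simps)
  also have "\<dots> < 0" using A0 B0 by (intro mult_neg_pos) auto
  finally show ?thesis .
qed

lemma Re_E: "Re (E \<omega> * cnj Ec) = (1 + \<kappa>)\<^sup>2 * cos \<omega>0 * cos \<omega> + (1 - \<kappa>)\<^sup>2 * sin \<omega>0 * sin \<omega>"
  by (simp add: symE_Re_Im power2_eq_square algebra_simps)

lemma continuous_on_E [continuous_intros]:
  "continuous_on S f \<Longrightarrow> continuous_on S (\<lambda>x. E (f x))"
  unfolding symE_def by (intro continuous_intros)

lemma continuous_on_ABQ [continuous_intros]:
  assumes "continuous_on S f"
  shows "continuous_on S (\<lambda>x. A (f x))" "continuous_on S (\<lambda>x. B (f x))"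
    "continuous_on S (\<lambda>x. dt (f x))" "continuous_on S (\<lambda>x. Q (f x))"
  unfolding symA_def symB_def symdet_def Q_def by (intro continuous_intros assms)+

lemma Q_bound: "\<exists>\<delta>>0. \<delta> \<le> \<omega>0 / 4 \<and> (\<forall>\<omega>. \<bar>\<omega> - \<omega>0\<bar> \<le> \<delta> \<longrightarrow> Q \<omega> \<le> Q \<omega>0 / 2)"
proof -
  have "continuous_on UNIV (\<lambda>x. Q x)" by (intro continuous_intros)
  then obtain d where d: "d > 0" "\<And>\<omega>. \<bar>\<omega> - \<omega>0\<bar> < d \<Longrightarrow> \<bar>Q \<omega> - Q \<omega>0\<bar> < - Q \<omega>0 / 2"
    unfolding continuous_on_iff dist_real_def using Q0 by (metis UNIV_I half_gt_zero minus_divide_left neg_0_less_iff_less)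
  have "Q \<omega> \<le> Q \<omega>0 / 2" if "\<bar>\<omega> - \<omega>0\<bar> \<le> min (d / 2) (\<omega>0 / 4)" for \<omega>
  proof -
    have "\<bar>\<omega> - \<omega>0\<bar> < d" using that d(1) by linarith
    from d(2)[OF this] show ?thesis by linarith
  qed
  then show ?thesis using d(1) \<omega>0 by (intro exI[of _ "min (d / 2) (\<omega>0 / 4)"]) auto
qed

text \<open>Radius of the admissible frequencies. \<open>Q\<close> stays away from 0 there, and the
  bound by \<omega>0 / 4 keeps n \<omega> above 3/2 \<omega>0 for n \<ge> 2, clear of the zero of
  the determinant.\<close>

definition \<delta>0 :: real where
  "\<delta>0 = (SOME \<delta>. \<delta> > 0 \<and> \<delta> \<le> \<omega>0 / 4 \<and> (\<forall>\<omega>. \<bar>\<omega> - \<omega>0\<bar> \<le> \<delta> \<longrightarrow> Q \<omega> \<le> Q \<omega>0 / 2))"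

lemma \<delta>0: "\<delta>0 > 0" "\<delta>0 \<le> \<omega>0 / 4" "\<bar>\<omega> - \<omega>0\<bar> \<le> \<delta>0 \<Longrightarrow> Q \<omega> \<le> Q \<omega>0 / 2"
  using someI_ex[OF Q_bound] unfolding \<delta>0_def by blast+

lemma det_ge:
  obtains d where "d > 0"
    "\<And>n \<omega>. \<bar>\<omega> - \<omega>0\<bar> \<le> \<delta>0 \<Longrightarrow> 2 \<le> n \<Longrightarrow> d * ((real n * \<omega>)\<^sup>2)\<^sup>2 \<le> dt (real n * \<omega>) \<and> \<omega>0 \<le> real n * \<omega> \<and> \<omega>0 * (real n + 1) / 2 \<le> real n * \<omega>"
proof -
  obtain e where e: "e > 0" "\<And>K. K \<ge> \<omega>0 \<Longrightarrow> e * (K\<^sup>2 * (K\<^sup>2 - \<omega>0\<^sup>2)) \<le> dt K" using det_lower by blast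
  have "e * (5 / 9) * ((real n * \<omega>)\<^sup>2)\<^sup>2 \<le> dt (real n * \<omega>) \<and> \<omega>0 \<le> real n * \<omega> \<and> \<omega>0 * (real n + 1) / 2 \<le> real n * \<omega>"
    if w: "\<bar>\<omega> - \<omega>0\<bar> \<le> \<delta>0" and n: "2 \<le> n" for n \<omega>
  proof -
    let ?K = "real n * \<omega>"
    \<comment> \<open>For n \<ge> 2 the factor 3 n / 4 dominates both 3/2 and (n + 1) / 2. The first
      makes \<open>\<omega>0\<^sup>2\<close> at most 4/9 of \<open>K\<^sup>2\<close>, whence the
      constant 5/9; the second prepares the decay in n + 1.\<close>
    have w34: "\<omega> \<ge> 3 / 4 * \<omega>0" using w \<delta>0(2) by linarith
    have "real n * (3 / 4 * \<omega>0) \<le> ?K" using w34 by (intro mult_left_mono) auto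
    moreover have "\<omega>0 * (3/2) \<le> \<omega>0 * (real n * (3 / 4))" using n \<omega>0 by (intro mult_left_mono) auto
    moreover have "\<omega>0 * ((real n + 1) / 2) \<le> \<omega>0 * (real n * (3 / 4))" using n \<omega>0 by (intro mult_left_mono) auto
    ultimately have K: "3/2 * \<omega>0 \<le> ?K" and K2: "\<omega>0 * (real n + 1) / 2 \<le> ?K" by (simp_all add: algebra_simps)
    then have K1: "\<omega>0 \<le> ?K" using \<omega>0 by linarith
    have "(3/2 * \<omega>0)\<^sup>2 \<le> ?K\<^sup>2" using K \<omega>0 by (intro power_mono) auto
    then have "\<omega>0\<^sup>2 \<le> 4 / 9 * ?K\<^sup>2" by (simp add: power_mult_distrib power_divide)
    then have "5 / 9 * ?K\<^sup>2 \<le> ?K\<^sup>2 - \<omega>0\<^sup>2" by linarith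
    then have "e * (?K\<^sup>2 * (5 / 9 * ?K\<^sup>2)) \<le> e * (?K\<^sup>2 * (?K\<^sup>2 - \<omega>0\<^sup>2))"
      using e by (intro mult_left_mono) auto
    also have "\<dots> \<le> dt ?K" using e K1 by blast
    finally have "e * (?K\<^sup>2 * (5 / 9 * ?K\<^sup>2)) \<le> dt ?K" .
    moreover have "e * (?K\<^sup>2 * (5 / 9 * ?K\<^sup>2)) = e * (5 / 9) * (?K\<^sup>2)\<^sup>2" by (simp add: power2_eq_square)
    ultimately have "e * (5 / 9) * (?K\<^sup>2)\<^sup>2 \<le> dt ?K" by (simp only:)
    then show ?thesis using K1 K2 by blast
  qed
  with e(1) show ?thesis using that[of "e * (5 / 9)"] by simp
qed

lemma dt_nz: "\<bar>\<omega> - \<omega>0\<bar> \<le> \<delta>0 \<Longrightarrow> 2 \<le> n \<Longrightarrow> dt (real n * \<omega>) > 0"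
proof -
  assume w: "\<bar>\<omega> - \<omega>0\<bar> \<le> \<delta>0" "2 \<le> n"
  obtain d where d: "d > 0"
    "\<And>n \<omega>. \<bar>\<omega> - \<omega>0\<bar> \<le> \<delta>0 \<Longrightarrow> 2 \<le> n \<Longrightarrow> d * ((real n * \<omega>)\<^sup>2)\<^sup>2 \<le> dt (real n * \<omega>) \<and> \<omega>0 \<le> real n * \<omega> \<and> \<omega>0 * (real n + 1) / 2 \<le> real n * \<omega>"
    using det_ge by blast
  have "0 < real n * \<omega>" using d(2)[OF w] \<omega>0 by linarith
  then have "0 < d * ((real n * \<omega>)\<^sup>2)\<^sup>2" using d(1) by (metis mult_pos_pos zero_less_power)
  then show ?thesis using d(2)[OF w] by linarith
qed

text \<open>For n \<ge> 2 the entries of the adjugate grow like \<open>K\<^sup>2\<close> and the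
  determinant at least like \<open>K ^ 4\<close>; the two low modes only need finite constants,
  uniform in \<omega>.\<close>

lemma g_bound:
  obtains C where "C > 0"
    "\<And>\<omega> n. \<bar>\<omega> - \<omega>0\<bar> \<le> \<delta>0 \<Longrightarrow> norm (g11 \<omega> n) \<le> C / (real n + 1)\<^sup>2"
    "\<And>\<omega> n. \<bar>\<omega> - \<omega>0\<bar> \<le> \<delta>0 \<Longrightarrow> norm (g12 \<omega> n) \<le> C / (real n + 1)\<^sup>2"
    "\<And>\<omega> n. \<bar>\<omega> - \<omega>0\<bar> \<le> \<delta>0 \<Longrightarrow> norm (g21 \<omega> n) \<le> C / (real n + 1)\<^sup>2"
    "\<And>\<omega> n. \<bar>\<omega> - \<omega>0\<bar> \<le> \<delta>0 \<Longrightarrow> norm (g22 \<omega> n) \<le> C / (real n + 1)\<^sup>2"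
proof -
  obtain d where d: "d > 0"
    "\<And>n \<omega>. \<bar>\<omega> - \<omega>0\<bar> \<le> \<delta>0 \<Longrightarrow> 2 \<le> n \<Longrightarrow> d * ((real n * \<omega>)\<^sup>2)\<^sup>2 \<le> dt (real n * \<omega>) \<and> \<omega>0 \<le> real n * \<omega> \<and> \<omega>0 * (real n + 1) / 2 \<le> real n * \<omega>"
    using det_ge by blast
  \<comment> \<open>\<open>M1\<close> serves n = 1 and \<open>M2\<close> serves n \<ge> 2. The
    factors 4 in \<open>C\<close> come from \<open>(1 + 1)\<^sup>2\<close> in the weight and from
    squaring (n + 1) / 2.\<close>
  define M1 where "M1 = (Ac\<^sup>2 + \<bar>Ac\<bar> * norm Ec + (norm Ec)\<^sup>2) / (- Q \<omega>0 / 2)"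
  define M2 where "M2 = (1 + \<kappa>) / \<omega>0\<^sup>2 + m * c\<^sup>2 + c\<^sup>2"
  define C where "C = 1 + 4 * M1 + 4 * M2 / (d * \<omega>0\<^sup>2)"
  have M1: "M1 \<ge> 0" using Q0 by (simp add: M1_def divide_nonneg_neg zero_le_divide_iff)
  have M2: "M2 \<ge> 0" using m \<kappa> by (simp add: M2_def)
  have C: "C \<ge> 1" "C \<ge> 4 * M1" "C \<ge> 4 * M2 / (d * \<omega>0\<^sup>2)" using M1 M2 d(1) by (simp_all add: C_def)
  have c0: "norm z \<le> C / (real 0 + 1)\<^sup>2" if "norm z = 1 / (4 * (1 + \<kappa>))" for z :: complex
  proof -
    have "1 / (4 * (1 + \<kappa>)) \<le> 1" using \<kappa> by simp
    then show ?thesis using that C by simp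
  qed
  have c1: "norm z / \<bar>Q \<omega>\<bar> \<le> C / 4"
    if "\<bar>\<omega> - \<omega>0\<bar> \<le> \<delta>0" "norm z \<le> Ac\<^sup>2 + \<bar>Ac\<bar> * norm Ec + (norm Ec)\<^sup>2" for z :: complex and \<omega>
  proof -
    have "\<bar>Q \<omega>\<bar> \<ge> - Q \<omega>0 / 2" using \<delta>0(3)[OF that(1)] by linarith
    then have "norm z / \<bar>Q \<omega>\<bar> \<le> M1" unfolding M1_def using that(2) Q0 by (intro frac_le) auto
    then show ?thesis using C by linarith
  qed
  have c2: "norm z / dt (real n * \<omega>) \<le> C / (real n + 1)\<^sup>2"
    if w: "\<bar>\<omega> - \<omega>0\<bar> \<le> \<delta>0" "2 \<le> n" and z: "norm z \<le> M2 * (real n * \<omega>)\<^sup>2" for z :: complex and \<omega> n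
  proof -
    let ?K = "real n * \<omega>"
    note dd = d(2)[OF w]
    have "?K > 0" using dd \<omega>0 by linarith
    then have K: "?K\<^sup>2 > 0" by (rule zero_less_power)
    have "norm z / dt ?K \<le> (M2 * ?K\<^sup>2) / (d * (?K\<^sup>2)\<^sup>2)"
      using z dd K d(1) M2 by (intro frac_le) auto
    also have "\<dots> = (M2 / d) / ?K\<^sup>2" using K by (simp add: power2_eq_square)
    also have "\<dots> \<le> (M2 / d) / (\<omega>0 * (real n + 1) / 2)\<^sup>2"
    proof (rule divide_left_mono)
      have p: "0 \<le> \<omega>0 * (real n + 1) / 2" using \<omega>0 by simp
      show le: "(\<omega>0 * (real n + 1) / 2)\<^sup>2 \<le> ?K\<^sup>2" using dd p by (intro power_mono) auto
      show "0 \<le> M2 / d" using M2 d by simp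
      show "0 < ?K\<^sup>2 * (\<omega>0 * (real n + 1) / 2)\<^sup>2" using K \<omega>0 by (intro mult_pos_pos[OF K] zero_less_power) simp
    qed
    also have "\<dots> = (4 * M2 / (d * \<omega>0\<^sup>2)) / (real n + 1)\<^sup>2" by (simp add: power_mult_distrib power_divide mult_ac)
    also have "\<dots> \<le> C / (real n + 1)\<^sup>2" using C by (intro divide_right_mono) auto
    finally show ?thesis .
  qed
  have bnd: "norm (complex_of_real (A (real n * \<omega>))) \<le> M2 * (real n * \<omega>)\<^sup>2 \<and>
      norm (complex_of_real (B (real n * \<omega>))) \<le> M2 * (real n * \<omega>)\<^sup>2 \<and> norm (E (real n * \<omega>)) \<le> M2 * (real n * \<omega>)\<^sup>2"
    if w: "\<bar>\<omega> - \<omega>0\<bar> \<le> \<delta>0" "2 \<le> n" for \<omega> and n :: nat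
  proof -
    define K where "K = real n * \<omega>"
    have "\<omega>0 \<le> K" using d(2)[OF w] by (simp add: K_def)
    then have "\<omega>0\<^sup>2 \<le> K\<^sup>2" using \<omega>0 by (intro power_mono) auto
    then have "(1 + \<kappa>) / \<omega>0\<^sup>2 * \<omega>0\<^sup>2 \<le> (1 + \<kappa>) / \<omega>0\<^sup>2 * K\<^sup>2" using \<kappa> \<omega>0 by (intro mult_left_mono) auto
    then have 1: "1 + \<kappa> \<le> (1 + \<kappa>) / \<omega>0\<^sup>2 * K\<^sup>2" using \<omega>0 by simp
    have nn: "0 \<le> m * c\<^sup>2 * K\<^sup>2" "0 \<le> c\<^sup>2 * K\<^sup>2" using m by auto
    have "norm (E K) \<le> 1 + \<kappa>" using symE_bound[OF \<kappa>] .
    then show ?thesis using 1 nn \<kappa> unfolding M2_def symA_def symB_def distrib_right K_def[symmetric] norm_of_real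
      by linarith
  qed
  show ?thesis
  proof (rule that)
    show "C > 0" using C by simp
    fix \<omega> :: real and n :: nat assume w: "\<bar>\<omega> - \<omega>0\<bar> \<le> \<delta>0"
    have kk: "1 / (4 * (1 + complex_of_real \<kappa>)) = complex_of_real (1 / (4 * (1 + \<kappa>)))" by simp
    have k: "norm (1 / (4 * (1 + complex_of_real \<kappa>))) = 1 / (4 * (1 + \<kappa>))"
      unfolding kk norm_of_real using \<kappa> by simp
    have k': "norm (- 1 / (4 * (1 + complex_of_real \<kappa>))) = 1 / (4 * (1 + \<kappa>))"
      using k by (metis minus_divide_left norm_minus_cancel)
    consider "n = 0" | "n = 1" | "n \<ge> 2" by linarith
    then have "norm (g11 \<omega> n) \<le> C / (real n + 1)\<^sup>2 \<and> norm (g12 \<omega> n) \<le> C / (real n + 1)\<^sup>2 \<and>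
        norm (g21 \<omega> n) \<le> C / (real n + 1)\<^sup>2 \<and> norm (g22 \<omega> n) \<le> C / (real n + 1)\<^sup>2"
    proof cases
      case 1
      then show ?thesis
        using c0[OF k] c0[OF k'] by (simp add: g11_def g12_def g21_def g22_def)
    next
      case 2
      have "norm (of_real (Ac\<^sup>2) :: complex) \<le> Ac\<^sup>2 + \<bar>Ac\<bar> * norm Ec + (norm Ec)\<^sup>2"
        "norm (- Ac * Ec) \<le> Ac\<^sup>2 + \<bar>Ac\<bar> * norm Ec + (norm Ec)\<^sup>2"
        "norm (- Ac * cnj Ec) \<le> Ac\<^sup>2 + \<bar>Ac\<bar> * norm Ec + (norm Ec)\<^sup>2"
        "norm (of_real ((norm Ec)\<^sup>2) :: complex) \<le> Ac\<^sup>2 + \<bar>Ac\<bar> * norm Ec + (norm Ec)\<^sup>2"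
        by (simp_all add: norm_mult norm_power)
      from this[THEN c1[OF w]] show ?thesis
        unfolding 2 by (simp add: g11_def g12_def g21_def g22_def norm_divide norm_mult norm_power)
    next
      case 3
      note b = bnd[OF w 3]
      have "norm (cnj (E (real n * \<omega>))) \<le> M2 * (real n * \<omega>)\<^sup>2" using b by simp
      from c2[OF w 3 this] c2[OF w 3 b[THEN conjunct1]] c2[OF w 3 b[THEN conjunct2, THEN conjunct1]]
        c2[OF w 3 b[THEN conjunct2, THEN conjunct2]] 3 dt_nz[OF w 3]
      show ?thesis
        by (simp add: g11_def g12_def g21_def g22_def norm_divide norm_mult)
    qed
    then show "norm (g11 \<omega> n) \<le> C / (real n + 1)\<^sup>2" "norm (g12 \<omega> n) \<le> C / (real n + 1)\<^sup>2"
      "norm (g21 \<omega> n) \<le> C / (real n + 1)\<^sup>2" "norm (g22 \<omega> n) \<le> C / (real n + 1)\<^sup>2" by blast+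
  qed
qed

lemma g_continuous:
  assumes "continuous_on UNIV f" "\<And>p. \<bar>f p - \<omega>0\<bar> \<le> \<delta>0"
  shows "continuous_on UNIV (\<lambda>p. g11 (f p) n)" "continuous_on UNIV (\<lambda>p. g12 (f p) n)"
    "continuous_on UNIV (\<lambda>p. g21 (f p) n)" "continuous_on UNIV (\<lambda>p. g22 (f p) n)"
proof -
  have q: "Q (f p) \<noteq> 0" for p using \<delta>0(3)[OF assms(2)[of p]] Q0 by auto
  have d: "dt (real n * f p) \<noteq> 0" if "\<not> n = 0" "\<not> n = Suc 0" for p
    using dt_nz[OF assms(2)[of p], of n] that by auto
  show "continuous_on UNIV (\<lambda>p. g11 (f p) n)" "continuous_on UNIV (\<lambda>p. g12 (f p) n)"
    "continuous_on UNIV (\<lambda>p. g21 (f p) n)" "continuous_on UNIV (\<lambda>p. g22 (f p) n)"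
    unfolding g11_def g12_def g21_def g22_def
    using q d by (cases "n = 0"; cases "n = 1"; simp; intro continuous_intros assms; simp)+
qed

section \<open>Solving the linear equation mode by mode\<close>

lemma mode_high:
  fixes u v z1 z2 :: complex and \<omega> :: real
  assumes w: "\<bar>\<omega> - \<omega>0\<bar> \<le> \<delta>0" and n: "2 \<le> n"
  defines "K \<equiv> real n * \<omega>"
  defines "z1 \<equiv> g11 \<omega> n * u + g12 \<omega> n * v" and "z2 \<equiv> g21 \<omega> n * u + g22 \<omega> n * v"
  shows "A K * z1 - E K * z2 = u" "B K * z2 - cnj (E K) * z1 = v"
proof -
  have d: "complex_of_real (dt K) \<noteq> 0" using dt_nz[OF w n] by (simp add: K_def)
  have dd: "complex_of_real (dt K) = A K * B K - E K * cnj (E K)"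
    by (simp only: symdet_def of_real_diff of_real_mult complex_norm_square)
  have z: "z1 = (B K * u + E K * v) / dt K" "z2 = (cnj (E K) * u + A K * v) / dt K"
    using n by (simp_all add: z1_def z2_def g11_def g12_def g21_def g22_def K_def add_divide_distrib)
  have "A K * z1 - E K * z2 = (A K * (B K * u + E K * v) - E K * (cnj (E K) * u + A K * v)) / dt K"
    unfolding z by (simp add: diff_divide_distrib)
  also have "\<dots> = (dt K * u) / dt K" unfolding dd by (simp add: algebra_simps)
  finally show "A K * z1 - E K * z2 = u" using d by simp
  have "B K * z2 - cnj (E K) * z1 = (B K * (cnj (E K) * u + A K * v) - cnj (E K) * (B K * u + E K * v)) / dt K"
    unfolding z by (simp add: diff_divide_distrib)
  also have "\<dots> = (dt K * v) / dt K" unfolding dd by (simp add: algebra_simps)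
  finally show "B K * z2 - cnj (E K) * z1 = v" using d by simp
qed

text \<open>The symbol at 0 multiplies (1, -1) by 2 (1 + \<kappa>) and annihilates (1, 1). Only the
  part of (u, v) along (1, -1) is recovered; the lost mean reappears as the constant \<gamma> of
  \<open>multop_solves\<close>.\<close>

lemma mode_0:
  fixes u v z1 z2 :: complex and \<omega> :: real
  defines "z1 \<equiv> g11 \<omega> 0 * u + g12 \<omega> 0 * v" and "z2 \<equiv> g21 \<omega> 0 * u + g22 \<omega> 0 * v"
  shows "A 0 * z1 - E 0 * z2 = (u - v) / 2" "B 0 * z2 - cnj (E 0) * z1 = (v - u) / 2"
proof -
  have k: "complex_of_real (1 + \<kappa>) \<noteq> 0" unfolding of_real_eq_0_iff using \<kappa> by simp
  have z: "z1 = (u - v) / 4 / (1 + \<kappa>)" "z2 = - z1"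
    by (simp_all add: z1_def z2_def g11_def g12_def g21_def g22_def diff_divide_distrib)
  have e: "(1 + \<kappa>) * z1 = (u - v) / 4"
    using nonzero_eq_divide_eq[OF k, THEN iffD1, OF z(1)] by (simp only: mult.commute)
  have "A 0 * z1 - E 0 * z2 = 2 * ((1 + \<kappa>) * z1)" "B 0 * z2 - cnj (E 0) * z1 = - 2 * ((1 + \<kappa>) * z1)"
    unfolding z(2) by (simp_all add: symA_def symB_def symE_0 algebra_simps)
  note p = this[unfolded e]
  have q: "2 * ((u - v) / 4) = (u - v) / 2" "- 2 * ((u - v) / 4) = (v - u) / 2" by (simp_all add: field_simps)
  show "A 0 * z1 - E 0 * z2 = (u - v) / 2" by (simp only: p q)
  show "B 0 * z2 - cnj (E 0) * z1 = (v - u) / 2" by (simp only: p q)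
qed

lemma norm_Ec_sq: "complex_of_real ((norm Ec)\<^sup>2) = Ec * cnj Ec"
  by (rule complex_norm_square)

lemma norm_Ec_sq': "(norm Ec)\<^sup>2 = Re Ec * Re Ec + Im Ec * Im Ec"
  unfolding cmod_power2 by (simp only: power2_eq_square)

text \<open>The compressed equation says that the residual is orthogonal to (- Ac, cnj Ec), so it is
  a multiple of \<mu>. Its coefficient s is read off the second component, which is possible because
  Ac is nonzero.\<close>

lemma mode_1:
  fixes u v z1 z2 s :: complex and \<omega> :: real
  assumes w: "\<bar>\<omega> - \<omega>0\<bar> \<le> \<delta>0"
  defines "z1 \<equiv> g11 \<omega> 1 * u + g12 \<omega> 1 * v" and "z2 \<equiv> g21 \<omega> 1 * u + g22 \<omega> 1 * v"
  defines "s \<equiv> (B \<omega> * z2 - cnj (E \<omega>) * z1 - v) / Ac"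
  shows "A \<omega> * z1 - E \<omega> * z2 = u + s * Ec" "B \<omega> * z2 - cnj (E \<omega>) * z1 = v + s * Ac"
    "cnj Ec * z1 + Ac * z2 = 0"
proof -
  have q: "complex_of_real (Q \<omega>) \<noteq> 0" using \<delta>0(3)[OF w] Q0 by auto
  have ac: "complex_of_real Ac \<noteq> 0" using A0 by auto
  define t where "t = (- Ac * u + Ec * v) / Q \<omega>"
  have z: "z1 = - Ac * t" "z2 = cnj Ec * t"
    unfolding z1_def z2_def g11_def g12_def g21_def g22_def t_def
    by (simp_all add: norm_Ec_sq[unfolded power2_eq_square of_real_mult] diff_divide_distrib add_divide_distrib power2_eq_square algebra_simps)
  then show "cnj Ec * z1 + Ac * z2 = 0" by simp
  show 2: "B \<omega> * z2 - cnj (E \<omega>) * z1 = v + s * Ac" using ac by (simp add: s_def)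
  have Qc: "complex_of_real (Q \<omega>) = Ac\<^sup>2 * A \<omega> + Ac * (E \<omega> * cnj Ec + cnj (E \<omega>) * Ec) + Ec * cnj Ec * B \<omega>"
    unfolding Q_def norm_Ec_sq' by (simp add: complex_eq_iff power2_eq_square algebra_simps)
  have "- Ac * (A \<omega> * z1 - E \<omega> * z2 - u) + Ec * (B \<omega> * z2 - cnj (E \<omega>) * z1 - v) = Q \<omega> * t + Ac * u - Ec * v"
    unfolding z Qc by (simp add: power2_eq_square algebra_simps)
  also have "\<dots> = 0" using q by (simp add: t_def)
  finally have 3: "- Ac * (A \<omega> * z1 - E \<omega> * z2 - u) + Ec * (B \<omega> * z2 - cnj (E \<omega>) * z1 - v) = 0" .
  have "B \<omega> * z2 - cnj (E \<omega>) * z1 - v = s * Ac" using 2 by simp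
  from 3[unfolded this] have "Ac * (A \<omega> * z1 - E \<omega> * z2 - u) = Ec * (s * Ac)"
    unfolding of_real_minus by algebra
  then have "A \<omega> * z1 - E \<omega> * z2 - u = Ec * s" using ac by (simp add: mult_ac)
  then show "A \<omega> * z1 - E \<omega> * z2 = u + s * Ec" by (simp add: algebra_simps)
qed

text \<open>The symbol applied to \<open>\<mu>\<close>, which spans its kernel at \<open>\<omega>0\<close>.\<close>

definition k1 :: "real \<Rightarrow> complex" where "k1 \<omega> = A \<omega> * Ec - E \<omega> * Ac"
definition k2 :: "real \<Rightarrow> complex" where "k2 \<omega> = B \<omega> * Ac - cnj (E \<omega>) * Ec"

text \<open>Both components vanish at \<omega>0 because \<mu> spans the kernel. At frequency
  \<omega>0 + a \<xi> they are O(a), which compensates the factor 1 / a in front of them in the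
  scaled equation.\<close>

lemma k_lipschitz:
  obtains C where "C > 0" "\<And>\<omega>. \<bar>\<omega> - \<omega>0\<bar> \<le> \<delta>0 \<Longrightarrow> norm (k1 \<omega>) \<le> C * \<bar>\<omega> - \<omega>0\<bar>"
    "\<And>\<omega>. \<bar>\<omega> - \<omega>0\<bar> \<le> \<delta>0 \<Longrightarrow> norm (k2 \<omega>) \<le> C * \<bar>\<omega> - \<omega>0\<bar>"
proof -
  define C1 where "C1 = c\<^sup>2 * (3 * \<omega>0) * norm Ec + (1 + \<kappa>) * \<bar>Ac\<bar>"
  define C2 where "C2 = m * c\<^sup>2 * (3 * \<omega>0) * \<bar>Ac\<bar> + (1 + \<kappa>) * norm Ec"
  have C: "C1 \<ge> 0" "C2 \<ge> 0" using m \<kappa> \<omega>0 by (simp_all add: C1_def C2_def)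
  have sq: "\<bar>\<omega>\<^sup>2 - \<omega>0\<^sup>2\<bar> \<le> (3 * \<omega>0) * \<bar>\<omega> - \<omega>0\<bar>" if "\<bar>\<omega> - \<omega>0\<bar> \<le> \<delta>0" for \<omega>
  proof -
    have "\<bar>\<omega>\<^sup>2 - \<omega>0\<^sup>2\<bar> = \<bar>\<omega> + \<omega>0\<bar> * \<bar>\<omega> - \<omega>0\<bar>"
      by (simp add: power2_eq_square square_diff_square_factored abs_mult)
    also have "\<dots> \<le> (3 * \<omega>0) * \<bar>\<omega> - \<omega>0\<bar>"
      using that \<delta>0 \<omega>0 by (intro mult_right_mono) auto
    finally show ?thesis .
  qed
  have 1: "norm (k1 \<omega>) \<le> C1 * \<bar>\<omega> - \<omega>0\<bar>" if w: "\<bar>\<omega> - \<omega>0\<bar> \<le> \<delta>0" for \<omega>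
  proof -
    have "k1 \<omega> = complex_of_real (c\<^sup>2 * - (\<omega>\<^sup>2 - \<omega>0\<^sup>2)) * Ec - (E \<omega> - Ec) * Ac"
      by (simp add: k1_def symA_def algebra_simps)
    then have "norm (k1 \<omega>) \<le> norm (complex_of_real (c\<^sup>2 * - (\<omega>\<^sup>2 - \<omega>0\<^sup>2)) * Ec) + norm ((E \<omega> - Ec) * Ac)"
      by (metis norm_triangle_ineq4)
    also have "\<dots> = c\<^sup>2 * \<bar>\<omega>\<^sup>2 - \<omega>0\<^sup>2\<bar> * norm Ec + norm (E \<omega> - Ec) * \<bar>Ac\<bar>"
      by (simp only: norm_mult norm_of_real abs_mult abs_minus_cancel abs_power2)
    also have "\<dots> \<le> c\<^sup>2 * ((3 * \<omega>0) * \<bar>\<omega> - \<omega>0\<bar>) * norm Ec + ((1 + \<kappa>) * \<bar>\<omega> - \<omega>0\<bar>) * \<bar>Ac\<bar>"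
      by (intro add_mono mult_right_mono mult_left_mono sq w symE_lipschitz \<kappa>) auto
    finally show ?thesis by (simp add: C1_def algebra_simps)
  qed
  have 2: "norm (k2 \<omega>) \<le> C2 * \<bar>\<omega> - \<omega>0\<bar>" if w: "\<bar>\<omega> - \<omega>0\<bar> \<le> \<delta>0" for \<omega>
  proof -
    have "complex_of_real (B \<omega>0) * Ac = cnj Ec * Ec"
      using AB0 by (metis complex_norm_square mult.commute of_real_mult)
    then have "k2 \<omega> = complex_of_real (m * c\<^sup>2 * - (\<omega>\<^sup>2 - \<omega>0\<^sup>2)) * Ac - cnj (E \<omega> - Ec) * Ec"
      by (simp add: k2_def symB_def algebra_simps)
    then have "norm (k2 \<omega>) \<le> norm (complex_of_real (m * c\<^sup>2 * - (\<omega>\<^sup>2 - \<omega>0\<^sup>2)) * Ac) + norm (cnj (E \<omega> - Ec) * Ec)"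
      by (metis norm_triangle_ineq4)
    also have "\<dots> = m * c\<^sup>2 * \<bar>\<omega>\<^sup>2 - \<omega>0\<^sup>2\<bar> * \<bar>Ac\<bar> + norm (E \<omega> - Ec) * norm Ec"
      using m by (simp only: norm_mult norm_of_real abs_mult abs_minus_cancel abs_power2 complex_mod_cnj abs_of_pos)
    also have "\<dots> \<le> m * c\<^sup>2 * ((3 * \<omega>0) * \<bar>\<omega> - \<omega>0\<bar>) * \<bar>Ac\<bar> + ((1 + \<kappa>) * \<bar>\<omega> - \<omega>0\<bar>) * norm Ec"
      using m by (intro add_mono mult_right_mono mult_left_mono sq w symE_lipschitz \<kappa>) auto
    finally show ?thesis by (simp add: C2_def algebra_simps)
  qed
  show ?thesis
  proof (rule that[of "C1 + C2 + 1"])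
    fix \<omega> assume w: "\<bar>\<omega> - \<omega>0\<bar> \<le> \<delta>0"
    have "C1 * \<bar>\<omega> - \<omega>0\<bar> \<le> (C1 + C2 + 1) * \<bar>\<omega> - \<omega>0\<bar>" "C2 * \<bar>\<omega> - \<omega>0\<bar> \<le> (C1 + C2 + 1) * \<bar>\<omega> - \<omega>0\<bar>"
      using C by (intro mult_right_mono; simp)+
    then show "norm (k1 \<omega>) \<le> (C1 + C2 + 1) * \<bar>\<omega> - \<omega>0\<bar>" "norm (k2 \<omega>) \<le> (C1 + C2 + 1) * \<bar>\<omega> - \<omega>0\<bar>"
      using 1[OF w] 2[OF w] by linarith+
  qed (use C in simp)
qed

lemma h_eq: "complex_of_real (h \<omega>) = cnj Ec * k1 \<omega> + Ac * k2 \<omega>"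
  unfolding h_def k1_def k2_def norm_Ec_sq' by (simp add: complex_eq_iff power2_eq_square algebra_simps)

text \<open>Transversality: \<open>h' \<omega>0 = Ac * dt' \<omega>0\<close>, and \<open>dt' \<omega>0 > 0\<close> by the lower bound on \<open>dt\<close>.\<close>

lemma h_transversal:
  obtains c1 d1 where "c1 > 0" "d1 > 0" "\<And>t. \<bar>t\<bar> \<le> d1 \<Longrightarrow> t * h (\<omega>0 + t) \<le> - c1 * t\<^sup>2"
proof -
  define A' where "A' = - c\<^sup>2 * (2 * \<omega>0)"
  define B' where "B' = - m * c\<^sup>2 * (2 * \<omega>0)"
  define N' where "N' = (1 - \<kappa>)\<^sup>2 * sin \<omega>0 * cos \<omega>0 - (1 + \<kappa>)\<^sup>2 * cos \<omega>0 * sin \<omega>0"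
  define D' where "D' = A' * B \<omega>0 + Ac * B' - 2 * N'"
  have dA: "(A has_real_derivative A') (at \<omega>0)"
    unfolding symA_def A'_def by (auto intro!: derivative_eq_intros)
  have dB: "(B has_real_derivative B') (at \<omega>0)"
    unfolding symB_def B'_def by (auto intro!: derivative_eq_intros)
  have dN: "((\<lambda>K. (norm (E K))\<^sup>2) has_real_derivative 2 * N') (at \<omega>0)"
    unfolding norm_symE_sq N'_def power_mult_distrib
    by (auto intro!: derivative_eq_intros simp: algebra_simps)
  have dR: "((\<lambda>\<omega>. Re (E \<omega> * cnj Ec)) has_real_derivative N') (at \<omega>0)"
    unfolding Re_E N'_def by (auto intro!: derivative_eq_intros simp: algebra_simps)
  have dD: "(dt has_real_derivative D') (at \<omega>0)"
    unfolding symdet_def D'_def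
    by (rule DERIV_cong[OF DERIV_diff[OF DERIV_mult[OF dA dB] dN]]) simp
  \<comment> \<open>Replacing |Ec| squared by Ac \<open>B \<omega>0\<close> takes a common factor Ac
    out of the derivative of the form and leaves that of the determinant.\<close>
  have dh: "(h has_real_derivative Ac * D') (at \<omega>0)"
    unfolding h_def D'_def AB0[symmetric]
    by (rule DERIV_cong[OF DERIV_add[OF DERIV_diff[OF DERIV_cmult[OF dA] DERIV_cmult[OF dR]] DERIV_cmult[OF dB]]])
       (simp add: power2_eq_square algebra_simps)
  obtain e where e: "e > 0" "\<And>K. K \<ge> \<omega>0 \<Longrightarrow> e * (K\<^sup>2 * (K\<^sup>2 - \<omega>0\<^sup>2)) \<le> dt K" using det_lower by blast
  have D': "D' > 0"
  proof (rule ccontr)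
    assume "\<not> D' > 0"
    \<comment> \<open>The assumed lower bound puts the determinant above the line of slope
      \<open>e * \<omega>0 ^ 3\<close> to the right of \<omega>0, using K \<ge> \<omega>0 twice; a
      derivative \<le> 0 would put it below.\<close>
    let ?p = "\<lambda>K. dt K - e * \<omega>0 ^ 3 * (K - \<omega>0)"
    have dp: "(?p has_real_derivative D' - e * \<omega>0 ^ 3) (at \<omega>0)"
      by (auto intro!: derivative_eq_intros dD)
    have "D' - e * \<omega>0 ^ 3 < 0" using \<open>\<not> D' > 0\<close> e(1) \<omega>0
      by (smt (verit) mult_pos_pos zero_less_power)
    from DERIV_neg_dec_right[OF dp this] obtain d where d: "d > 0" "\<And>t. 0 < t \<Longrightarrow> t < d \<Longrightarrow> ?p (\<omega>0 + t) < ?p \<omega>0"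
      by blast
    let ?t = "d / 2"
    let ?K = "\<omega>0 + ?t"
    have "?p ?K < 0" using d(2)[of ?t] d(1) det0 by simp
    moreover have "e * \<omega>0 ^ 3 * ?t \<le> e * (?K\<^sup>2 * (?K\<^sup>2 - \<omega>0\<^sup>2))"
    proof -
      have "\<omega>0\<^sup>2 * (\<omega>0 * ?t) \<le> ?K\<^sup>2 * (?K\<^sup>2 - \<omega>0\<^sup>2)"
      proof (rule mult_mono)
        show "\<omega>0\<^sup>2 \<le> ?K\<^sup>2" using d(1) \<omega>0 by (intro power_mono) auto
        show "\<omega>0 * ?t \<le> ?K\<^sup>2 - \<omega>0\<^sup>2" using d(1) \<omega>0 by (simp add: power2_eq_square algebra_simps)
      qed (use d(1) \<omega>0 in auto)
      then have "e * (\<omega>0\<^sup>2 * (\<omega>0 * ?t)) \<le> e * (?K\<^sup>2 * (?K\<^sup>2 - \<omega>0\<^sup>2))" using e(1) by (intro mult_left_mono) auto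
      then show ?thesis by (simp add: power2_eq_square power3_eq_cube mult_ac)
    qed
    moreover have "e * (?K\<^sup>2 * (?K\<^sup>2 - \<omega>0\<^sup>2)) \<le> dt ?K" using e(2)[of ?K] d(1) by simp
    ultimately show False by simp
  qed
  define l where "l = Ac * D'"
  have l: "l < 0" using D' A0 by (simp add: l_def mult_neg_pos)
  have "Re (Ec * cnj Ec) = (norm Ec)\<^sup>2" by (simp only: complex_norm_square[symmetric] Re_complex_of_real)
  then have h0: "h \<omega>0 = 0" unfolding h_def AB0[symmetric] by (simp add: power2_eq_square algebra_simps)
  \<comment> \<open>Subtracting a line of half the slope leaves a function that still decreases
    through 0, so one comparison yields the quadratic bound for both signs of t.\<close>
  let ?p = "\<lambda>K. h K - (l / 2) * (K - \<omega>0)"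
  have dp: "(?p has_real_derivative l / 2) (at \<omega>0)"
    by (rule derivative_eq_intros dh refl | simp add: l_def)+
  have l2: "l / 2 < 0" using l by simp
  obtain d where d: "d > 0" "\<And>t. 0 < t \<Longrightarrow> t < d \<Longrightarrow> ?p (\<omega>0 + t) < ?p \<omega>0"
    using DERIV_neg_dec_right[OF dp l2] by blast
  obtain d' where d': "d' > 0" "\<And>t. 0 < t \<Longrightarrow> t < d' \<Longrightarrow> ?p \<omega>0 < ?p (\<omega>0 - t)"
    using DERIV_neg_dec_left[OF dp l2] by blast
  show ?thesis
  proof (rule that[of "- l / 2" "min (d / 2) (d' / 2)"])
    fix t assume t: "\<bar>t\<bar> \<le> min (d / 2) (d' / 2)"
    consider "t > 0" | "t = 0" | "t < 0" by linarith
    then have "t * ?p (\<omega>0 + t) \<le> 0"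
    proof cases
      case 1
      then have "?p (\<omega>0 + t) < 0" using d(2)[of t] t d(1) h0 by simp
      then show ?thesis using 1 by (intro mult_nonneg_nonpos) auto
    next
      case 3
      then have "?p (\<omega>0 + t) > 0" using d'(2)[of "- t"] t d'(1) h0 by simp
      then show ?thesis using 3 by (intro mult_nonpos_nonneg) auto
    qed simp
    then show "t * h (\<omega>0 + t) \<le> - (- l / 2) * t\<^sup>2" by (simp add: power2_eq_square algebra_simps)
  qed (use l d d' in auto)
qed

end

section \<open>Fixed points, conservation laws and the linear problem\<close>

text \<open>The contraction principle on a closed ball of bounded continuous functions, phrased for
  plain functions so that the type of bounded continuous functions does not occur in the
  application.\<close>

lemma ex_bounded_fixed_point:
  fixes \<Phi> :: "('a::metric_space \<Rightarrow> 'b::banach) \<Rightarrow> 'a \<Rightarrow> 'b"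
  assumes r: "0 \<le> r"
    and self: "\<And>f x. continuous_on UNIV f \<Longrightarrow> (\<And>x. norm (f x) \<le> r) \<Longrightarrow>
      continuous_on UNIV (\<Phi> f) \<and> norm (\<Phi> f x) \<le> r"
    and contr: "\<And>f g d x. continuous_on UNIV f \<Longrightarrow> (\<And>x. norm (f x) \<le> r) \<Longrightarrow>
      continuous_on UNIV g \<Longrightarrow> (\<And>x. norm (g x) \<le> r) \<Longrightarrow> (\<And>x. norm (f x - g x) \<le> d) \<Longrightarrow>
      norm (\<Phi> f x - \<Phi> g x) \<le> d / 2"
  obtains f where "continuous_on UNIV f" "\<And>x. norm (f x) \<le> r" "\<Phi> f = f"
proof -
  let ?S = "{f :: 'a \<Rightarrow>\<^sub>C 'b. norm f \<le> r}"
  let ?T = "\<lambda>f. Bcontfun (\<Phi> (apply_bcontfun f))"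
  have S_cball: "?S = cball 0 r" by auto
  have in_S: "norm (apply_bcontfun f x) \<le> r" if "f \<in> ?S" for f x
    using norm_bounded[of f x] that by simp
  have bc: "\<Phi> (apply_bcontfun f) \<in> bcontfun" if "f \<in> ?S" for f
    using self[OF continuous_on_apply_bcontfun in_S[OF that]] by (intro bcontfun_normI[of _ r]) auto
  have ap: "apply_bcontfun (?T f) = \<Phi> (apply_bcontfun f)" if "f \<in> ?S" for f
    using bc[OF that] by (simp add: Bcontfun_inverse)
  have "\<exists>!f\<in>?S. ?T f = f"
  proof (rule Banach_fix[where c = "1/2"])
    show "complete ?S" unfolding S_cball by (simp add: complete_eq_closed)
    show "?S \<noteq> {}" unfolding S_cball using r by simp
    show "?T ` ?S \<subseteq> ?S"
    proof safe
      fix f :: "'a \<Rightarrow>\<^sub>C 'b" assume "norm f \<le> r"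
      then have f: "f \<in> ?S" by simp
      show "norm (?T f) \<le> r"
        using self[OF continuous_on_apply_bcontfun in_S[OF f]] by (intro norm_bound) (simp add: ap[OF f])
    qed
    show "dist (?T f) (?T g) \<le> 1 / 2 * dist f g" if "f \<in> ?S" "g \<in> ?S" for f g
    proof (rule dist_bound)
      fix x
      have "norm (\<Phi> (apply_bcontfun f) x - \<Phi> (apply_bcontfun g) x) \<le> dist f g / 2"
        by (rule contr[OF continuous_on_apply_bcontfun in_S[OF that(1)] continuous_on_apply_bcontfun in_S[OF that(2)]])
           (metis dist_bounded dist_norm)
      then show "dist (apply_bcontfun (?T f) x) (apply_bcontfun (?T g) x) \<le> 1 / 2 * dist f g"
        using ap that by (simp add: dist_norm)
    qed
  qed auto
  then obtain f where f: "f \<in> ?S" "?T f = f" by blast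
  then have "\<Phi> (apply_bcontfun f) = apply_bcontfun f" using ap[OF f(1)] by simp
  then show ?thesis using that[OF continuous_on_apply_bcontfun in_S[OF f(1)]] by blast
qed

lemma integral_Re_cis:
  assumes v: "continuous_on UNIV v"
  shows "integral {- pi..pi} (\<lambda>x. Re (z * cis x) * v x) = 2 * pi * Re (z * cnj (fc v 1))"
proof -
  let ?F = "\<lambda>x. of_real (v x) * cis (- (real_of_int 1 * x))"
  have "cnj (integral {- pi..pi} ?F) = integral {- pi..pi} (\<lambda>x. cnj (?F x))"
    by (rule integral_cnj)
  also have "(\<lambda>x. cnj (?F x)) = (\<lambda>x. of_real (v x) * cis x)" by (simp add: cis_cnj)
  finally have 1: "2 * pi * (z * cnj (fc v 1)) = integral {- pi..pi} (\<lambda>x. z * (of_real (v x) * cis x))"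
    by (simp add: fc_def)
  have "(\<lambda>x. z * (of_real (v x) * cis x)) integrable_on {- pi..pi}"
    using v by (intro integrable_continuous_real continuous_intros) (auto intro: continuous_on_subset)
  from integral_linear[OF this bounded_linear_Re]
  have "integral {- pi..pi} (\<lambda>x. Re (z * (of_real (v x) * cis x))) = Re (2 * pi * (z * cnj (fc v 1)))"
    unfolding 1 by (simp add: o_def)
  moreover have "Re (2 * pi * (z * cnj (fc v 1))) = 2 * pi * Re (z * cnj (fc v 1))" by simp
  moreover have "(\<lambda>x. Re (z * (of_real (v x) * cis x))) = (\<lambda>x. Re (z * cis x) * v x)"
    by (simp add: fun_eq_iff algebra_simps)
  ultimately show ?thesis by simp
qed

lemma periodic_integral_shift_diff:
  fixes f :: "real \<Rightarrow> real"
  assumes "continuous_on UNIV f" "\<And>x. f (x + 2 * pi) = f x"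
  shows "integral {- pi..pi} (\<lambda>x. f x - f (x + w)) = 0"
proof -
  have c: "continuous_on UNIV (\<lambda>x. f (x + w))"
    by (rule continuous_on_compose2[OF assms(1)]) (auto intro!: continuous_intros)
  have "f integrable_on {- pi..pi}" "(\<lambda>x. f (x + w)) integrable_on {- pi..pi}"
    using assms(1) c by (auto intro!: integrable_continuous_real intro: continuous_on_subset)
  then show ?thesis
    using periodic_integral_shift[OF assms, of w] by (simp add: integral_diff)
qed

text \<open>The translation \<open>u \<mapsto> u + (t, t)\<close> and the phase shift \<open>u \<mapsto> u (\<cdot> + t)\<close> leave the
  underlying action invariant, so residuals are orthogonal to the generators of both.\<close>

lemma tw_residual_orthogonal:
  fixes f g :: "real \<Rightarrow> real"
  assumes F: "\<And>t. (F has_real_derivative f t) (at t)" and G: "\<And>t. (G has_real_derivative g t) (at t)"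
    and f: "continuous_on UNIV f" and g: "continuous_on UNIV g"
    and u1: "\<And>x. (u1 has_real_derivative v1 x) (at x)" "\<And>x. (v1 has_real_derivative w1 x) (at x)"
    and u2: "\<And>x. (u2 has_real_derivative v2 x) (at x)" "\<And>x. (v2 has_real_derivative w2 x) (at x)"
    and per: "\<And>x. u1 (x + 2 * pi) = u1 x" "\<And>x. u2 (x + 2 * pi) = u2 x"
    and r: "continuous_on UNIV r1" "continuous_on UNIV r2"
    and eq1: "\<And>x. M1 * w1 x = f (u2 (x + w) - u1 x) - g (u1 x - u2 (x - w)) + r1 x"
    and eq2: "\<And>x. M2 * w2 x = g (u1 (x + w) - u2 x) - f (u2 x - u1 (x - w)) + r2 x"
  shows "integral {- pi..pi} (\<lambda>x. r1 x + r2 x) = 0"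
    and "integral {- pi..pi} (\<lambda>x. r1 x * v1 x + r2 x * v2 x) = 0"
proof -
  have dper: "v (x + 2 * pi) = v x" if "\<And>x. (u has_real_derivative v x) (at x)" "\<And>x. u (x + 2 * pi) = u x"
    for u v :: "real \<Rightarrow> real" and x
  proof -
    have "((\<lambda>x. u (x + 2 * pi)) has_real_derivative v (x + 2 * pi)) (at x)"
      using that(1)[of "x + 2 * pi"] by (simp add: DERIV_shift)
    then show ?thesis using that(1)[of x] that(2) DERIV_unique by fastforce
  qed
  have dcont: "continuous_on UNIV u" if "\<And>x. (u has_real_derivative v x) (at x)" for u v :: "real \<Rightarrow> real"
    using that by (meson DERIV_continuous_on has_field_derivative_at_within)
  note vper = dper[OF u1(1) per(1)] dper[OF u2(1) per(2)]
  note cont = dcont[OF u1(1)] dcont[OF u1(2)] dcont[OF u2(1)] dcont[OF u2(2)]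
  have sh: "continuous_on UNIV (\<lambda>x. u (x + t))" "continuous_on UNIV (\<lambda>x. u (x - t))"
    if "continuous_on UNIV u" for u :: "real \<Rightarrow> real" and t
    by (rule continuous_on_compose2[OF that]; auto intro!: continuous_intros)+
  have dv: "integral {- pi..pi} P' = 0"
    if "\<And>x. (P has_real_derivative P' x) (at x)" "\<And>x. P (x + 2 * pi) = P x" for P P' :: "real \<Rightarrow> real"
    using periodic_integral_deriv[of P P'] that by (simp add: has_real_derivative_iff_has_vector_derivative)
  define a where "a x = f (u2 x - u1 (x - w))" for x
  define b where "b x = g (u1 x - u2 (x - w))" for x
  have ab: "a (x + w) = f (u2 (x + w) - u1 x)" "b (x + w) = g (u1 (x + w) - u2 x)" for x
    by (simp_all add: a_def b_def)
  have p': "u1 (x + 2 * pi - w) = u1 (x - w)" "u2 (x + 2 * pi - w) = u2 (x - w)" for x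
    using per(1)[of "x - w"] per(2)[of "x - w"] by (simp_all add: algebra_simps)
  have ca: "continuous_on UNIV a" "continuous_on UNIV b"
    unfolding a_def b_def
    by (rule continuous_on_compose2[OF f] continuous_on_compose2[OF g]; auto intro!: continuous_intros cont sh)+
  have pa: "a (x + 2 * pi) = a x" "b (x + 2 * pi) = b x" for x
    by (simp_all add: a_def b_def per p')
  have int: "h integrable_on {- pi..pi}" if "continuous_on UNIV h" for h :: "real \<Rightarrow> real"
    using that by (auto intro!: integrable_continuous_real intro: continuous_on_subset)
  have s0: "integral {- pi..pi} (\<lambda>x. M1 * w1 x + M2 * w2 x) = 0"
    by (rule dv[of "\<lambda>x. M1 * v1 x + M2 * v2 x"]) (auto intro!: derivative_eq_intros u1 u2 simp: vper)
  \<comment> \<open>Every bond force enters the two equations with opposite signs, once shifted by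
    w, so the sum of the residuals is a derivative plus differences of translates of periodic
    functions.\<close>
  have s1: "r1 x + r2 x = (M1 * w1 x + M2 * w2 x) + ((a x - a (x + w)) + (b x - b (x + w)))" for x
    using eq1[of x] eq2[of x] unfolding ab by (simp add: a_def b_def)
  have cs: "continuous_on UNIV (\<lambda>x. a x - a (x + w))" "continuous_on UNIV (\<lambda>x. b x - b (x + w))"
    by (intro continuous_intros ca sh)+
  \<comment> \<open>The second derivatives are known only pointwise; the continuity of this
    combination is read off the equations.\<close>
  have cw: "continuous_on UNIV (\<lambda>x. M1 * w1 x + M2 * w2 x)"
  proof -
    have "M1 * w1 x + M2 * w2 x = r1 x + r2 x - ((a x - a (x + w)) + (b x - b (x + w)))" for x
      using s1[of x] by simp
    then show ?thesis by (simp only:) (intro continuous_on_add continuous_on_diff r cs)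
  qed
  show "integral {- pi..pi} (\<lambda>x. r1 x + r2 x) = 0"
    unfolding s1
    by (simp only: integral_add integrable_add int cs cw s0 periodic_integral_shift_diff[OF ca(1) pa(1)]
        periodic_integral_shift_diff[OF ca(2) pa(2)])
  \<comment> \<open>Energy density of the wave. Its derivative differs from the residual paired with
    the velocities only in where the forces act, at x or at x - w.\<close>
  let ?E = "\<lambda>x. M1 * (v1 x)\<^sup>2 / 2 + M2 * (v2 x)\<^sup>2 / 2 + F (u2 x - u1 (x - w)) + G (u1 x - u2 (x - w))"
  let ?E' = "\<lambda>x. M1 * w1 x * v1 x + M2 * w2 x * v2 x + a x * (v2 x - v1 (x - w)) + b x * (v1 x - v2 (x - w))"
  have sub: "((\<lambda>x. u (x - w)) has_real_derivative v (x - w)) (at x)"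
    if "\<And>x. (u has_real_derivative v x) (at x)" for u v :: "real \<Rightarrow> real" and x
    using that[of "x - w"] DERIV_shift[of u "v (x - w)" x "- w"] by simp
  have e0: "integral {- pi..pi} ?E' = 0"
  proof (rule dv[of ?E])
    fix x
    have 1: "((\<lambda>x. F (u2 x - u1 (x - w))) has_real_derivative a x * (v2 x - v1 (x - w))) (at x)"
      unfolding a_def by (rule DERIV_chain2[OF F DERIV_diff[OF u2(1) sub[OF u1(1)]]])
    have 2: "((\<lambda>x. G (u1 x - u2 (x - w))) has_real_derivative b x * (v1 x - v2 (x - w))) (at x)"
      unfolding b_def by (rule DERIV_chain2[OF G DERIV_diff[OF u1(1) sub[OF u2(1)]]])
    show "(?E has_real_derivative ?E' x) (at x)"
      by (rule derivative_eq_intros u1(2) u2(2) 1 2 refl | simp add: algebra_simps)+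
    show "?E (x + 2 * pi) = ?E x" by (simp add: vper per p')
  qed
  \<comment> \<open>Power of the bond forces on the particles at x - w: the mismatch with
    \<open>?E'\<close> is a difference of translates of these two functions and integrates to
    zero.\<close>
  let ?A = "\<lambda>x. a x * v1 (x - w)" and ?B = "\<lambda>x. b x * v2 (x - w)"
  have pA: "?A (x + 2 * pi) = ?A x" "?B (x + 2 * pi) = ?B x" for x
  proof -
    have "v1 (x + 2 * pi - w) = v1 (x - w)" "v2 (x + 2 * pi - w) = v2 (x - w)"
      using vper(1)[of "x - w"] vper(2)[of "x - w"] by (simp_all add: algebra_simps)
    then show "?A (x + 2 * pi) = ?A x" "?B (x + 2 * pi) = ?B x" by (simp_all add: pa)
  qed
  have cA: "continuous_on UNIV ?A" "continuous_on UNIV ?B" by (intro continuous_intros ca sh cont)+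
  have cAs: "continuous_on UNIV (\<lambda>x. ?A x - ?A (x + w))" "continuous_on UNIV (\<lambda>x. ?B x - ?B (x + w))"
    using cA sh(1)[OF cA(1), of w] sh(1)[OF cA(2), of w] by (auto intro!: continuous_intros)
  have s2: "r1 x * v1 x + r2 x * v2 x = ?E' x + ((?A x - ?A (x + w)) + (?B x - ?B (x + w)))" for x
  proof -
    have r: "r1 x = M1 * w1 x - a (x + w) + b x" "r2 x = M2 * w2 x - b (x + w) + a x"
      using eq1[of x] eq2[of x] unfolding ab by (simp_all add: a_def b_def)
    show ?thesis by (simp only: r) (simp add: algebra_simps)
  qed
  have cE: "continuous_on UNIV ?E'"
  proof -
    have "?E' x = r1 x * v1 x + r2 x * v2 x - ((?A x - ?A (x + w)) + (?B x - ?B (x + w)))" for x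
      using s2[of x] by simp
    then show ?thesis by (simp only:) (intro continuous_on_add continuous_on_diff continuous_on_mult r cAs cont)
  qed
  show "integral {- pi..pi} (\<lambda>x. r1 x * v1 x + r2 x * v2 x) = 0"
    unfolding s2
    by (simp only: integral_add integrable_add int cE cAs e0 periodic_integral_shift_diff[OF cA(1) pA(1)]
        periodic_integral_shift_diff[OF cA(2) pA(2)])
qed

context dimer
begin

text \<open>The multipliers invert the linearization up to \<gamma> (1, 1) and a multiple of \<mu>
  in mode 1. The identity is checked on each mode n \<ge> 0 and lifted to a differential equation by
  \<open>fc_second_antiderivative\<close>.\<close>

lemma multop_solves:
  fixes f1 f2 :: "real \<Rightarrow> real" and s :: complex
  assumes w: "\<bar>\<omega> - \<omega>0\<bar> \<le> \<delta>0"
    and f: "continuous_on UNIV f1" "continuous_on UNIV f2"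
    and fp: "\<And>x. f1 (x + 2 * pi) = f1 x" "\<And>x. f2 (x + 2 * pi) = f2 x"
    and fb: "\<And>x. \<bar>f1 x\<bar> \<le> M" "\<And>x. \<bar>f2 x\<bar> \<le> M"
    and p1: "p1 = (\<lambda>x. multop (g11 \<omega>) f1 x + multop (g12 \<omega>) f2 x)"
    and p2: "p2 = (\<lambda>x. multop (g21 \<omega>) f1 x + multop (g22 \<omega>) f2 x)"
    and s: "s = (B \<omega> * fc p2 1 - cnj (E \<omega>) * fc p1 1 - fc f2 1) / Ac"
  shows "\<exists>q1 q2 \<gamma>. \<forall>x.
      (p1 has_real_derivative q1 x) (at x) \<and> (p2 has_real_derivative q2 x) (at x) \<and>
      (q1 has_real_derivative (p2 (x + \<omega>) + \<kappa> * p2 (x - \<omega>) - (1 + \<kappa>) * p1 x + f1 x + \<gamma> +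
         Re (2 * s * Ec * cis x)) / (c\<^sup>2 * \<omega>\<^sup>2)) (at x) \<and>
      (q2 has_real_derivative (\<kappa> * p1 (x + \<omega>) + p1 (x - \<omega>) - (1 + \<kappa>) * p2 x + f2 x + \<gamma> +
         Re (2 * s * Ac * cis x)) / (m * c\<^sup>2 * \<omega>\<^sup>2)) (at x)" (is ?ode)
    and "A \<omega> * fc p1 1 - E \<omega> * fc p2 1 = fc f1 1 + s * Ec"
    and "B \<omega> * fc p2 1 - cnj (E \<omega>) * fc p1 1 = fc f2 1 + s * Ac"
    and "cnj Ec * fc p1 1 + Ac * fc p2 1 = 0"
proof -
  obtain C where C: "C > 0"
    "\<And>n. norm (g11 \<omega> n) \<le> C / (real n + 1)\<^sup>2" "\<And>n. norm (g12 \<omega> n) \<le> C / (real n + 1)\<^sup>2"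
    "\<And>n. norm (g21 \<omega> n) \<le> C / (real n + 1)\<^sup>2" "\<And>n. norm (g22 \<omega> n) \<le> C / (real n + 1)\<^sup>2"
    using g_bound w by (metis (full_types))
  have cm: "continuous_on UNIV (multop g f)"
    if "\<And>n. norm (g n) \<le> C / (real n + 1)\<^sup>2" "continuous_on UNIV f" "\<And>x. \<bar>f x\<bar> \<le> M" for g f
  proof -
    have "continuous_on UNIV (\<lambda>(p :: real, x). multop g f x)"
    proof (rule multop_continuous[OF that(1)])
      show "continuous_on UNIV (\<lambda>(p :: real, x). f x)" unfolding case_prod_beta
        by (rule continuous_on_compose2[OF that(2)]) (auto intro: continuous_intros)
    qed (use that in auto)
    from continuous_on_compose2[OF this, of UNIV "\<lambda>x. (0, x)"] show ?thesis
      by (simp add: continuous_on_Pair)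
  qed
  have g0: "Im (g11 \<omega> 0) = 0" "Im (g12 \<omega> 0) = 0" "Im (g21 \<omega> 0) = 0" "Im (g22 \<omega> 0) = 0"
  proof -
    have "g11 \<omega> 0 = of_real (1 / (4 * (1 + \<kappa>)))" "g12 \<omega> 0 = of_real (- 1 / (4 * (1 + \<kappa>)))"
      "g21 \<omega> 0 = of_real (- 1 / (4 * (1 + \<kappa>)))" "g22 \<omega> 0 = of_real (1 / (4 * (1 + \<kappa>)))"
      by (simp_all add: g11_def g12_def g21_def g22_def)
    then show "Im (g11 \<omega> 0) = 0" "Im (g12 \<omega> 0) = 0" "Im (g21 \<omega> 0) = 0" "Im (g22 \<omega> 0) = 0"
      by (simp_all only: Im_complex_of_real)
  qed
  note cms = cm[OF C(2) f(1) fb(1)] cm[OF C(3) f(2) fb(2)] cm[OF C(4) f(1) fb(1)] cm[OF C(5) f(2) fb(2)]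
  have z1: "fc p1 (int n) = g11 \<omega> n * fc f1 n + g12 \<omega> n * fc f2 n" for n
    unfolding p1 fc_add[OF cms(1,2)]
    using fc_multop[OF C(2) f(1) fb(1) g0(1)] fc_multop[OF C(3) f(2) fb(2) g0(2)] by simp
  have z2: "fc p2 (int n) = g21 \<omega> n * fc f1 n + g22 \<omega> n * fc f2 n" for n
    unfolding p2 fc_add[OF cms(3,4)]
    using fc_multop[OF C(4) f(1) fb(1) g0(3)] fc_multop[OF C(5) f(2) fb(2) g0(4)] by simp
  have cp: "continuous_on UNIV p1" "continuous_on UNIV p2" unfolding p1 p2 by (intro continuous_intros cms)+
  have pp: "p1 (x + 2 * pi) = p1 x" "p2 (x + 2 * pi) = p2 x" for x
    unfolding p1 p2 by (simp_all add: multop_periodic)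
  note m1 = mode_1[OF w, of "fc f1 1" "fc f2 1"]
  have z11: "fc p1 1 = g11 \<omega> 1 * fc f1 1 + g12 \<omega> 1 * fc f2 1" using z1[of 1] by simp
  have z21: "fc p2 1 = g21 \<omega> 1 * fc f1 1 + g22 \<omega> 1 * fc f2 1" using z2[of 1] by simp
  show e1: "A \<omega> * fc p1 1 - E \<omega> * fc p2 1 = fc f1 1 + s * Ec"
    and e2: "B \<omega> * fc p2 1 - cnj (E \<omega>) * fc p1 1 = fc f2 1 + s * Ac"
    and "cnj Ec * fc p1 1 + Ac * fc p2 1 = 0"
    using m1 unfolding s z11 z21 by auto
  \<comment> \<open>Minus the average of the two means: the part of the right-hand side along (1,
    1), which mode 0 cannot absorb.\<close>
  define \<gamma> where "\<gamma> = - (Re (fc f1 0) + Re (fc f2 0)) / 2"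
  have \<gamma>: "complex_of_real \<gamma> = - (fc f1 0 + fc f2 0) / 2"
    using fc_0_real[of f1] fc_0_real[of f2] by (simp add: \<gamma>_def complex_eq_iff)
  \<comment> \<open>The factor 2 undoes the halving in \<open>fc_monomial\<close>, so that the first
    coefficient is exactly s z.\<close>
  define corr where "corr z x = \<gamma> + Re (2 * s * z * cis x)" for z x
  have fcorr: "fc (corr z) (int n) = (if n = 0 then of_real \<gamma> else if n = 1 then s * z else 0)" for z n
  proof -
    have "fc (corr z) (int n) = fc (\<lambda>_. \<gamma>) n + fc (\<lambda>x. Re ((2 * s * z) * cis (real 1 * x))) n"
      unfolding corr_def by (subst fc_add[symmetric]) (auto intro!: continuous_intros)
    then show ?thesis unfolding fc_const fc_monomial by auto
  qed
  have ccorr: "continuous_on UNIV (corr z)" for z unfolding corr_def by (intro continuous_intros)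
  have pcorr: "corr z (x + 2 * pi) = corr z x" for z x
    using cis_int_periodic[of 1 x] unfolding corr_def by simp
  have sh: "continuous_on UNIV (\<lambda>x. p (x + t))" "continuous_on UNIV (\<lambda>x. p (x - t))"
    if "continuous_on UNIV p" for p :: "real \<Rightarrow> real" and t
    by (rule continuous_on_compose2[OF that]; auto intro!: continuous_intros)+
  have modes: "A (n * \<omega>) * fc p1 n - E (n * \<omega>) * fc p2 n = fc f1 n + fc (corr Ec) n \<and>
     B (n * \<omega>) * fc p2 n - cnj (E (n * \<omega>)) * fc p1 n = fc f2 n + fc (corr Ac) n" for n :: nat
  proof -
    consider "n = 0" | "n = 1" | "n \<ge> 2" by linarith
    then show ?thesis
    proof cases
      case 1
      then show ?thesis
        using mode_0[of \<omega> "fc f1 0" "fc f2 0"] unfolding z1 z2 fcorr by (simp add: \<gamma> field_simps)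
    next
      case 2
      then show ?thesis using e1 e2 fcorr[of Ec 1] fcorr[of Ac 1] by simp
    next
      case 3
      then show ?thesis using mode_high[OF w 3, of "fc f1 n" "fc f2 n"] unfolding z1 z2 fcorr by auto
    qed
  qed
  have w0: "\<omega> \<noteq> 0" using w \<delta>0(2) \<omega>0 by auto
  have fsh: "fc (\<lambda>x. p (x + \<omega>)) (int n) = cis (n * \<omega>) * fc p n" "fc (\<lambda>x. p (x - \<omega>)) (int n) = cis (- (n * \<omega>)) * fc p n"
    if "continuous_on UNIV p" "\<And>x. p (x + 2 * pi) = p x" for p and n :: nat
    using fc_shift[OF that, of \<omega> n] fc_shift[OF that, of "- \<omega>" n] by simp_all
  let ?R1 = "\<lambda>x. (p2 (x + \<omega>) + \<kappa> * p2 (x - \<omega>) - (1 + \<kappa>) * p1 x + f1 x + corr Ec x)"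
  let ?R2 = "\<lambda>x. (\<kappa> * p1 (x + \<omega>) + p1 (x - \<omega>) - (1 + \<kappa>) * p2 x + f2 x + corr Ac x)"
  have lin: "fc (\<lambda>x. j * a x + k * b x - l * d x + e x + g x) n =
      j * fc a n + k * fc b n - l * fc d n + fc e n + fc g n"
    if "continuous_on UNIV a" "continuous_on UNIV b" "continuous_on UNIV d" "continuous_on UNIV e"
      "continuous_on UNIV g" for a b d e g :: "real \<Rightarrow> real" and j k l :: real and n
    using that by (simp add: fc_add fc_diff fc_scale continuous_on_add continuous_on_diff continuous_on_mult)
  have R1: "fc ?R1 (int n) = E (n * \<omega>) * fc p2 n - (1 + \<kappa>) * fc p1 n + fc f1 n + fc (corr Ec) n" for n :: nat
    using lin[OF sh(1)[OF cp(2)] sh(2)[OF cp(2)] cp(1) f(1) ccorr, of 1 \<omega> \<kappa> \<omega> "1 + \<kappa>" Ec "int n"]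
    unfolding fsh[OF cp(2) pp(2)] mult_1 by (simp add: symE_def algebra_simps)
  have R2: "fc ?R2 (int n) = cnj (E (n * \<omega>)) * fc p1 n - (1 + \<kappa>) * fc p2 n + fc f2 n + fc (corr Ac) n" for n :: nat
    using lin[OF sh(1)[OF cp(1)] sh(2)[OF cp(1)] cp(2) f(2) ccorr, of \<kappa> \<omega> 1 \<omega> "1 + \<kappa>" Ac "int n"]
    unfolding fsh[OF cp(1) pp(1)] mult_1 by (simp add: symE_def cis_cnj algebra_simps)
  have pR: "?R1 (x + 2 * pi) = ?R1 x" "?R2 (x + 2 * pi) = ?R2 x" for x
    using pp(1)[of "x + \<omega>"] pp(1)[of "x - \<omega>"] pp(2)[of "x + \<omega>"] pp(2)[of "x - \<omega>"] pp[of x] fp[of x] pcorr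
    by (simp_all add: algebra_simps)
  have cR: "continuous_on UNIV ?R1" "continuous_on UNIV ?R2" by (intro continuous_intros sh cp f ccorr)+
  obtain q1 where q1: "\<And>x. (p1 has_real_derivative q1 x) (at x)"
    "\<And>x. (q1 has_real_derivative (1 / (c\<^sup>2 * \<omega>\<^sup>2)) * ?R1 x) (at x)"
  proof (rule fc_second_antiderivative[OF cp(1) pp(1), of "\<lambda>x. (1 / (c\<^sup>2 * \<omega>\<^sup>2)) * ?R1 x"])
    show "continuous_on UNIV (\<lambda>x. (1 / (c\<^sup>2 * \<omega>\<^sup>2)) * ?R1 x)" by (intro continuous_on_mult continuous_on_const cR)
    show "(1 / (c\<^sup>2 * \<omega>\<^sup>2)) * ?R1 (x + 2 * pi) = (1 / (c\<^sup>2 * \<omega>\<^sup>2)) * ?R1 x" for x by (simp only: pR)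
    fix n :: nat
    have "fc ?R1 (int n) = - (of_real (c\<^sup>2 * \<omega>\<^sup>2) * (of_nat n)\<^sup>2 * fc p1 n)"
      using conjunct1[OF modes[of n]] unfolding R1 symA_def
      by (simp add: algebra_simps power_mult_distrib)
    then show "fc (\<lambda>x. (1 / (c\<^sup>2 * \<omega>\<^sup>2)) * ?R1 x) (int n) = - (of_nat n)\<^sup>2 * fc p1 n"
      unfolding fc_scale using c w0 by simp
  qed blast
  obtain q2 where q2: "\<And>x. (p2 has_real_derivative q2 x) (at x)"
    "\<And>x. (q2 has_real_derivative (1 / (m * c\<^sup>2 * \<omega>\<^sup>2)) * ?R2 x) (at x)"
  proof (rule fc_second_antiderivative[OF cp(2) pp(2), of "\<lambda>x. (1 / (m * c\<^sup>2 * \<omega>\<^sup>2)) * ?R2 x"])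
    show "continuous_on UNIV (\<lambda>x. (1 / (m * c\<^sup>2 * \<omega>\<^sup>2)) * ?R2 x)" by (intro continuous_on_mult continuous_on_const cR)
    show "(1 / (m * c\<^sup>2 * \<omega>\<^sup>2)) * ?R2 (x + 2 * pi) = (1 / (m * c\<^sup>2 * \<omega>\<^sup>2)) * ?R2 x" for x by (simp only: pR)
    fix n :: nat
    have "fc ?R2 (int n) = - (of_real (m * c\<^sup>2 * \<omega>\<^sup>2) * (of_nat n)\<^sup>2 * fc p2 n)"
      using conjunct2[OF modes[of n]] unfolding R2 symB_def
      by (simp add: algebra_simps power_mult_distrib)
    then show "fc (\<lambda>x. (1 / (m * c\<^sup>2 * \<omega>\<^sup>2)) * ?R2 x) (int n) = - (of_nat n)\<^sup>2 * fc p2 n"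
      unfolding fc_scale using c w0 m by simp
  qed blast
  show ?ode
    using q1 q2 unfolding corr_def
    by (intro exI[of _ q1] exI[of _ q2] exI[of _ \<gamma>]) (simp add: add.assoc)
qed

end

section \<open>The projected nonlinear problem\<close>

text \<open>A Lipschitz condition whose constant shrinks linearly towards 0: what bounded second
  derivatives give for a function vanishing to second order at 0.\<close>

definition quad_lipschitz :: "real \<Rightarrow> (real \<Rightarrow> real) \<Rightarrow> bool" where
  "quad_lipschitz L f \<longleftrightarrow> f 0 = 0 \<and>
     (\<forall>r s. \<bar>r\<bar> \<le> 1 \<longrightarrow> \<bar>s\<bar> \<le> 1 \<longrightarrow> \<bar>f r - f s\<bar> \<le> L * max \<bar>r\<bar> \<bar>s\<bar> * \<bar>r - s\<bar>)"

text \<open>The nonlinear part of a force balance at the profile \<open>(a u, a v)\<close>, divided by \<open>a\<^sup>2\<close>.\<close>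

definition NL :: "(real \<Rightarrow> real) \<Rightarrow> (real \<Rightarrow> real) \<Rightarrow> real \<Rightarrow> real \<Rightarrow> (real \<Rightarrow> real) \<Rightarrow> (real \<Rightarrow> real) \<Rightarrow> real \<Rightarrow> real" where
  "NL f g a w u v x = (f (a * (v (x + w) - u x)) - g (a * (u x - v (x - w)))) / a\<^sup>2"

text \<open>One factor \<open>a\<close> comes from the size of the arguments, the other from their
  difference. The bound 6 on strains is twice the bound 3 on components, namely 2 for \<nu> and 1
  for a \<psi>.\<close>

lemma quad_lipschitz_scaled:
  assumes f: "quad_lipschitz L f" and L: "L \<ge> 0" and a: "6 * \<bar>a\<bar> \<le> 1"
    and s: "\<bar>s\<bar> \<le> 6" "\<bar>t\<bar> \<le> 6" "\<bar>s - t\<bar> \<le> e"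
  shows "\<bar>f (a * s) - f (a * t)\<bar> \<le> 6 * L * e * a\<^sup>2"
proof -
  have 1: "\<bar>a * s\<bar> \<le> \<bar>a\<bar> * 6" "\<bar>a * t\<bar> \<le> \<bar>a\<bar> * 6" using s by (auto simp: abs_mult intro!: mult_left_mono)
  then have "\<bar>a * s\<bar> \<le> 1" "\<bar>a * t\<bar> \<le> 1" using a by linarith+
  then have "\<bar>f (a * s) - f (a * t)\<bar> \<le> L * max \<bar>a * s\<bar> \<bar>a * t\<bar> * \<bar>a * s - a * t\<bar>"
    using f unfolding quad_lipschitz_def by blast
  also have "\<dots> \<le> L * (\<bar>a\<bar> * 6) * (\<bar>a\<bar> * e)"
  proof (rule mult_mono)
    show "L * max \<bar>a * s\<bar> \<bar>a * t\<bar> \<le> L * (\<bar>a\<bar> * 6)" using 1 L by (intro mult_left_mono) auto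
    have "\<bar>a * s - a * t\<bar> = \<bar>a\<bar> * \<bar>s - t\<bar>" by (simp add: abs_mult flip: right_diff_distrib)
    then show "\<bar>a * s - a * t\<bar> \<le> \<bar>a\<bar> * e" using s by (simp add: mult_left_mono)
  qed (use L in auto)
  also have "\<dots> = 6 * L * e * \<bar>a\<bar>\<^sup>2" by (simp only: power2_eq_square) (simp add: mult_ac)
  finally show ?thesis by simp
qed

lemma NL_diff:
  assumes f: "quad_lipschitz L f" and g: "quad_lipschitz L g" and L: "L \<ge> 0" and a: "6 * \<bar>a\<bar> \<le> 1" "a \<noteq> 0"
    and b: "\<And>x. \<bar>u x\<bar> \<le> 3" "\<And>x. \<bar>v x\<bar> \<le> 3" "\<And>x. \<bar>u' x\<bar> \<le> 3" "\<And>x. \<bar>v' x\<bar> \<le> 3"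
    and d: "\<And>x. \<bar>u x - u' x\<bar> \<le> d" "\<And>x. \<bar>v x - v' x\<bar> \<le> d"
  shows "\<bar>NL f g a w u v x - NL f g a w u' v' x\<bar> \<le> 24 * L * d"
proof -
  have s: "\<bar>p - q\<bar> \<le> 6" if "\<bar>p\<bar> \<le> 3" "\<bar>q\<bar> \<le> 3" for p q :: real
    using that by linarith
  have e: "\<bar>(p - q) - (p' - q')\<bar> \<le> 2 * d" if "\<bar>p - p'\<bar> \<le> d" "\<bar>q - q'\<bar> \<le> d" for p q p' q' :: real
    using that by linarith
  have "\<bar>f (a * (v (x + w) - u x)) - f (a * (v' (x + w) - u' x))\<bar> \<le> 6 * L * (2 * d) * a\<^sup>2"
    by (rule quad_lipschitz_scaled[OF f L a(1) s[OF b(2) b(1)] s[OF b(4) b(3)] e[OF d(2) d(1)]])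
  moreover have "\<bar>g (a * (u x - v (x - w))) - g (a * (u' x - v' (x - w)))\<bar> \<le> 6 * L * (2 * d) * a\<^sup>2"
    by (rule quad_lipschitz_scaled[OF g L a(1) s[OF b(1) b(2)] s[OF b(3) b(4)] e[OF d(1) d(2)]])
  ultimately have "\<bar>(f (a * (v (x + w) - u x)) - g (a * (u x - v (x - w)))) -
      (f (a * (v' (x + w) - u' x)) - g (a * (u' x - v' (x - w))))\<bar> \<le> 24 * L * d * a\<^sup>2" by linarith
  then have "\<bar>(f (a * (v (x + w) - u x)) - g (a * (u x - v (x - w)))) -
      (f (a * (v' (x + w) - u' x)) - g (a * (u' x - v' (x - w))))\<bar> / a\<^sup>2 \<le> 24 * L * d"
    using a(2) by (simp add: pos_divide_le_eq)
  then show ?thesis unfolding NL_def by (simp add: abs_divide flip: diff_divide_distrib)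
qed

lemma NL_bound:
  assumes f: "quad_lipschitz L f" and g: "quad_lipschitz L g" and L: "L \<ge> 0" and a: "6 * \<bar>a\<bar> \<le> 1" "a \<noteq> 0"
    and b: "\<And>x. \<bar>u x\<bar> \<le> 3" "\<And>x. \<bar>v x\<bar> \<le> 3"
  shows "\<bar>NL f g a w u v x\<bar> \<le> 72 * L"
proof -
  have "NL f g a w (\<lambda>_. 0) (\<lambda>_. 0) x = 0" using f g by (simp add: NL_def quad_lipschitz_def)
  then show ?thesis using NL_diff[OF f g L a b, where u' = "\<lambda>_. 0" and v' = "\<lambda>_. 0" and d = 3 and w = w and x = x] b by simp
qed

text \<open>The parts of the forces beyond the linear ones. The primitives \<open>W1\<close> and
  \<open>W2\<close> provide the variational structure on which the two conservation laws
  rest.\<close>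

locale dimer_nl = dimer +
  fixes n1 n2 W1 W2 :: "real \<Rightarrow> real" and L :: real
  assumes L: "L \<ge> 0" and n1: "quad_lipschitz L n1" and n2: "quad_lipschitz L n2"
    and W1: "\<And>t. (W1 has_real_derivative n1 t) (at t)" and W2: "\<And>t. (W2 has_real_derivative n2 t) (at t)"
    and cont_n1: "continuous_on UNIV n1" and cont_n2: "continuous_on UNIV n2"
begin

section \<open>The leading-order profile in real components\<close>

definition muN :: real where "muN = sqrt ((norm Ec)\<^sup>2 + Ac\<^sup>2)"
text \<open>Equals 2 / (sqrt 2 |\<mu>|): the sum of the two conjugate exponentials in the profile is
  twice a real part.\<close>

definition Nn :: real where "Nn = sqrt 2 / muN"
definition nu1 :: "real \<Rightarrow> real" where "nu1 x = Nn * Re (Ec * cis x)"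
definition nu2 :: "real \<Rightarrow> real" where "nu2 x = Nn * Re (of_real Ac * cis x)"

lemma muN_pos: "muN > 0" using A0 by (simp add: muN_def add_nonneg_pos)
lemma Nn_pos: "Nn > 0" using muN_pos by (simp add: Nn_def)
lemma muN_sq: "complex_of_real (muN\<^sup>2) = Ec * cnj Ec + of_real (Ac\<^sup>2)"
  by (simp only: muN_def real_sqrt_pow2[OF add_nonneg_nonneg[OF zero_le_power2 zero_le_power2]]
      of_real_add complex_norm_square)

lemma nu_bound: "\<bar>nu1 x\<bar> \<le> 2" "\<bar>nu2 x\<bar> \<le> 2"
proof -
  have s: "sqrt 2 \<le> 2" using real_sqrt_le_iff[of 2 4] by (simp del: real_sqrt_le_iff)
  have b: "\<bar>Nn * Re (z * cis x)\<bar> \<le> 2" if "norm z \<le> muN" for z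
  proof -
    have "\<bar>Re (z * cis x)\<bar> \<le> muN" using abs_Re_le_cmod[of "z * cis x"] that by (simp only: norm_mult norm_cis)
    then have "Nn * \<bar>Re (z * cis x)\<bar> \<le> Nn * muN" using Nn_pos by (intro mult_left_mono) auto
    also have "\<dots> = sqrt 2" using muN_pos by (simp add: Nn_def)
    finally show ?thesis using s Nn_pos by (simp only: abs_mult abs_of_pos)
  qed
  have "norm Ec \<le> muN" unfolding muN_def by (rule real_le_rsqrt) simp
  then show "\<bar>nu1 x\<bar> \<le> 2" unfolding nu1_def by (rule b)
  have "norm (complex_of_real Ac) \<le> muN" unfolding muN_def norm_of_real by (rule real_le_rsqrt) simp
  then show "\<bar>nu2 x\<bar> \<le> 2" unfolding nu2_def by (rule b)
qed

lemma nu_periodic: "nu1 (x + 2 * pi) = nu1 x" "nu2 (x + 2 * pi) = nu2 x"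
  using cis_int_periodic[of 1 x] by (simp_all only: nu1_def nu2_def of_int_1 mult_1)

lemma nu_id1: "nu2 (x + w) + \<kappa> * nu2 (x - w) - (1 + \<kappa>) * nu1 x + c\<^sup>2 * w\<^sup>2 * nu1 x = - Nn * Re (k1 w * cis x)"
proof -
  have cs: "cis (x + w) = cis x * cis w" "cis (x - w) = cis x * cis (- w)" by (simp_all add: cis_mult)
  have "nu2 (x + w) + \<kappa> * nu2 (x - w) - (1 + \<kappa>) * nu1 x + c\<^sup>2 * w\<^sup>2 * nu1 x =
     Nn * Re (of_real Ac * cis (x + w) + of_real \<kappa> * (of_real Ac * cis (x - w)) - of_real (A w) * (Ec * cis x))"
    by (simp add: nu1_def nu2_def symA_def algebra_simps)
  also have "of_real Ac * cis (x + w) + of_real \<kappa> * (of_real Ac * cis (x - w)) - of_real (A w) * (Ec * cis x) = - (k1 w * cis x)"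
    unfolding cs k1_def symE_def by (simp add: algebra_simps)
  finally show ?thesis by (simp add: algebra_simps)
qed

lemma nu_id2: "\<kappa> * nu1 (x + w) + nu1 (x - w) - (1 + \<kappa>) * nu2 x + m * c\<^sup>2 * w\<^sup>2 * nu2 x = - Nn * Re (k2 w * cis x)"
proof -
  have cs: "cis (x + w) = cis x * cis w" "cis (x - w) = cis x * cis (- w)" by (simp_all add: cis_mult)
  have "\<kappa> * nu1 (x + w) + nu1 (x - w) - (1 + \<kappa>) * nu2 x + m * c\<^sup>2 * w\<^sup>2 * nu2 x =
     Nn * Re (of_real \<kappa> * (Ec * cis (x + w)) + Ec * cis (x - w) - of_real (B w) * (of_real Ac * cis x))"
    by (simp add: nu1_def nu2_def symB_def algebra_simps)
  also have "of_real \<kappa> * (Ec * cis (x + w)) + Ec * cis (x - w) - of_real (B w) * (of_real Ac * cis x) = - (k2 w * cis x)"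
    unfolding cs k2_def symE_def[of _ w] by (simp add: cis_cnj algebra_simps)
  finally show ?thesis by (simp add: algebra_simps)
qed

lemma nu_deriv:
  "(nu1 has_real_derivative Nn * Re (\<i> * Ec * cis x)) (at x)"
  "((\<lambda>x. Nn * Re (\<i> * Ec * cis x)) has_real_derivative - nu1 x) (at x)"
  "(nu2 has_real_derivative Nn * Re (\<i> * of_real Ac * cis x)) (at x)"
  "((\<lambda>x. Nn * Re (\<i> * of_real Ac * cis x)) has_real_derivative - nu2 x) (at x)"
proof -
  have "((\<lambda>x. Nn * Re (z * cis x)) has_real_derivative Nn * Re (\<i> * z * cis x)) (at x)" for z
    by (auto intro!: derivative_eq_intros simp: algebra_simps)
  note d = this
  show "(nu1 has_real_derivative Nn * Re (\<i> * Ec * cis x)) (at x)" unfolding nu1_def[abs_def] by (rule d)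
  show "(nu2 has_real_derivative Nn * Re (\<i> * of_real Ac * cis x)) (at x)" unfolding nu2_def[abs_def] by (rule d)
  show "((\<lambda>x. Nn * Re (\<i> * Ec * cis x)) has_real_derivative - nu1 x) (at x)"
    by (rule DERIV_cong[OF d]) (simp add: nu1_def algebra_simps)
  show "((\<lambda>x. Nn * Re (\<i> * of_real Ac * cis x)) has_real_derivative - nu2 x) (at x)"
    by (rule DERIV_cong[OF d]) (simp add: nu2_def algebra_simps)
qed

lemma fc_nu: "fc nu1 1 = Nn * Ec / 2" "fc nu2 1 = Nn * Ac / 2"
proof -
  have e: "fc (\<lambda>x. Nn * Re (z * cis x)) 1 = of_real Nn * z / 2" for z :: complex
    using fc_monomial[of z 1 1] by (simp only: fc_scale of_nat_1 mult_1) simp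
  show "fc nu1 1 = Nn * Ec / 2" unfolding nu1_def[abs_def] by (rule e)
  show "fc nu2 1 = Nn * Ac / 2"
    unfolding nu2_def[abs_def] of_real_divide of_real_mult of_real_numeral by (rule e)
qed

text \<open>The frequency is clamped so that the profile is a bounded continuous function of all \<open>(\<xi>, x)\<close>.\<close>

definition om :: "real \<Rightarrow> real \<Rightarrow> real \<Rightarrow> real" where
  "om a R \<xi> = \<omega>0 + a * max (- R) (min R \<xi>)"

definition P1 :: "real \<Rightarrow> real \<Rightarrow> (real \<times> real \<Rightarrow> real \<times> real) \<Rightarrow> real \<Rightarrow> real \<Rightarrow> real" where
  "P1 a R p \<xi> x = NL n1 n2 a (om a R \<xi>) (\<lambda>x. nu1 x + a * fst (p (\<xi>, x))) (\<lambda>x. nu2 x + a * snd (p (\<xi>, x))) x"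

definition P2 :: "real \<Rightarrow> real \<Rightarrow> (real \<times> real \<Rightarrow> real \<times> real) \<Rightarrow> real \<Rightarrow> real \<Rightarrow> real" where
  "P2 a R p \<xi> x = NL n2 n1 a (om a R \<xi>) (\<lambda>x. nu2 x + a * snd (p (\<xi>, x))) (\<lambda>x. nu1 x + a * fst (p (\<xi>, x))) x"

text \<open>The profile \<nu> enters the linear part at order \<open>a\<close>, so its residual
  keeps a factor 1 / a after the division by \<open>a\<^sup>2\<close>; \<open>k_lipschitz\<close>
  cancels it, and \<open>F_bound\<close> depends on R but not on \<open>a\<close>.\<close>

definition F1 :: "real \<Rightarrow> real \<Rightarrow> (real \<times> real \<Rightarrow> real \<times> real) \<Rightarrow> real \<Rightarrow> real \<Rightarrow> real" where
  "F1 a R p \<xi> x = P1 a R p \<xi> x - (Nn / a) * Re (k1 (om a R \<xi>) * cis x)"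

definition F2 :: "real \<Rightarrow> real \<Rightarrow> (real \<times> real \<Rightarrow> real \<times> real) \<Rightarrow> real \<Rightarrow> real \<Rightarrow> real" where
  "F2 a R p \<xi> x = P2 a R p \<xi> x - (Nn / a) * Re (k2 (om a R \<xi>) * cis x)"

definition TT :: "real \<Rightarrow> real \<Rightarrow> (real \<times> real \<Rightarrow> real \<times> real) \<Rightarrow> real \<times> real \<Rightarrow> real \<times> real" where
  "TT a R p = (\<lambda>(\<xi>, x).
     (multop (g11 (om a R \<xi>)) (F1 a R p \<xi>) x + multop (g12 (om a R \<xi>)) (F2 a R p \<xi>) x,
      multop (g21 (om a R \<xi>)) (F1 a R p \<xi>) x + multop (g22 (om a R \<xi>)) (F2 a R p \<xi>) x))"

lemma continuous_on_om: "continuous_on S f \<Longrightarrow> continuous_on S (\<lambda>q. om a R (f q))"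
  unfolding om_def by (intro continuous_intros)

lemma om_near:
  assumes "R > 0" "\<bar>a\<bar> * R \<le> \<delta>0"
  shows "\<bar>om a R \<xi> - \<omega>0\<bar> \<le> \<bar>a\<bar> * R" "\<bar>om a R \<xi> - \<omega>0\<bar> \<le> \<delta>0"
proof -
  have "\<bar>max (- R) (min R \<xi>)\<bar> \<le> R" using assms by auto
  then have "\<bar>a\<bar> * \<bar>max (- R) (min R \<xi>)\<bar> \<le> \<bar>a\<bar> * R" by (intro mult_left_mono) auto
  then show "\<bar>om a R \<xi> - \<omega>0\<bar> \<le> \<bar>a\<bar> * R" by (simp add: om_def abs_mult)
  then show "\<bar>om a R \<xi> - \<omega>0\<bar> \<le> \<delta>0" using assms by linarith
qed

lemma P_continuous:
  assumes p: "continuous_on UNIV p"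
  shows "continuous_on UNIV (\<lambda>(\<xi>, x). P1 a R p \<xi> x)" "continuous_on UNIV (\<lambda>(\<xi>, x). P2 a R p \<xi> x)"
proof -
  have cp: "continuous_on UNIV (\<lambda>q. fst (p (f q, g q)))" "continuous_on UNIV (\<lambda>q. snd (p (f q, g q)))"
    if "continuous_on UNIV f" "continuous_on UNIV g" for f g :: "real \<times> real \<Rightarrow> real"
    by (intro continuous_on_fst continuous_on_snd continuous_on_compose2[OF p] continuous_on_Pair that; simp)+
  have cn: "continuous_on UNIV (\<lambda>q. n1 (f q))" "continuous_on UNIV (\<lambda>q. n2 (f q))"
    if "continuous_on UNIV f" for f :: "real \<times> real \<Rightarrow> real"
    by (rule continuous_on_compose2[OF cont_n1 that], simp, rule continuous_on_compose2[OF cont_n2 that], simp)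
  have cnu: "continuous_on UNIV (\<lambda>q. nu1 (f q))" "continuous_on UNIV (\<lambda>q. nu2 (f q))"
    if "continuous_on UNIV f" for f :: "real \<times> real \<Rightarrow> real"
    unfolding nu1_def nu2_def by (intro continuous_intros that)+
  show "continuous_on UNIV (\<lambda>(\<xi>, x). P1 a R p \<xi> x)" "continuous_on UNIV (\<lambda>(\<xi>, x). P2 a R p \<xi> x)"
    unfolding case_prod_beta P1_def P2_def NL_def divide_inverse
    by (intro continuous_on_mult continuous_on_diff continuous_on_add continuous_on_const cn cnu cp
        continuous_on_om continuous_on_fst continuous_on_snd continuous_on_id)+
qed

lemma F_continuous:
  assumes p: "continuous_on UNIV p"
  shows "continuous_on UNIV (\<lambda>(\<xi>, x). F1 a R p \<xi> x)" "continuous_on UNIV (\<lambda>(\<xi>, x). F2 a R p \<xi> x)"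
  unfolding case_prod_beta F1_def F2_def k1_def k2_def
  by (intro P_continuous[OF p, unfolded case_prod_beta] continuous_on_diff continuous_on_mult continuous_on_const
      continuous_on_Re continuous_on_of_real continuous_on_cis_compose continuous_on_ABQ continuous_on_E
      continuous_on_cnj continuous_on_om continuous_on_fst continuous_on_snd continuous_on_id)+

lemma continuous_on_slice:
  fixes f :: "real \<Rightarrow> real \<Rightarrow> 'b::topological_space"
  assumes "continuous_on UNIV (\<lambda>(p, x). f p x)"
  shows "continuous_on UNIV (f p)"
  using continuous_on_compose2[OF assms, of UNIV "\<lambda>x. (p, x)"] by (simp add: continuous_on_Pair)

lemma profile_bound:
  assumes "\<bar>a\<bar> * \<rho> \<le> 1" "norm q \<le> \<rho>"
  shows "\<bar>nu1 x + a * fst q\<bar> \<le> 3" "\<bar>nu2 x + a * snd q\<bar> \<le> 3"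
proof -
  have "\<bar>fst q\<bar> \<le> \<rho>" "\<bar>snd q\<bar> \<le> \<rho>"
    using assms(2) norm_fst_le[of "fst q" "snd q"] norm_snd_le[of "snd q" "fst q"] by simp_all
  then have "\<bar>a * fst q\<bar> \<le> 1" "\<bar>a * snd q\<bar> \<le> 1"
    unfolding abs_mult using assms(1) by (meson abs_ge_zero mult_left_mono order_trans)+
  then show "\<bar>nu1 x + a * fst q\<bar> \<le> 3" "\<bar>nu2 x + a * snd q\<bar> \<le> 3"
    using nu_bound[of x] by linarith+
qed

lemma P_bound:
  assumes a: "6 * \<bar>a\<bar> \<le> 1" "a \<noteq> 0" and \<rho>: "\<bar>a\<bar> * \<rho> \<le> 1" and p: "\<And>q. norm (p q) \<le> \<rho>"
  shows "\<bar>P1 a R p \<xi> x\<bar> \<le> 72 * L" "\<bar>P2 a R p \<xi> x\<bar> \<le> 72 * L"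
  unfolding P1_def P2_def
  by (rule NL_bound[OF n1 n2 L a profile_bound[OF \<rho> p]], rule NL_bound[OF n2 n1 L a profile_bound(2,1)[OF \<rho> p]])

lemma F_bound:
  assumes a: "6 * \<bar>a\<bar> \<le> 1" "a \<noteq> 0" and \<rho>: "\<bar>a\<bar> * \<rho> \<le> 1" and p: "\<And>q. norm (p q) \<le> \<rho>"
    and R: "R > 0" "\<bar>a\<bar> * R \<le> \<delta>0"
    and k: "\<And>\<omega>. \<bar>\<omega> - \<omega>0\<bar> \<le> \<delta>0 \<Longrightarrow> norm (k1 \<omega>) \<le> Ck * \<bar>\<omega> - \<omega>0\<bar>"
      "\<And>\<omega>. \<bar>\<omega> - \<omega>0\<bar> \<le> \<delta>0 \<Longrightarrow> norm (k2 \<omega>) \<le> Ck * \<bar>\<omega> - \<omega>0\<bar>" and Ck: "Ck > 0"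
  shows "\<bar>F1 a R p \<xi> x\<bar> \<le> 72 * L + Nn * Ck * R" "\<bar>F2 a R p \<xi> x\<bar> \<le> 72 * L + Nn * Ck * R"
proof -
  have e: "\<bar>(Nn / a) * Re (z * cis x)\<bar> \<le> Nn * Ck * R" if "norm z \<le> Ck * \<bar>om a R \<xi> - \<omega>0\<bar>" for z
  proof -
    have "\<bar>Re (z * cis x)\<bar> \<le> norm z" using abs_Re_le_cmod[of "z * cis x"] by (simp only: norm_mult norm_cis mult_1_right)
    also have "\<dots> \<le> Ck * (\<bar>a\<bar> * R)"
      using that mult_left_mono[OF om_near(1)[OF R, of \<xi>], of Ck] Ck by linarith
    finally have "(Nn / \<bar>a\<bar>) * \<bar>Re (z * cis x)\<bar> \<le> (Nn / \<bar>a\<bar>) * (Ck * (\<bar>a\<bar> * R))"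
      using Nn_pos by (intro mult_left_mono) auto
    also have "\<dots> = Nn * Ck * R" using a(2) by simp
    finally show ?thesis using Nn_pos by (simp only: abs_mult abs_divide abs_of_pos)
  qed
  show "\<bar>F1 a R p \<xi> x\<bar> \<le> 72 * L + Nn * Ck * R"
    unfolding F1_def using P_bound(1)[where p = p and R = R and \<xi> = \<xi> and x = x, OF a \<rho> p] e[OF k(1)[OF om_near(2)[OF R]]] by linarith
  show "\<bar>F2 a R p \<xi> x\<bar> \<le> 72 * L + Nn * Ck * R"
    unfolding F2_def using P_bound(2)[where p = p and R = R and \<xi> = \<xi> and x = x, OF a \<rho> p] e[OF k(2)[OF om_near(2)[OF R]]] by linarith
qed

lemma F_diff:
  assumes a: "6 * \<bar>a\<bar> \<le> 1" "a \<noteq> 0" and \<rho>: "\<bar>a\<bar> * \<rho> \<le> 1"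
    and p: "\<And>q. norm (p q) \<le> \<rho>" and p': "\<And>q. norm (p' q) \<le> \<rho>" and d: "\<And>q. norm (p q - p' q) \<le> d"
  shows "\<bar>F1 a R p \<xi> x - F1 a R p' \<xi> x\<bar> \<le> 24 * L * (\<bar>a\<bar> * d)" "\<bar>F2 a R p \<xi> x - F2 a R p' \<xi> x\<bar> \<le> 24 * L * (\<bar>a\<bar> * d)"
proof -
  have e: "\<bar>(nu1 x + a * fst (p (\<xi>, x))) - (nu1 x + a * fst (p' (\<xi>, x)))\<bar> \<le> \<bar>a\<bar> * d"
    "\<bar>(nu2 x + a * snd (p (\<xi>, x))) - (nu2 x + a * snd (p' (\<xi>, x)))\<bar> \<le> \<bar>a\<bar> * d" for x
  proof -
    let ?q = "p (\<xi>, x) - p' (\<xi>, x)"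
    have "\<bar>fst ?q\<bar> \<le> norm ?q" "\<bar>snd ?q\<bar> \<le> norm ?q"
      using norm_fst_le[of "fst ?q" "snd ?q"] norm_snd_le[of "snd ?q" "fst ?q"]
      unfolding prod.collapse real_norm_def .
    then have "\<bar>fst ?q\<bar> \<le> d" "\<bar>snd ?q\<bar> \<le> d" using d[of "(\<xi>, x)"] by linarith+
    then have "\<bar>a\<bar> * \<bar>fst ?q\<bar> \<le> \<bar>a\<bar> * d" "\<bar>a\<bar> * \<bar>snd ?q\<bar> \<le> \<bar>a\<bar> * d" by (simp_all add: mult_left_mono)
    then show "\<bar>(nu1 x + a * fst (p (\<xi>, x))) - (nu1 x + a * fst (p' (\<xi>, x)))\<bar> \<le> \<bar>a\<bar> * d"
      "\<bar>(nu2 x + a * snd (p (\<xi>, x))) - (nu2 x + a * snd (p' (\<xi>, x)))\<bar> \<le> \<bar>a\<bar> * d"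
      by (simp_all flip: abs_mult right_diff_distrib)
  qed
  show "\<bar>F1 a R p \<xi> x - F1 a R p' \<xi> x\<bar> \<le> 24 * L * (\<bar>a\<bar> * d)"
    using NL_diff[OF n1 n2 L a profile_bound[OF \<rho> p] profile_bound[OF \<rho> p'] e]
    by (simp add: F1_def P1_def)
  show "\<bar>F2 a R p \<xi> x - F2 a R p' \<xi> x\<bar> \<le> 24 * L * (\<bar>a\<bar> * d)"
    using NL_diff[OF n2 n1 L a profile_bound(2,1)[OF \<rho> p] profile_bound(2,1)[OF \<rho> p'] e(2,1)]
    by (simp add: F2_def P2_def)
qed

text \<open>The 8 is a product of three factors 2: conjugate modes, two entries in each row of the
  inverse, and the norm of a pair. The 48 is twice the constant of \<open>F_diff\<close>, so that
  the map contracts by 1/2.\<close>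

lemma ex_profile:
  assumes a: "6 * \<bar>a\<bar> \<le> 1" "a \<noteq> 0" and R: "R > 0" "\<bar>a\<bar> * R \<le> \<delta>0"
    and k: "\<And>\<omega>. \<bar>\<omega> - \<omega>0\<bar> \<le> \<delta>0 \<Longrightarrow> norm (k1 \<omega>) \<le> Ck * \<bar>\<omega> - \<omega>0\<bar>"
      "\<And>\<omega>. \<bar>\<omega> - \<omega>0\<bar> \<le> \<delta>0 \<Longrightarrow> norm (k2 \<omega>) \<le> Ck * \<bar>\<omega> - \<omega>0\<bar>" and Ck: "Ck > 0"
    and C: "C > 0"
    and g: "\<And>\<omega> n. \<bar>\<omega> - \<omega>0\<bar> \<le> \<delta>0 \<Longrightarrow> norm (g11 \<omega> n) \<le> C / (real n + 1)\<^sup>2"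
      "\<And>\<omega> n. \<bar>\<omega> - \<omega>0\<bar> \<le> \<delta>0 \<Longrightarrow> norm (g12 \<omega> n) \<le> C / (real n + 1)\<^sup>2"
      "\<And>\<omega> n. \<bar>\<omega> - \<omega>0\<bar> \<le> \<delta>0 \<Longrightarrow> norm (g21 \<omega> n) \<le> C / (real n + 1)\<^sup>2"
      "\<And>\<omega> n. \<bar>\<omega> - \<omega>0\<bar> \<le> \<delta>0 \<Longrightarrow> norm (g22 \<omega> n) \<le> C / (real n + 1)\<^sup>2"
    and \<rho>: "\<rho> = 8 * C * inv_sq_sum * (72 * L + Nn * Ck * R)" and a\<rho>: "\<bar>a\<bar> * \<rho> \<le> 1"
    and contr: "8 * C * inv_sq_sum * (48 * L) * \<bar>a\<bar> \<le> 1"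
  obtains p where "continuous_on UNIV p" "\<And>q. norm (p q) \<le> \<rho>" "TT a R p = p"
proof -
  let ?M = "72 * L + Nn * Ck * R"
  have M: "?M \<ge> 0" using L Nn_pos Ck R(1) by simp
  have \<rho>0: "\<rho> \<ge> 0" unfolding \<rho> using M C inv_sq_sum_pos by simp
  note gb = g(1)[OF om_near(2)[OF R]] g(2)[OF om_near(2)[OF R]] g(3)[OF om_near(2)[OF R]] g(4)[OF om_near(2)[OF R]]
  have comp: "norm (x :: real, y :: real) \<le> 2 * b" if "\<bar>x\<bar> \<le> b" "\<bar>y\<bar> \<le> b" for x y b
    using norm_Pair_le[of x y] that by simp
  have sum2: "\<bar>multop g f x + multop g' f' x\<bar> \<le> 4 * C * inv_sq_sum * M'"
    if "\<And>n. norm (g n) \<le> C / (real n + 1)\<^sup>2" "\<And>n. norm (g' n) \<le> C / (real n + 1)\<^sup>2"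
      "continuous_on UNIV f" "\<And>x. \<bar>f x\<bar> \<le> M'" "continuous_on UNIV f'" "\<And>x. \<bar>f' x\<bar> \<le> M'" for g g' f f' x M'
    using multop_bound[OF that(1,3,4), of x] multop_bound[OF that(2,5,6), of x] by (simp add: mult_ac)
  show ?thesis
  proof (rule ex_bounded_fixed_point[OF \<rho>0, of "TT a R"])
    fix p :: "real \<times> real \<Rightarrow> real \<times> real" and q
    assume p: "continuous_on UNIV p" "\<And>q. norm (p q) \<le> \<rho>"
    note Fc = F_continuous[OF p(1), of a R] and Fb = F_bound[where p = p, OF a a\<rho> p(2) R k Ck]
    have om: "continuous_on UNIV (om a R)" using continuous_on_om[OF continuous_on_id] .
    note gc = g_continuous[OF om om_near(2)[OF R]]
    have "continuous_on UNIV (TT a R p)"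
      unfolding TT_def case_prod_beta
      using multop_continuous[OF gb(1) gc(1) Fc(1) Fb(1)] multop_continuous[OF gb(2) gc(2) Fc(2) Fb(2)]
        multop_continuous[OF gb(3) gc(3) Fc(1) Fb(1)] multop_continuous[OF gb(4) gc(4) Fc(2) Fb(2)]
      unfolding case_prod_beta by (intro continuous_on_Pair continuous_on_add)
    moreover have "norm (TT a R p q) \<le> 2 * (4 * C * inv_sq_sum * ?M)"
      unfolding TT_def case_prod_beta
      by (intro comp sum2 gb continuous_on_slice[OF Fc(1)] continuous_on_slice[OF Fc(2)] Fb)
    ultimately show "continuous_on UNIV (TT a R p) \<and> norm (TT a R p q) \<le> \<rho>" unfolding \<rho> by simp
  next
    fix p p' :: "real \<times> real \<Rightarrow> real \<times> real" and d q
    assume p: "continuous_on UNIV p" "\<And>q. norm (p q) \<le> \<rho>" and p': "continuous_on UNIV p'" "\<And>q. norm (p' q) \<le> \<rho>"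
      and d: "\<And>q. norm (p q - p' q) \<le> d"
    have d0: "d \<ge> 0" using d[of undefined] norm_ge_zero order_trans by blast
    note Fc = continuous_on_slice[OF F_continuous(1)[OF p(1), of a R]] continuous_on_slice[OF F_continuous(2)[OF p(1), of a R]]
    note Fc' = continuous_on_slice[OF F_continuous(1)[OF p'(1), of a R]] continuous_on_slice[OF F_continuous(2)[OF p'(1), of a R]]
    note Fb = F_bound[where p = p, OF a a\<rho> p(2) R k Ck] and Fb' = F_bound[where p = p', OF a a\<rho> p'(2) R k Ck]
    note Fd = F_diff[where p = p and p' = p' and R = R, OF a a\<rho> p(2) p'(2) d]
    have md: "multop (g (om a R \<xi>)) (F p \<xi>) x - multop (g (om a R \<xi>)) (F p' \<xi>) x =
        multop (g (om a R \<xi>)) (\<lambda>x. F p \<xi> x - F p' \<xi> x) x"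
      if "\<And>n. norm (g (om a R \<xi>) n) \<le> C / (real n + 1)\<^sup>2" "F = F1 a R \<or> F = F2 a R"
      for g :: "real \<Rightarrow> nat \<Rightarrow> complex" and F \<xi> x
      using that(2) multop_diff[OF that(1) Fc(1) Fb(1) Fc'(1) Fb'(1)] multop_diff[OF that(1) Fc(2) Fb(2) Fc'(2) Fb'(2)]
      by auto
    have "norm (TT a R p (\<xi>, x) - TT a R p' (\<xi>, x)) \<le> 2 * (4 * C * inv_sq_sum * (24 * L * (\<bar>a\<bar> * d)))" for \<xi> x
      unfolding TT_def prod.case diff_Pair add_diff_add
        md[of g11, OF gb(1) disjI1[OF refl]] md[of g12, OF gb(2) disjI2[OF refl]]
        md[of g21, OF gb(3) disjI1[OF refl]] md[of g22, OF gb(4) disjI2[OF refl]]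
      by (intro comp sum2 gb continuous_on_diff Fc Fc' Fd)
    then have "norm (TT a R p q - TT a R p' q) \<le> 2 * (4 * C * inv_sq_sum * (24 * L * (\<bar>a\<bar> * d)))"
      by (metis surj_pair)
    also have "\<dots> = (8 * C * inv_sq_sum * (48 * L) * \<bar>a\<bar>) * (d / 2)" by simp
    also have "\<dots> \<le> 1 * (d / 2)" using contr d0 by (intro mult_right_mono) auto
    finally show "norm (TT a R p q - TT a R p' q) \<le> d / 2" by simp
  qed (rule that)
qed

end

section \<open>The bifurcation equation\<close>

lemma NL_periodic:
  assumes "\<And>x. u (x + 2 * pi) = u x" "\<And>x. v (x + 2 * pi) = v x"
  shows "NL f g a w u v (x + 2 * pi) = NL f g a w u v x"
proof -
  have "v (x + 2 * pi + w) = v (x + w)" "v (x + 2 * pi - w) = v (x - w)"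
    using assms(2)[of "x + w"] assms(2)[of "x - w"] by (simp_all add: algebra_simps)
  then show ?thesis by (simp add: NL_def assms)
qed

context dimer_nl
begin

text \<open>The projected equation leaves a residual \<open>\<gamma> (1, 1) + 2 Re (s \<mu> cis x)\<close>. Invariance forces
  \<open>\<gamma> = 0\<close> and \<open>Im s = 0\<close>, and \<open>Sf\<close> is the remaining component \<open>Re s\<close> up to a positive factor.\<close>

definition Sf :: "real \<Rightarrow> real \<Rightarrow> (real \<times> real \<Rightarrow> real \<times> real) \<Rightarrow> real \<Rightarrow> real" where
  "Sf a R p \<xi> =
     Re (cnj (k1 (om a R \<xi>)) * fc (\<lambda>x. fst (p (\<xi>, x))) 1 + cnj (k2 (om a R \<xi>)) * fc (\<lambda>x. snd (p (\<xi>, x))) 1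
       - cnj Ec * fc (P1 a R p \<xi>) 1 - of_real Ac * fc (P2 a R p \<xi>) 1)
     + Nn / (2 * a) * h (om a R \<xi>)"

text \<open>The function \<nu> + a \<psi> satisfies the full equation with rescaled forces up to a
  residual spanned by the kernel, and \<open>tw_residual_orthogonal\<close> gives two real relations
  for its three real coefficients.\<close>

lemma profile_solves:
  fixes \<xi> :: real
  assumes a: "6 * \<bar>a\<bar> \<le> 1" "a \<noteq> 0" and R: "R > 0" "\<bar>a\<bar> * R \<le> \<delta>0"
    and k: "\<And>\<omega>. \<bar>\<omega> - \<omega>0\<bar> \<le> \<delta>0 \<Longrightarrow> norm (k1 \<omega>) \<le> Ck * \<bar>\<omega> - \<omega>0\<bar>"
      "\<And>\<omega>. \<bar>\<omega> - \<omega>0\<bar> \<le> \<delta>0 \<Longrightarrow> norm (k2 \<omega>) \<le> Ck * \<bar>\<omega> - \<omega>0\<bar>" and Ck: "Ck > 0"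
    and a\<rho>: "\<bar>a\<bar> * \<rho> \<le> 1"
    and p: "continuous_on UNIV p" "\<And>q. norm (p q) \<le> \<rho>" "TT a R p = p"
  defines "w \<equiv> om a R \<xi>" and "p1 \<equiv> \<lambda>x. fst (p (\<xi>, x))" and "p2 \<equiv> \<lambda>x. snd (p (\<xi>, x))"
  shows "(\<forall>x. p1 (x + 2 * pi) = p1 x \<and> p2 (x + 2 * pi) = p2 x) \<and>
    cnj Ec * fc p1 1 + Ac * fc p2 1 = 0 \<and>
    (\<exists>q1 q2 (s :: complex). Im s = 0 \<and> Re s * muN\<^sup>2 = Sf a R p \<xi> \<and>
     (\<forall>x. (p1 has_real_derivative q1 x) (at x) \<and> (p2 has_real_derivative q2 x) (at x) \<and>
      (q1 has_real_derivative (p2 (x + w) + \<kappa> * p2 (x - w) - (1 + \<kappa>) * p1 x + F1 a R p \<xi> x +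
         Re (2 * s * Ec * cis x)) / (c\<^sup>2 * w\<^sup>2)) (at x) \<and>
      (q2 has_real_derivative (\<kappa> * p1 (x + w) + p1 (x - w) - (1 + \<kappa>) * p2 x + F2 a R p \<xi> x +
         Re (2 * s * Ac * cis x)) / (m * c\<^sup>2 * w\<^sup>2)) (at x)))"
proof -
  note wn = om_near(2)[OF R, of \<xi>, folded w_def]
  have w0: "w \<noteq> 0" using wn \<delta>0(2) \<omega>0 by auto
  have P1: "p1 = (\<lambda>x. multop (g11 w) (F1 a R p \<xi>) x + multop (g12 w) (F2 a R p \<xi>) x)"
    and P2: "p2 = (\<lambda>x. multop (g21 w) (F1 a R p \<xi>) x + multop (g22 w) (F2 a R p \<xi>) x)"
  proof -
    have "p (\<xi>, x) = TT a R p (\<xi>, x)" for x by (simp only: p(3))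
    then show "p1 = (\<lambda>x. multop (g11 w) (F1 a R p \<xi>) x + multop (g12 w) (F2 a R p \<xi>) x)"
      "p2 = (\<lambda>x. multop (g21 w) (F1 a R p \<xi>) x + multop (g22 w) (F2 a R p \<xi>) x)"
      unfolding p1_def p2_def w_def TT_def by simp_all
  qed
  have pp: "p1 (x + 2 * pi) = p1 x" "p2 (x + 2 * pi) = p2 x" for x
    unfolding P1 P2 by (simp_all add: multop_periodic)
  have cisp: "cis (x + 2 * pi) = cis x" for x using cis_int_periodic[of 1 x] by simp
  let ?u1 = "\<lambda>x. nu1 x + a * p1 x" and ?u2 = "\<lambda>x. nu2 x + a * p2 x"
  have up: "?u1 (x + 2 * pi) = ?u1 x" "?u2 (x + 2 * pi) = ?u2 x" for x
    by (simp_all add: nu_periodic pp)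
  have F1eq: "F1 a R p \<xi> x = NL n1 n2 a w ?u1 ?u2 x - (Nn / a) * Re (k1 w * cis x)"
    and F2eq: "F2 a R p \<xi> x = NL n2 n1 a w ?u2 ?u1 x - (Nn / a) * Re (k2 w * cis x)" for x
    by (simp_all only: F1_def F2_def P1_def P2_def w_def p1_def p2_def)
  have Fp: "F1 a R p \<xi> (x + 2 * pi) = F1 a R p \<xi> x" "F2 a R p \<xi> (x + 2 * pi) = F2 a R p \<xi> x" for x
    unfolding F1eq F2eq NL_periodic[of ?u1 ?u2, OF up] NL_periodic[of ?u2 ?u1, OF up(2,1)] cisp by simp_all
  have Fc: "continuous_on UNIV (F1 a R p \<xi>)" "continuous_on UNIV (F2 a R p \<xi>)"
    by (rule continuous_on_slice[OF F_continuous(1)[OF p(1)]], rule continuous_on_slice[OF F_continuous(2)[OF p(1)]])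
  note Fb = F_bound[where p = p and \<xi> = \<xi>, OF a a\<rho> p(2) R k Ck]
  define s where "s = (B w * fc p2 1 - cnj (E w) * fc p1 1 - fc (F2 a R p \<xi>) 1) / of_real Ac"
  note sol = multop_solves[OF wn Fc Fp Fb P1 P2 s_def]
  from sol(1) obtain q1 q2 \<gamma> where ode: "\<And>x. (p1 has_real_derivative q1 x) (at x)"
    "\<And>x. (p2 has_real_derivative q2 x) (at x)"
    "\<And>x. (q1 has_real_derivative (p2 (x + w) + \<kappa> * p2 (x - w) - (1 + \<kappa>) * p1 x + F1 a R p \<xi> x + \<gamma> +
         Re (2 * s * Ec * cis x)) / (c\<^sup>2 * w\<^sup>2)) (at x)"
    "\<And>x. (q2 has_real_derivative (\<kappa> * p1 (x + w) + p1 (x - w) - (1 + \<kappa>) * p2 x + F2 a R p \<xi> x + \<gamma> +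
         Re (2 * s * Ac * cis x)) / (m * c\<^sup>2 * w\<^sup>2)) (at x)" by blast
  let ?R1 = "\<lambda>x. (p2 (x + w) + \<kappa> * p2 (x - w) - (1 + \<kappa>) * p1 x + F1 a R p \<xi> x + \<gamma> +
         Re (2 * s * Ec * cis x)) / (c\<^sup>2 * w\<^sup>2)"
  let ?R2 = "\<lambda>x. (\<kappa> * p1 (x + w) + p1 (x - w) - (1 + \<kappa>) * p2 x + F2 a R p \<xi> x + \<gamma> +
         Re (2 * s * Ac * cis x)) / (m * c\<^sup>2 * w\<^sup>2)"
  have dcont: "continuous_on UNIV u" if "\<And>x. (u has_real_derivative v x) (at x)" for u v :: "real \<Rightarrow> real"
    using that by (meson DERIV_continuous_on has_field_derivative_at_within)
  note pc = dcont[OF ode(1)] dcont[OF ode(2)]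
  let ?v1 = "\<lambda>x. Nn * Re (\<i> * Ec * cis x) + a * q1 x" and ?v2 = "\<lambda>x. Nn * Re (\<i> * of_real Ac * cis x) + a * q2 x"
  let ?w1 = "\<lambda>x. - nu1 x + a * ?R1 x" and ?w2 = "\<lambda>x. - nu2 x + a * ?R2 x"
  have du: "(?u1 has_real_derivative ?v1 x) (at x)" "(?v1 has_real_derivative ?w1 x) (at x)"
    "(?u2 has_real_derivative ?v2 x) (at x)" "(?v2 has_real_derivative ?w2 x) (at x)" for x
    by (intro DERIV_add DERIV_cmult nu_deriv ode)+
  define r where "r z x = a * (\<gamma> + Re (2 * s * z * cis x))" for z x
  have cr: "continuous_on UNIV (r z)" for z unfolding r_def by (intro continuous_intros)
  \<comment> \<open>The forces seen by the profile divided by \<open>a\<close>: t goes to V'(a t) /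
    a, with the matching potentials below.\<close>
  let ?f = "\<lambda>t. t + n1 (a * t) / a" and ?g = "\<lambda>t. \<kappa> * t + n2 (a * t) / a"
  let ?F = "\<lambda>t. t\<^sup>2 / 2 + W1 (a * t) / a\<^sup>2" and ?G = "\<lambda>t. \<kappa> * t\<^sup>2 / 2 + W2 (a * t) / a\<^sup>2"
  have dW: "((\<lambda>t. W (a * t) / a\<^sup>2) has_real_derivative n (a * t) / a) (at t)"
    if "\<And>t. (W has_real_derivative n t) (at t)" for W n t
  proof -
    have "((\<lambda>t. W (a * t)) has_real_derivative n (a * t) * a) (at t)"
      by (rule DERIV_chain2[OF that]) (auto intro!: derivative_eq_intros)
    from DERIV_cdivide[OF this, of "a\<^sup>2"] show ?thesis using a(2) by (simp add: power2_eq_square)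
  qed
  have dF: "(?F has_real_derivative ?f t) (at t)" for t
    by (rule DERIV_add[OF _ dW[OF W1]]) (auto intro!: derivative_eq_intros)
  have dG: "(?G has_real_derivative ?g t) (at t)" for t
    by (rule DERIV_add[OF _ dW[OF W2]]) (auto intro!: derivative_eq_intros)
  have cf: "continuous_on UNIV ?f" "continuous_on UNIV ?g"
    using a(2) by (auto intro!: continuous_intros continuous_on_compose2[OF cont_n1] continuous_on_compose2[OF cont_n2])
  have ar: "d * (- y + a * (X / d)) = - (d * y) + a * X" if "d \<noteq> 0" for d y X
    using that by (simp add: field_simps)
  have ar2: "a * ((y - X) / a\<^sup>2) = y / a - X / a" for y X
    using a(2) by (simp add: power2_eq_square field_simps)
  have eq1: "(c\<^sup>2 * w\<^sup>2) * ?w1 x = ?f (?u2 (x + w) - ?u1 x) - ?g (?u1 x - ?u2 (x - w)) + r Ec x" for x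
  proof -
    have "(c\<^sup>2 * w\<^sup>2) * ?w1 x = - (c\<^sup>2 * w\<^sup>2 * nu1 x) + a * (p2 (x + w) + \<kappa> * p2 (x - w) - (1 + \<kappa>) * p1 x + F1 a R p \<xi> x + \<gamma> +
         Re (2 * s * Ec * cis x))"
      by (rule ar) (use c w0 in simp)
    also have "\<dots> = (- (c\<^sup>2 * w\<^sup>2 * nu1 x) - Nn * Re (k1 w * cis x)) + a * (p2 (x + w) + \<kappa> * p2 (x - w) - (1 + \<kappa>) * p1 x)
        + a * NL n1 n2 a w ?u1 ?u2 x + r Ec x"
      unfolding F1eq r_def using a(2) by (simp add: distrib_left right_diff_distrib)
    also have "- (c\<^sup>2 * w\<^sup>2 * nu1 x) - Nn * Re (k1 w * cis x) = nu2 (x + w) + \<kappa> * nu2 (x - w) - (1 + \<kappa>) * nu1 x"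
      using nu_id1[of x w] by simp
    also have "a * NL n1 n2 a w ?u1 ?u2 x = n1 (a * (?u2 (x + w) - ?u1 x)) / a - n2 (a * (?u1 x - ?u2 (x - w))) / a"
      unfolding NL_def by (rule ar2)
    finally show ?thesis by (simp add: algebra_simps)
  qed
  have eq2: "(m * c\<^sup>2 * w\<^sup>2) * ?w2 x = ?g (?u1 (x + w) - ?u2 x) - ?f (?u2 x - ?u1 (x - w)) + r (of_real Ac) x" for x
  proof -
    have "(m * c\<^sup>2 * w\<^sup>2) * ?w2 x = - (m * c\<^sup>2 * w\<^sup>2 * nu2 x) + a * (\<kappa> * p1 (x + w) + p1 (x - w) - (1 + \<kappa>) * p2 x + F2 a R p \<xi> x + \<gamma> +
         Re (2 * s * of_real Ac * cis x))"
      by (rule ar) (use c w0 m in simp)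
    also have "\<dots> = (- (m * c\<^sup>2 * w\<^sup>2 * nu2 x) - Nn * Re (k2 w * cis x)) + a * (\<kappa> * p1 (x + w) + p1 (x - w) - (1 + \<kappa>) * p2 x)
        + a * NL n2 n1 a w ?u2 ?u1 x + r (of_real Ac) x"
      unfolding F2eq r_def using a(2) by (simp add: distrib_left right_diff_distrib)
    also have "- (m * c\<^sup>2 * w\<^sup>2 * nu2 x) - Nn * Re (k2 w * cis x) = \<kappa> * nu1 (x + w) + nu1 (x - w) - (1 + \<kappa>) * nu2 x"
      using nu_id2[of x w] by simp
    also have "a * NL n2 n1 a w ?u2 ?u1 x = n2 (a * (?u1 (x + w) - ?u2 x)) / a - n1 (a * (?u2 x - ?u1 (x - w))) / a"
      unfolding NL_def by (rule ar2)
    finally show ?thesis by (simp add: algebra_simps)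
  qed
  note orth = tw_residual_orthogonal[OF dF dG cf du up cr cr eq1 eq2]
  have int0: "integral {- pi..pi} (\<lambda>x. Re (z * cis x)) = 0" for z
    using integral_Re_cis[of "\<lambda>_. 1" z] fc_const[of 1 1] by simp
  have intb: "(\<lambda>x. Re (z * cis x)) integrable_on {- pi..pi}" for z
    by (intro integrable_continuous_real continuous_intros)
  \<comment> \<open>Translation invariance: the oscillating part of the residual has mean zero, so
    only 2 a \<gamma> contributes.\<close>
  have \<gamma>0: "\<gamma> = 0"
  proof -
    have "integral {- pi..pi} (\<lambda>x. r Ec x + r (of_real Ac) x) = integral {- pi..pi} (\<lambda>x. 2 * a * \<gamma> + Re ((2 * a * s * (Ec + Ac)) * cis x))"
      by (intro integral_cong) (simp add: r_def algebra_simps)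
    also have "\<dots> = integral {- pi..pi} (\<lambda>x::real. 2 * a * \<gamma>) + 0"
      by (subst integral_add[OF integrable_const_ivl intb]) (simp only: int0)
    finally show ?thesis using orth(1) a(2) by simp
  qed
  note cv = dcont[OF du(2)] dcont[OF du(4)] and cn = dcont[OF nu_deriv(1)] dcont[OF nu_deriv(3)]
  have fu: "fc ?u1 1 = Nn * Ec / 2 + a * fc p1 1" "fc ?u2 1 = Nn * Ac / 2 + a * fc p2 1"
    using fc_add[OF cn(1) continuous_on_mult[OF continuous_on_const pc(1)], where k = 1]
      fc_add[OF cn(2) continuous_on_mult[OF continuous_on_const pc(2)], where k = 1]
    by (simp_all add: fc_nu fc_scale)
  have fv: "fc ?v1 1 = \<i> * (Nn * Ec / 2 + a * fc p1 1)" "fc ?v2 1 = \<i> * (Nn * Ac / 2 + a * fc p2 1)"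
    using fc_deriv[OF du(1) cv(1) up(1), of 1] fc_deriv[OF du(3) cv(2) up(2), of 1] unfolding fu by simp_all
  have z: "cnj Ec * fc p1 1 + Ac * fc p2 1 = 0" by (rule sol(4))
  \<comment> \<open>Phase invariance: the velocity has first coefficient \<i> times that of \<nu> +
    a \<psi>. Since \<psi> is orthogonal to \<mu> in mode 1, the pairing is a nonzero multiple of Im
    s.\<close>
  have s0: "Im s = 0"
  proof -
    have ci: "(\<lambda>x. Re (z * cis x) * v x) integrable_on {- pi..pi}" if "continuous_on UNIV v" for z v
      by (rule integrable_continuous_real, rule continuous_on_subset[of UNIV], intro continuous_intros that) simp
    have rr: "r z x = Re ((2 * a * s * z) * cis x)" for z x
      by (simp add: r_def \<gamma>0 algebra_simps)
    have "0 = integral {- pi..pi} (\<lambda>x. Re ((2 * a * s * Ec) * cis x) * ?v1 x + Re ((2 * a * s * Ac) * cis x) * ?v2 x)"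
      by (rule orth(2)[unfolded rr, symmetric])
    also have "\<dots> = integral {- pi..pi} (\<lambda>x. Re ((2 * a * s * Ec) * cis x) * ?v1 x) + integral {- pi..pi} (\<lambda>x. Re ((2 * a * s * Ac) * cis x) * ?v2 x)"
      by (rule integral_add[OF ci[OF cv(1)] ci[OF cv(2)]])
    also have "\<dots> = 2 * pi * Re ((2 * a * s * Ec) * cnj (fc ?v1 1) + (2 * a * s * Ac) * cnj (fc ?v2 1))"
      unfolding integral_Re_cis[OF cv(1)] integral_Re_cis[OF cv(2)] plus_complex.sel by (rule distrib_left[symmetric])
    also have "(2 * a * s * Ec) * cnj (fc ?v1 1) + (2 * a * s * Ac) * cnj (fc ?v2 1) =
        - \<i> * (2 * a * s) * (Nn / 2 * (Ec * cnj Ec + of_real (Ac\<^sup>2)) + a * cnj (cnj Ec * fc p1 1 + Ac * fc p2 1))"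
      unfolding fv by (simp add: power2_eq_square algebra_simps)
    also have "\<dots> = - \<i> * s * of_real (a * Nn * muN\<^sup>2)"
      unfolding z muN_sq[symmetric] by (simp add: algebra_simps)
    also have "2 * pi * Re \<dots> = 2 * pi * (a * Nn * muN\<^sup>2) * Im s" by simp
    finally show ?thesis using a(2) Nn_pos muN_pos by simp
  qed
  have "Re s * muN\<^sup>2 = Sf a R p \<xi>"
  proof -
    have cP: "continuous_on UNIV (P1 a R p \<xi>)" "continuous_on UNIV (P2 a R p \<xi>)"
      by (rule continuous_on_slice[OF P_continuous(1)[OF p(1)]], rule continuous_on_slice[OF P_continuous(2)[OF p(1)]])
    have fe: "fc (\<lambda>x. (Nn / a) * Re (z * cis x)) 1 = of_real (Nn / (2 * a)) * z" for z
      using fc_monomial[of z 1 1] by (simp only: fc_scale of_nat_1 mult_1) simp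
    have fF: "fc (F1 a R p \<xi>) 1 = fc (P1 a R p \<xi>) 1 - of_real (Nn / (2 * a)) * k1 w"
      "fc (F2 a R p \<xi>) 1 = fc (P2 a R p \<xi>) 1 - of_real (Nn / (2 * a)) * k2 w"
      unfolding F1_def[abs_def] F2_def[abs_def] w_def
      by (subst fc_diff[OF cP(1)], (intro continuous_intros)[1], simp only: fe,
          subst fc_diff[OF cP(2)], (intro continuous_intros)[1], simp only: fe)
    have "s * of_real (muN\<^sup>2) = cnj Ec * (A w * fc p1 1 - E w * fc p2 1 - fc (F1 a R p \<xi>) 1)
       + Ac * (B w * fc p2 1 - cnj (E w) * fc p1 1 - fc (F2 a R p \<xi>) 1)"
    proof -
      have "A w * fc p1 1 - E w * fc p2 1 - fc (F1 a R p \<xi>) 1 = s * Ec"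
        "B w * fc p2 1 - cnj (E w) * fc p1 1 - fc (F2 a R p \<xi>) 1 = s * Ac"
        using sol(2,3) by simp_all
      then show ?thesis unfolding muN_sq by (simp only:) (simp add: power2_eq_square algebra_simps)
    qed
    \<comment> \<open>The symbol is Hermitian, so pairing with \<mu> moves it from \<psi> onto
      \<mu>, where it produces the small vectors \<open>k1\<close>, \<open>k2\<close>; their own
      pairing with \<mu> is \<open>h\<close>.\<close>
    also have "\<dots> = (cnj (k1 w) * fc p1 1 + cnj (k2 w) * fc p2 1 - cnj Ec * fc (P1 a R p \<xi>) 1 - Ac * fc (P2 a R p \<xi>) 1)
       + of_real (Nn / (2 * a)) * (cnj Ec * k1 w + Ac * k2 w)"
      unfolding fF by (simp add: k1_def k2_def algebra_simps)
    finally have "Re (s * of_real (muN\<^sup>2)) = Sf a R p \<xi>"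
      unfolding h_eq[symmetric] Sf_def w_def[symmetric] p1_def[symmetric] p2_def[symmetric]
      by (simp only: plus_complex.sel flip: of_real_mult) simp
    then show ?thesis by simp
  qed
  note res = s0 this ode[unfolded \<gamma>0 add_0_right]
  show ?thesis
    by (rule conjI, use pp in blast, rule conjI, rule z, rule exI[of _ q1], rule exI[of _ q2], rule exI[of _ s],
        use res in blast)
qed

text \<open>The equation for \<open>\<psi> = (p1, p2)\<close> is the system at \<open>a \<nu> + a\<^sup>2 \<psi>\<close> divided by \<open>a\<^sup>2\<close>; the terms with
  \<open>k1\<close> and \<open>k2\<close> are the residual of \<open>\<nu>\<close> in the linearization.\<close>

definition is_branch :: "real \<Rightarrow> real \<Rightarrow> real \<Rightarrow> real \<Rightarrow> (real \<Rightarrow> real) \<Rightarrow> (real \<Rightarrow> real) \<Rightarrow> (real \<Rightarrow> real) \<Rightarrow> (real \<Rightarrow> real) \<Rightarrow> bool" where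
  "is_branch \<rho> K a \<xi> p1 p2 q1 q2 \<longleftrightarrow>
    \<bar>\<xi>\<bar> \<le> K \<and> \<bar>a * \<xi>\<bar> \<le> \<delta>0 \<and> norm (k1 (\<omega>0 + a * \<xi>)) \<le> K * \<bar>a\<bar> \<and> norm (k2 (\<omega>0 + a * \<xi>)) \<le> K * \<bar>a\<bar> \<and>
    cnj Ec * fc p1 1 + Ac * fc p2 1 = 0 \<and>
    (\<forall>x. p1 (x + 2 * pi) = p1 x \<and> p2 (x + 2 * pi) = p2 x \<and> \<bar>p1 x\<bar> \<le> \<rho> \<and> \<bar>p2 x\<bar> \<le> \<rho> \<and>
      (p1 has_real_derivative q1 x) (at x) \<and> (p2 has_real_derivative q2 x) (at x) \<and>
      (q1 has_real_derivative (p2 (x + (\<omega>0 + a * \<xi>)) + \<kappa> * p2 (x - (\<omega>0 + a * \<xi>)) - (1 + \<kappa>) * p1 x +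
        (NL n1 n2 a (\<omega>0 + a * \<xi>) (\<lambda>x. nu1 x + a * p1 x) (\<lambda>x. nu2 x + a * p2 x) x
          - (Nn / a) * Re (k1 (\<omega>0 + a * \<xi>) * cis x))) / (c\<^sup>2 * (\<omega>0 + a * \<xi>)\<^sup>2)) (at x) \<and>
      (q2 has_real_derivative (\<kappa> * p1 (x + (\<omega>0 + a * \<xi>)) + p1 (x - (\<omega>0 + a * \<xi>)) - (1 + \<kappa>) * p2 x +
        (NL n2 n1 a (\<omega>0 + a * \<xi>) (\<lambda>x. nu2 x + a * p2 x) (\<lambda>x. nu1 x + a * p1 x) x
          - (Nn / a) * Re (k2 (\<omega>0 + a * \<xi>) * cis x))) / (m * c\<^sup>2 * (\<omega>0 + a * \<xi>)\<^sup>2)) (at x))"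

text \<open>At the ends of the window the term with \<open>h\<close> outweighs everything else in
  \<open>Sf\<close> and has opposite signs there. A zero of \<open>Sf\<close> in between removes the
  last component of the residual.\<close>

lemma ex_branch:
  obtains \<rho> a0 K where "\<rho> \<ge> 0" "a0 > 0" "K \<ge> 0"
    "\<And>a. a \<noteq> 0 \<Longrightarrow> \<bar>a\<bar> \<le> a0 \<Longrightarrow> \<bar>a\<bar> * \<rho> \<le> 1 \<and> 6 * \<bar>a\<bar> \<le> 1 \<and>
      (\<exists>\<xi> p1 p2 q1 q2. is_branch \<rho> K a \<xi> p1 p2 q1 q2)"
proof -
  obtain C where C: "C > 0"
    and g: "\<And>\<omega> n. \<bar>\<omega> - \<omega>0\<bar> \<le> \<delta>0 \<Longrightarrow> norm (g11 \<omega> n) \<le> C / (real n + 1)\<^sup>2"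
      "\<And>\<omega> n. \<bar>\<omega> - \<omega>0\<bar> \<le> \<delta>0 \<Longrightarrow> norm (g12 \<omega> n) \<le> C / (real n + 1)\<^sup>2"
      "\<And>\<omega> n. \<bar>\<omega> - \<omega>0\<bar> \<le> \<delta>0 \<Longrightarrow> norm (g21 \<omega> n) \<le> C / (real n + 1)\<^sup>2"
      "\<And>\<omega> n. \<bar>\<omega> - \<omega>0\<bar> \<le> \<delta>0 \<Longrightarrow> norm (g22 \<omega> n) \<le> C / (real n + 1)\<^sup>2"
    by (rule g_bound) blast
  obtain Ck where Ck: "Ck > 0"
    and k: "\<And>\<omega>. \<bar>\<omega> - \<omega>0\<bar> \<le> \<delta>0 \<Longrightarrow> norm (k1 \<omega>) \<le> Ck * \<bar>\<omega> - \<omega>0\<bar>"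
      "\<And>\<omega>. \<bar>\<omega> - \<omega>0\<bar> \<le> \<delta>0 \<Longrightarrow> norm (k2 \<omega>) \<le> Ck * \<bar>\<omega> - \<omega>0\<bar>"
    by (rule k_lipschitz) blast
  obtain c1 d1 where c1: "c1 > 0" "d1 > 0" and h: "\<And>t. \<bar>t\<bar> \<le> d1 \<Longrightarrow> t * h (\<omega>0 + t) \<le> - c1 * t\<^sup>2"
    by (rule h_transversal) blast
  define X where "X = 72 * L * (norm Ec + \<bar>Ac\<bar>)"
  have X: "X \<ge> 0" using L by (simp add: X_def)
  \<comment> \<open>Chosen so that the dispersive term reaches X + 2 at the ends, while the other
    terms stay below X + 1.\<close>
  define R where "R = 2 * (X + 2) / (Nn * c1)"
  have R: "R > 0" using X Nn_pos c1 by (simp add: R_def)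
  have RX: "Nn * c1 * R / 2 = X + 2" using Nn_pos c1 by (simp add: R_def)
  define \<rho> where "\<rho> = 8 * C * inv_sq_sum * (72 * L + Nn * Ck * R)"
  have \<rho>: "\<rho> \<ge> 0" using C inv_sq_sum_pos L Nn_pos Ck R by (simp add: \<rho>_def)
  define T where "T = 8 * C * inv_sq_sum * (48 * L)"
  have T: "T \<ge> 0" using C inv_sq_sum_pos L by (simp add: T_def)
  \<comment> \<open>In order: strains within the unit interval, frequencies where the inverse is
    controlled, frequencies where transversality holds, |a \<psi>| \<le> 1, contraction, and the
    terms with \<open>k1\<close> and \<open>k2\<close> in \<open>Sf\<close> at most 1 in total. The
    added 1 keeps denominators positive.\<close>
  define a0 where "a0 = Min {1 / 6, \<delta>0 / R, d1 / R, 1 / (\<rho> + 1), 1 / (T + 1), 1 / (2 * Ck * R * \<rho> + 1)}"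
  have Y: "2 * Ck * R * \<rho> \<ge> 0" using Ck R \<rho> by simp
  have a0: "a0 > 0" unfolding a0_def using \<delta>0(1) R c1 \<rho> T Y by (simp add: add_nonneg_pos)
  have scal: "\<bar>a\<bar> * y \<le> 1" if "\<bar>a\<bar> \<le> 1 / (y + 1)" "y \<ge> 0" for a y :: real
  proof -
    have "\<bar>a\<bar> * (y + 1) \<le> 1" using that by (simp add: pos_le_divide_eq)
    then show ?thesis by (simp add: distrib_left)
  qed
  show ?thesis
  proof (rule that[of \<rho> a0 "R + Ck * R"])
    show "R + Ck * R \<ge> 0" using R Ck by simp
    fix a :: real assume a: "a \<noteq> 0" "\<bar>a\<bar> \<le> a0"
    have aa: "\<bar>a\<bar> \<le> 1 / 6" "\<bar>a\<bar> \<le> \<delta>0 / R" "\<bar>a\<bar> \<le> d1 / R" "\<bar>a\<bar> \<le> 1 / (\<rho> + 1)" "\<bar>a\<bar> \<le> 1 / (T + 1)"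
      "\<bar>a\<bar> \<le> 1 / (2 * Ck * R * \<rho> + 1)"
      using a(2) unfolding a0_def by simp_all
    have a6: "6 * \<bar>a\<bar> \<le> 1" using aa(1) by simp
    have aR: "\<bar>a\<bar> * R \<le> \<delta>0" "\<bar>a\<bar> * R \<le> d1" using aa(2,3) R by (simp_all add: pos_le_divide_eq)
    have a\<rho>: "\<bar>a\<bar> * \<rho> \<le> 1" by (rule scal[OF aa(4) \<rho>])
    have aT: "8 * C * inv_sq_sum * (48 * L) * \<bar>a\<bar> \<le> 1" using scal[OF aa(5) T] by (simp add: T_def mult.commute)
    have aY: "\<bar>a\<bar> * (2 * Ck * R * \<rho>) \<le> 1" by (rule scal[OF aa(6) Y])
    obtain p where p: "continuous_on UNIV p" "\<And>q. norm (p q) \<le> \<rho>" "TT a R p = p"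
      using ex_profile[OF a6 a(1) R aR(1) k Ck C g \<rho>_def a\<rho> aT] by blast
    note om = om_near[OF R aR(1)]
    have pb: "\<bar>fst (p q)\<bar> \<le> \<rho>" "\<bar>snd (p q)\<bar> \<le> \<rho>" for q
      using p(2)[of q] norm_fst_le[of "fst (p q)" "snd (p q)"] norm_snd_le[of "snd (p q)" "fst (p q)"] by simp_all
    have pc: "continuous_on UNIV (\<lambda>(\<xi>, x). fst (p (\<xi>, x)))" "continuous_on UNIV (\<lambda>(\<xi>, x). snd (p (\<xi>, x)))"
      using p(1) unfolding case_prod_beta prod.collapse by (auto intro: continuous_on_fst continuous_on_snd)
    have Sc: "continuous_on UNIV (Sf a R p)"
      unfolding Sf_def k1_def k2_def h_def divide_inverse
      by (intro continuous_on_add continuous_on_diff continuous_on_mult continuous_on_Re continuous_on_cnj continuous_on_const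
          continuous_on_of_real continuous_on_ABQ continuous_on_E continuous_on_om continuous_on_id
          fc_continuous_param[OF pc(1)] fc_continuous_param[OF pc(2)]
          fc_continuous_param[OF P_continuous(1)[OF p(1)]] fc_continuous_param[OF P_continuous(2)[OF p(1)]])
    have kb: "norm (k1 (om a R \<xi>)) \<le> Ck * (\<bar>a\<bar> * R)" "norm (k2 (om a R \<xi>)) \<le> Ck * (\<bar>a\<bar> * R)" for \<xi>
      using order_trans[OF k(1)[OF om(2)] mult_left_mono[OF om(1)]] order_trans[OF k(2)[OF om(2)] mult_left_mono[OF om(1)]] Ck
      by auto
    have near: "\<bar>Sf a R p \<xi> - Nn / (2 * a) * h (om a R \<xi>)\<bar> \<le> X + 1" for \<xi>
    proof -
      let ?z1 = "fc (\<lambda>x. fst (p (\<xi>, x))) 1" and ?z2 = "fc (\<lambda>x. snd (p (\<xi>, x))) 1"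
      have z: "norm ?z1 \<le> \<rho>" "norm ?z2 \<le> \<rho>"
        using fc_bound[OF continuous_on_slice[OF pc(1)] pb(1)] fc_bound[OF continuous_on_slice[OF pc(2)] pb(2)] by auto
      have f: "norm (fc (P1 a R p \<xi>) 1) \<le> 72 * L" "norm (fc (P2 a R p \<xi>) 1) \<le> 72 * L"
        using fc_bound[OF continuous_on_slice[OF P_continuous(1)[OF p(1)]] P_bound(1)[where p = p, OF a6 a(1) a\<rho> p(2)]]
          fc_bound[OF continuous_on_slice[OF P_continuous(2)[OF p(1)]] P_bound(2)[where p = p, OF a6 a(1) a\<rho> p(2)]] by auto
      have "\<bar>Sf a R p \<xi> - Nn / (2 * a) * h (om a R \<xi>)\<bar> \<le> norm (cnj (k1 (om a R \<xi>)) * ?z1 + cnj (k2 (om a R \<xi>)) * ?z2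
         - cnj Ec * fc (P1 a R p \<xi>) 1 - of_real Ac * fc (P2 a R p \<xi>) 1)"
        unfolding Sf_def add_diff_cancel_right' by (rule abs_Re_le_cmod)
      also have "\<dots> \<le> norm (cnj (k1 (om a R \<xi>)) * ?z1) + norm (cnj (k2 (om a R \<xi>)) * ?z2)
         + norm (cnj Ec * fc (P1 a R p \<xi>) 1) + norm (of_real Ac * fc (P2 a R p \<xi>) 1)"
        by (meson norm_triangle_ineq norm_triangle_ineq4 order_trans add_right_mono)
      also have "\<dots> \<le> (Ck * (\<bar>a\<bar> * R)) * \<rho> + (Ck * (\<bar>a\<bar> * R)) * \<rho> + norm Ec * (72 * L) + \<bar>Ac\<bar> * (72 * L)"
        unfolding norm_mult complex_mod_cnj norm_of_real
        using kb[of \<xi>] z f Ck R by (intro add_mono mult_mono) auto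
      also have "\<dots> = \<bar>a\<bar> * (2 * Ck * R * \<rho>) + X" by (simp add: X_def algebra_simps)
      finally show ?thesis using aY by linarith
    qed
    have omR: "om a R R = \<omega>0 + a * R" "om a R (- R) = \<omega>0 + a * (- R)" using R by (simp_all add: om_def)
    \<comment> \<open>Transversality is stated for t h(\<omega>0 + t), so dividing by
      \<open>a\<close> instead of t gives signs that depend on \<xi> = R or - R and not on the sign
      of \<open>a\<close>.\<close>
    have ha: "1 / a * h (\<omega>0 + a * R) \<le> - c1 * R" "c1 * R \<le> 1 / a * h (\<omega>0 + a * (- R))"
    proof -
      have t: "\<bar>a * R\<bar> \<le> d1" "\<bar>a * (- R)\<bar> \<le> d1" using aR(2) R by (simp_all add: abs_mult)
      have pos: "a\<^sup>2 * R > 0" using a(1) R by simp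
      have "(a\<^sup>2 * R) * (1 / a * h (\<omega>0 + a * R)) \<le> (a\<^sup>2 * R) * (- c1 * R)"
        using h[OF t(1)] a(1) by (simp add: power2_eq_square mult_ac)
      then show "1 / a * h (\<omega>0 + a * R) \<le> - c1 * R" using pos by (simp only: mult_le_cancel_left_pos)
      have "(a\<^sup>2 * R) * (c1 * R) \<le> (a\<^sup>2 * R) * (1 / a * h (\<omega>0 + a * (- R)))"
        using h[OF t(2)] a(1) by (simp add: power2_eq_square mult_ac)
      then show "c1 * R \<le> 1 / a * h (\<omega>0 + a * (- R))" using pos by (simp only: mult_le_cancel_left_pos)
    qed
    have hR: "Nn / (2 * a) * h (om a R R) \<le> - (X + 2)" "X + 2 \<le> Nn / (2 * a) * h (om a R (- R))"
    proof -
      have "Nn / 2 * (1 / a * h (\<omega>0 + a * R)) \<le> Nn / 2 * (- c1 * R)" using ha(1) Nn_pos by (intro mult_left_mono) auto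
      then show "Nn / (2 * a) * h (om a R R) \<le> - (X + 2)" unfolding omR RX[symmetric] by simp
      have "Nn / 2 * (c1 * R) \<le> Nn / 2 * (1 / a * h (\<omega>0 + a * (- R)))" using ha(2) Nn_pos by (intro mult_left_mono) auto
      then show "X + 2 \<le> Nn / (2 * a) * h (om a R (- R))" unfolding omR RX[symmetric] by simp
    qed
    have "Sf a R p R \<le> 0" "0 \<le> Sf a R p (- R)" using near[of R] near[of "- R"] hR by linarith+
    then obtain \<xi> where \<xi>: "- R \<le> \<xi>" "\<xi> \<le> R" "Sf a R p \<xi> = 0"
      using IVT2'[of "Sf a R p" R 0 "- R"] R continuous_on_subset[OF Sc] by auto
    have w: "om a R \<xi> = \<omega>0 + a * \<xi>" using \<xi> by (simp add: om_def)
    have aR': "\<bar>a * \<xi>\<bar> \<le> \<bar>a\<bar> * R" unfolding abs_mult using \<xi> by (intro mult_left_mono) auto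
    note sol = profile_solves[OF a6 a(1) R aR(1) k Ck a\<rho> p, of \<xi>]
    from sol obtain q1 q2 and s :: complex where s: "Im s = 0" "Re s * muN\<^sup>2 = Sf a R p \<xi>"
      and ode: "\<And>x. ((\<lambda>x. fst (p (\<xi>, x))) has_real_derivative q1 x) (at x) \<and> ((\<lambda>x. snd (p (\<xi>, x))) has_real_derivative q2 x) (at x) \<and>
      (q1 has_real_derivative (snd (p (\<xi>, x + om a R \<xi>)) + \<kappa> * snd (p (\<xi>, x - om a R \<xi>)) - (1 + \<kappa>) * fst (p (\<xi>, x)) + F1 a R p \<xi> x +
         Re (2 * s * Ec * cis x)) / (c\<^sup>2 * (om a R \<xi>)\<^sup>2)) (at x) \<and>
      (q2 has_real_derivative (\<kappa> * fst (p (\<xi>, x + om a R \<xi>)) + fst (p (\<xi>, x - om a R \<xi>)) - (1 + \<kappa>) * snd (p (\<xi>, x)) + F2 a R p \<xi> x +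
         Re (2 * s * Ac * cis x)) / (m * c\<^sup>2 * (om a R \<xi>)\<^sup>2)) (at x)" by blast
    have "Re s = 0" using s(2) \<xi>(3) muN_pos by simp
    then have s0: "s = 0" using s(1) by (simp add: complex_eq_iff)
    note ode0 = ode[unfolded s0 w F1_def F2_def P1_def P2_def mult_zero_left mult_zero_right zero_complex.sel add_0_right]
    have per: "\<forall>x. fst (p (\<xi>, x + 2 * pi)) = fst (p (\<xi>, x)) \<and> snd (p (\<xi>, x + 2 * pi)) = snd (p (\<xi>, x))"
      and orth: "cnj Ec * fc (\<lambda>x. fst (p (\<xi>, x))) 1 + Ac * fc (\<lambda>x. snd (p (\<xi>, x))) 1 = 0"
      using sol by blast+
    have K: "norm (k1 (\<omega>0 + a * \<xi>)) \<le> (R + Ck * R) * \<bar>a\<bar>" "norm (k2 (\<omega>0 + a * \<xi>)) \<le> (R + Ck * R) * \<bar>a\<bar>"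
    proof -
      have "Ck * (\<bar>a\<bar> * R) \<le> (R + Ck * R) * \<bar>a\<bar>" using R by (simp add: algebra_simps)
      then show "norm (k1 (\<omega>0 + a * \<xi>)) \<le> (R + Ck * R) * \<bar>a\<bar>" "norm (k2 (\<omega>0 + a * \<xi>)) \<le> (R + Ck * R) * \<bar>a\<bar>"
        using kb[of \<xi>] unfolding w by linarith+
    qed
    have xK: "\<bar>\<xi>\<bar> \<le> R + Ck * R" using \<xi> mult_pos_pos[OF Ck R] by linarith
    have aw: "\<bar>a * \<xi>\<bar> \<le> \<delta>0" using aR aR' by linarith
    have "is_branch \<rho> (R + Ck * R) a \<xi> (\<lambda>x. fst (p (\<xi>, x))) (\<lambda>x. snd (p (\<xi>, x))) q1 q2"
      unfolding is_branch_def using xK aw K orth per pb ode0 by blast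
    then show "\<bar>a\<bar> * \<rho> \<le> 1 \<and> 6 * \<bar>a\<bar> \<le> 1 \<and> (\<exists>\<xi> p1 p2 q1 q2. is_branch \<rho> (R + Ck * R) a \<xi> p1 p2 q1 q2)"
      using a\<rho> a6 by blast
  qed (use \<rho> a0 in auto)
qed

end

section \<open>Regularity\<close>

lemma nonlinearity_derivatives:
  fixes V :: "real \<Rightarrow> real"
  assumes V: "smooth V" and O: "(\<lambda>r. deriv V r - (k * r + b * r\<^sup>2)) \<in> O[at 0](\<lambda>r. r ^ 3)"
  obtains N where "N 0 = (\<lambda>r. deriv V r - k * r)"
    and "\<And>j x. (N j has_real_derivative N (Suc j) x) (at x)" and "N 0 0 = 0" "N 1 0 = 0"
    and "\<And>x. (V has_real_derivative deriv V x) (at x)"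
proof -
  obtain D where D: "D 0 = V" "\<And>n x. (D n has_real_derivative D (Suc n) x) (at x)"
    using V unfolding smooth_def has_real_derivative_iff_has_vector_derivative by blast
  have D1: "D 1 = deriv V" using DERIV_imp_deriv[OF D(2)[of 0]] D(1) by (auto simp: fun_eq_iff)
  \<comment> \<open>Subtracting the linear part changes only the first two members of the chain of
    derivatives.\<close>
  define N where "N j = (case j of 0 \<Rightarrow> (\<lambda>r. D 1 r - k * r) | Suc 0 \<Rightarrow> (\<lambda>r. D 2 r - k) | Suc (Suc i) \<Rightarrow> D (Suc j))" for j
  have dN: "(N j has_real_derivative N (Suc j) x) (at x)" for j x
  proof -
    consider "j = 0" | "j = 1" | i where "j = Suc (Suc i)" by (metis One_nat_def not0_implies_Suc)
    then show ?thesis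
    proof cases
      case 1
      have "((\<lambda>r. D 1 r - k * r) has_real_derivative D 2 x - k) (at x)"
        using D(2)[of 1 x] by (auto intro!: derivative_eq_intros simp: numeral_2_eq_2)
      then show ?thesis using 1 by (simp add: N_def)
    next
      case 2
      have "((\<lambda>r. D 2 r - k) has_real_derivative D 3 x) (at x)"
        using D(2)[of 2 x] by (auto intro!: derivative_eq_intros simp: numeral_2_eq_2 numeral_3_eq_3)
      then show ?thesis using 2 by (simp add: N_def numeral_3_eq_3 numeral_2_eq_2)
    next
      case 3
      then show ?thesis using D(2)[of "Suc j" x] by (simp add: N_def)
    qed
  qed
  obtain C where C: "eventually (\<lambda>r. norm (deriv V r - (k * r + b * r\<^sup>2)) \<le> C * norm (r ^ 3)) (at 0)"
    using O by (elim landau_o.bigE) auto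
  have N0: "N 0 r = (deriv V r - (k * r + b * r\<^sup>2)) + b * r\<^sup>2" for r by (simp add: N_def D1[unfolded One_nat_def])
  have lim: "((\<lambda>r. N 0 r / r) \<longlongrightarrow> 0) (at 0)"
  proof (rule Lim_null_comparison)
    show "eventually (\<lambda>r. norm (N 0 r / r) \<le> C * r\<^sup>2 + \<bar>b\<bar> * \<bar>r\<bar>) (at 0)"
      using C eventually_neq_at_within[of 0 0 UNIV]
    proof eventually_elim
      case (elim r)
      then have r: "r \<noteq> 0" by simp
      have "\<bar>N 0 r\<bar> \<le> C * \<bar>r\<bar> ^ 3 + \<bar>b\<bar> * \<bar>r\<bar>\<^sup>2"
        unfolding N0 using elim(1) abs_triangle_ineq[of "deriv V r - (k * r + b * r\<^sup>2)" "b * r\<^sup>2"]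
        by (simp add: abs_mult power_abs)
      also have "\<dots> = (C * r\<^sup>2 + \<bar>b\<bar> * \<bar>r\<bar>) * \<bar>r\<bar>" by (simp add: power2_eq_square power3_eq_cube algebra_simps)
      finally show ?case using r by (simp add: pos_divide_le_eq)
    qed
    have "((\<lambda>r. C * r\<^sup>2 + \<bar>b\<bar> * \<bar>r\<bar>) \<longlongrightarrow> C * 0\<^sup>2 + \<bar>b\<bar> * \<bar>0\<bar>) (at 0)" by (intro tendsto_intros)
    then show "((\<lambda>r. C * r\<^sup>2 + \<bar>b\<bar> * \<bar>r\<bar>) \<longlongrightarrow> 0) (at 0)" by simp
  qed
  have "((\<lambda>r. N 0 r / r * r) \<longlongrightarrow> 0 * 0) (at 0)" by (intro tendsto_mult lim tendsto_ident_at)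
  \<comment> \<open>The growth condition speaks of a punctured neighbourhood, so the value at 0 is
    obtained by continuity.\<close>
  moreover have "((\<lambda>r. N 0 r / r * r) \<longlongrightarrow> N 0 0) (at 0)"
  proof (rule Lim_transform_eventually)
    show "(N 0 \<longlongrightarrow> N 0 0) (at 0)" using DERIV_isCont[OF dN] by (simp add: isCont_def)
    show "eventually (\<lambda>r. N 0 r = N 0 r / r * r) (at 0)" by (auto simp: eventually_at_filter)
  qed
  ultimately have z0: "N 0 0 = 0" using tendsto_unique[of "at (0::real)"] by fastforce
  have "((\<lambda>r. N 0 r / r) \<longlongrightarrow> N 1 0) (at 0)"
    using dN[of 0 0] z0 by (simp add: DERIV_def)
  then have z1: "N 1 0 = 0" using lim tendsto_unique[of "at (0::real)"] by fastforce
  show ?thesis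
    using that[of N] dN z0 z1 D(2)[of 0] unfolding D(1) D1[symmetric] by (simp add: N_def)
qed

lemma bounded_on_unit_interval:
  fixes f :: "real \<Rightarrow> real"
  assumes "\<And>x. (f has_real_derivative f' x) (at x)"
  obtains B where "B \<ge> 0" "\<And>x. \<bar>x\<bar> \<le> 1 \<Longrightarrow> \<bar>f x\<bar> \<le> B"
proof -
  have "continuous_on {- 1..1} f"
    using assms by (meson DERIV_continuous_on has_field_derivative_at_within)
  then have "bounded (f ` {- 1..1})" by (intro compact_imp_bounded compact_continuous_image) auto
  then obtain B where "B > 0" "\<And>y. y \<in> f ` {- 1..1} \<Longrightarrow> norm y \<le> B" by (meson bounded_pos)
  then show ?thesis using that[of B] by (auto simp: abs_le_iff)
qed

lemma nonlinearity_bounds: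
  assumes N: "\<And>j x. (N j has_real_derivative N (Suc j) x) (at x)" and z: "N 0 0 = 0" "N 1 0 = 0"
  obtains L where "L \<ge> 0" "quad_lipschitz L (N 0)" "\<And>t. \<bar>t\<bar> \<le> 1 \<Longrightarrow> \<bar>N 1 t\<bar> \<le> L * \<bar>t\<bar>"
proof -
  obtain L where L: "L \<ge> 0" "\<And>x. \<bar>x\<bar> \<le> 1 \<Longrightarrow> \<bar>N 2 x\<bar> \<le> L"
    using bounded_on_unit_interval[OF N[of 2]] by blast
  have mvt: "\<exists>t. min r s \<le> t \<and> t \<le> max r s \<and> N j r - N j s = N (Suc j) t * (r - s)" for j r s
  proof (cases r s rule: linorder_cases)
    case less
    then obtain t where "r < t" "t < s" "N j s - N j r = (s - r) * N (Suc j) t"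
      using MVT2[OF less, of "N j" "N (Suc j)"] N by blast
    then show ?thesis using less by (intro exI[of _ t]) (simp add: algebra_simps)
  next
    case greater
    then obtain t where "s < t" "t < r" "N j r - N j s = (r - s) * N (Suc j) t"
      using MVT2[OF greater, of "N j" "N (Suc j)"] N by blast
    then show ?thesis using greater by (intro exI[of _ t]) (simp add: algebra_simps)
  qed auto
  have b1: "\<bar>N 1 t\<bar> \<le> L * \<bar>t\<bar>" if t: "\<bar>t\<bar> \<le> 1" for t
  proof -
    obtain y where y: "min t 0 \<le> y" "y \<le> max t 0" "N 1 t - N 1 0 = N (Suc 1) y * (t - 0)" using mvt by blast
    have "\<bar>y\<bar> \<le> 1" using y(1,2) t by linarith
    from L(2)[OF this] have "\<bar>N 2 y\<bar> * \<bar>t\<bar> \<le> L * \<bar>t\<bar>" by (intro mult_right_mono) auto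
    then show ?thesis using y(3) z by (simp add: abs_mult numeral_2_eq_2)
  qed
  have "quad_lipschitz L (N 0)"
    unfolding quad_lipschitz_def
  proof (intro conjI allI impI z(1))
    fix r s :: real assume rs: "\<bar>r\<bar> \<le> 1" "\<bar>s\<bar> \<le> 1"
    obtain t where t: "min r s \<le> t" "t \<le> max r s" "N 0 r - N 0 s = N (Suc 0) t * (r - s)" using mvt by blast
    have tm: "\<bar>t\<bar> \<le> max \<bar>r\<bar> \<bar>s\<bar>" using t(1,2) by linarith
    then have "\<bar>t\<bar> \<le> 1" using rs by linarith
    then have "\<bar>N 1 t\<bar> \<le> L * \<bar>t\<bar>" by (rule b1)
    also have "\<dots> \<le> L * max \<bar>r\<bar> \<bar>s\<bar>" using tm L(1) by (rule mult_left_mono)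
    finally have "\<bar>N 1 t\<bar> * \<bar>r - s\<bar> \<le> L * max \<bar>r\<bar> \<bar>s\<bar> * \<bar>r - s\<bar>" by (intro mult_right_mono) auto
    then show "\<bar>N 0 r - N 0 s\<bar> \<le> L * max \<bar>r\<bar> \<bar>s\<bar> * \<bar>r - s\<bar>" unfolding t(3) by (simp add: abs_mult)
  qed
  with L(1) b1 show ?thesis using that by blast
qed

lemma quad_lipschitz_mono:
  assumes "quad_lipschitz L f" "L \<le> L'"
  shows "quad_lipschitz L' f"
  unfolding quad_lipschitz_def
proof (intro conjI allI impI)
  show "f 0 = 0" using assms by (simp add: quad_lipschitz_def)
  fix r s :: real assume "\<bar>r\<bar> \<le> 1" "\<bar>s\<bar> \<le> 1"
  then have "\<bar>f r - f s\<bar> \<le> L * max \<bar>r\<bar> \<bar>s\<bar> * \<bar>r - s\<bar>" using assms by (simp add: quad_lipschitz_def)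
  also have "\<dots> \<le> L' * max \<bar>r\<bar> \<bar>s\<bar> * \<bar>r - s\<bar>" using assms(2) by (intro mult_right_mono) auto
  finally show "\<bar>f r - f s\<bar> \<le> L' * max \<bar>r\<bar> \<bar>s\<bar> * \<bar>r - s\<bar>" .
qed

text \<open>The j-th derivative in s brings out \<open>a ^ j\<close> against the division by
  \<open>a\<^sup>2\<close>. For j \<ge> 2 this suffices; for j = 1 one missing factor comes from
  N'(0) = 0, and for j = 0 both come from the quadratic vanishing.\<close>

lemma ubd_scaled_nonlinearity:
  assumes N: "\<And>j x. (N j has_real_derivative N (Suc j) x) (at x)" and z: "N 0 0 = 0" "N 1 0 = 0"
    and A: "\<And>a. a \<in> A \<Longrightarrow> a \<noteq> 0 \<and> 6 * \<bar>a\<bar> \<le> 1"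
    and f: "ubd n A f" "\<And>a x. a \<in> A \<Longrightarrow> \<bar>f a x\<bar> \<le> 6"
  shows "ubd n A (\<lambda>a x. N 0 (a * f a x) / a\<^sup>2)"
proof -
  obtain L where L: "L \<ge> 0" "quad_lipschitz L (N 0)" "\<And>t. \<bar>t\<bar> \<le> 1 \<Longrightarrow> \<bar>N 1 t\<bar> \<le> L * \<bar>t\<bar>"
    using nonlinearity_bounds[OF N z] by blast
  define D where "D j a s = N j (a * s) * a ^ j / a\<^sup>2" for j :: nat and a s :: real
  have as: "\<bar>a * s\<bar> \<le> 1" if "a \<in> A" "\<bar>s\<bar> \<le> 6" for a s
  proof -
    have "\<bar>a\<bar> * \<bar>s\<bar> \<le> \<bar>a\<bar> * 6" using that by (intro mult_left_mono) auto
    then show ?thesis using conjunct2[OF A[OF that(1)]] unfolding abs_mult by linarith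
  qed
  have "ubd n A (\<lambda>a x. D 0 a (f a x))"
  proof (rule ubd_comp[OF _ _ f(2) f(1)])
    fix j a s
    have "((\<lambda>s. N j (a * s)) has_real_derivative N (Suc j) (a * s) * a) (at s)"
      by (rule DERIV_chain2[OF N]) (auto intro!: derivative_eq_intros)
    from DERIV_cdivide[OF DERIV_cmult_right[OF this, of "a ^ j"], of "a\<^sup>2"]
    show "(D j a has_real_derivative D (Suc j) a s) (at s)"
      unfolding D_def[abs_def] by (simp add: mult_ac)
  next
    fix j
    show "\<exists>C. \<forall>a\<in>A. \<forall>s. \<bar>s\<bar> \<le> 6 \<longrightarrow> \<bar>D j a s\<bar> \<le> C"
    proof -
      consider "j = 0" | "j = 1" | i where "j = Suc (Suc i)" by (metis One_nat_def not0_implies_Suc)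
      then show ?thesis
      proof cases
        case 1
        have "\<bar>D j a s\<bar> \<le> 36 * L" if as': "a \<in> A" "\<bar>s\<bar> \<le> 6" for a s
        proof -
          have "\<bar>N 0 (a * s) - N 0 0\<bar> \<le> L * max \<bar>a * s\<bar> \<bar>0\<bar> * \<bar>a * s - 0\<bar>"
            using L(2) as[OF as'] zero_le_one unfolding quad_lipschitz_def by (metis abs_zero)
          then have "\<bar>N 0 (a * s)\<bar> \<le> (L * s\<^sup>2) * a\<^sup>2" using z by (simp add: abs_mult power2_eq_square mult_ac flip: abs_mult)
          also have "\<dots> \<le> (L * 6\<^sup>2) * a\<^sup>2"
            using as'(2) L(1) power_mono[of "\<bar>s\<bar>" 6 2] by (intro mult_right_mono mult_left_mono) auto
          finally show ?thesis using A[OF as'(1)] 1 by (simp add: D_def pos_divide_le_eq)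
        qed
        then show ?thesis by blast
      next
        case 2
        have "\<bar>D j a s\<bar> \<le> 6 * L" if as': "a \<in> A" "\<bar>s\<bar> \<le> 6" for a s
        proof -
          have "\<bar>N 1 (a * s)\<bar> \<le> L * \<bar>a * s\<bar>" using L(3) as[OF as'] .
          also have "\<dots> = (L * \<bar>s\<bar>) * \<bar>a\<bar>" by (simp add: abs_mult)
          also have "\<dots> \<le> (L * 6) * \<bar>a\<bar>" using as'(2) L(1) by (intro mult_right_mono mult_left_mono) auto
          finally have "\<bar>N 1 (a * s)\<bar> * \<bar>a\<bar> \<le> (L * 6) * \<bar>a\<bar> * \<bar>a\<bar>" by (intro mult_right_mono) auto
          then show ?thesis using A[OF as'(1)] 2
            by (simp add: D_def abs_mult pos_divide_le_eq power2_eq_square mult_ac)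
        qed
        then show ?thesis by blast
      next
        case 3
        obtain B where B: "B \<ge> 0" "\<And>x. \<bar>x\<bar> \<le> 1 \<Longrightarrow> \<bar>N j x\<bar> \<le> B"
          using bounded_on_unit_interval[OF N[of j]] by blast
        have "\<bar>D j a s\<bar> \<le> B" if as': "a \<in> A" "\<bar>s\<bar> \<le> 6" for a s
        proof -
          have a: "a \<noteq> 0" "\<bar>a\<bar> \<le> 1" using A[OF as'(1)] by auto
          have "D j a s = N j (a * s) * a ^ i" using a 3 by (simp add: D_def power2_eq_square)
          then have "\<bar>D j a s\<bar> = \<bar>N j (a * s)\<bar> * \<bar>a\<bar> ^ i" by (simp add: abs_mult power_abs)
          also have "\<dots> \<le> B * 1" using B as[OF as'] a by (intro mult_mono power_le_one) auto
          finally show ?thesis by simp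
        qed
        then show ?thesis by blast
      qed
    qed
  qed
  then show ?thesis by (simp add: D_def)
qed

lemma ubd_NL:
  assumes N: "\<And>j x. (N j has_real_derivative N (Suc j) x) (at x)" "N 0 0 = 0" "N 1 0 = 0"
    and M: "\<And>j x. (M j has_real_derivative M (Suc j) x) (at x)" "M 0 0 = 0" "M 1 0 = 0"
    and A: "\<And>a. a \<in> A \<Longrightarrow> a \<noteq> 0 \<and> 6 * \<bar>a\<bar> \<le> 1"
    and u: "ubd n A u" "\<And>a x. a \<in> A \<Longrightarrow> \<bar>u a x\<bar> \<le> 3" and v: "ubd n A v" "\<And>a x. a \<in> A \<Longrightarrow> \<bar>v a x\<bar> \<le> 3"
  shows "ubd n A (\<lambda>a x. NL (N 0) (M 0) a (w a) (u a) (v a) x)"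
proof -
  have v': "ubd n A (\<lambda>a x. v a (x - w a))" using ubd_shift[OF v(1), of "\<lambda>a. - w a"] by simp
  have b: "\<bar>p - q\<bar> \<le> 6" if "\<bar>p\<bar> \<le> 3" "\<bar>q\<bar> \<le> 3" for p q :: real using that by linarith
  have "ubd n A (\<lambda>a x. N 0 (a * (v a (x + w a) - u a x)) / a\<^sup>2)"
    by (rule ubd_scaled_nonlinearity[OF N A ubd_diff[OF ubd_shift[OF v(1)] u(1)] b[OF v(2) u(2)]])
  moreover have "ubd n A (\<lambda>a x. M 0 (a * (u a x - v a (x - w a))) / a\<^sup>2)"
    by (rule ubd_scaled_nonlinearity[OF M A ubd_diff[OF u(1) v'] b[OF u(2) v(2)]])
  ultimately show ?thesis unfolding NL_def diff_divide_distrib by (rule ubd_diff)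
qed

lemma ubd_cscale: "ubd n A f \<Longrightarrow> ubd n A (\<lambda>i x. k * f i x)"
  by (rule ubd_scale[where C = "\<bar>k\<bar>"]) auto

context dimer_nl
begin

lemma ubd_nu: "ubd n I (\<lambda>a x. nu1 x)" "ubd n I (\<lambda>a x. nu2 x)"
proof -
  have "ubd n I (\<lambda>a x. Nn * Re z * cos x - Nn * Im z * sin x)" for z
    using ubd_cos_sin[of n I] by (intro ubd_diff ubd_cscale) blast+
  then have "ubd n I (\<lambda>a x. Nn * Re (z * cis x))" for z by (simp add: right_diff_distrib mult.assoc)
  then show "ubd n I (\<lambda>a x. nu1 x)" "ubd n I (\<lambda>a x. nu2 x)" unfolding nu1_def nu2_def by blast+
qed

text \<open>The equation expresses second derivatives through shifts of the profile and compositions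
  with it, none of which costs a derivative, so a bound of order n yields n + 2; the induction keeps
  only n + 1 of it.\<close>

lemma ubd_branch:
  assumes N: "\<And>j x. (N j has_real_derivative N (Suc j) x) (at x)" "N 0 0 = 0" "N 1 0 = 0" "N 0 = n1"
    and M: "\<And>j x. (M j has_real_derivative M (Suc j) x) (at x)" "M 0 0 = 0" "M 1 0 = 0" "M 0 = n2"
    and A: "\<And>a. a \<in> I \<Longrightarrow> a \<noteq> 0 \<and> 6 * \<bar>a\<bar> \<le> 1" "\<And>a. a \<in> I \<Longrightarrow> \<bar>a\<bar> * \<rho> \<le> 1"
    and K: "K \<ge> 0"
    and br: "\<And>a. a \<in> I \<Longrightarrow> is_branch \<rho> K a (\<xi> a) (p1 a) (p2 a) (q1 a) (q2 a)"
  shows "ubd n I p1 \<and> ubd n I p2"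
proof -
  define w where "w a = \<omega>0 + a * \<xi> a" for a
  note b = br[unfolded is_branch_def, folded w_def]
  have pb: "\<bar>p1 a x\<bar> \<le> \<rho>" "\<bar>p2 a x\<bar> \<le> \<rho>" if "a \<in> I" for a x using b[OF that] by blast+
  have ub: "\<bar>nu1 x + a * p1 a x\<bar> \<le> 3" "\<bar>nu2 x + a * p2 a x\<bar> \<le> 3" if "a \<in> I" for a x
  proof -
    have "\<bar>a\<bar> * \<bar>p1 a x\<bar> \<le> \<bar>a\<bar> * \<rho>" "\<bar>a\<bar> * \<bar>p2 a x\<bar> \<le> \<bar>a\<bar> * \<rho>" using pb[OF that] by (auto intro!: mult_left_mono)
    then have "\<bar>a * p1 a x\<bar> \<le> 1" "\<bar>a * p2 a x\<bar> \<le> 1" using A(2)[OF that] unfolding abs_mult by linarith+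
    then show "\<bar>nu1 x + a * p1 a x\<bar> \<le> 3" "\<bar>nu2 x + a * p2 a x\<bar> \<le> 3" using nu_bound[of x] by linarith+
  qed
  have cs: "ubd n I (\<lambda>a x. cos x)" "ubd n I (\<lambda>a x. sin x)" for n using ubd_cos_sin by blast+
  have e: "ubd n I (\<lambda>a x. (Nn / a) * Re (k (w a) * cis x))" if k: "\<And>a. a \<in> I \<Longrightarrow> norm (k (w a)) \<le> K * \<bar>a\<bar>" for k :: "real \<Rightarrow> complex" and n
  proof -
    have "\<bar>Nn / a * y\<bar> \<le> Nn * K" if "a \<in> I" "\<bar>y\<bar> \<le> norm (k (w a))" for a y
    proof -
      have "\<bar>y\<bar> \<le> K * \<bar>a\<bar>" using that k by force
      then have "Nn / \<bar>a\<bar> * \<bar>y\<bar> \<le> Nn / \<bar>a\<bar> * (K * \<bar>a\<bar>)" using Nn_pos by (intro mult_left_mono) auto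
      also have "\<dots> = Nn * K" using A(1)[OF that(1)] by simp
      finally show ?thesis using Nn_pos by (simp only: abs_mult abs_divide abs_of_pos)
    qed
    then have "ubd n I (\<lambda>a x. (Nn / a * Re (k (w a))) * cos x - (Nn / a * Im (k (w a))) * sin x)"
      by (intro ubd_diff ubd_scale[where C = "Nn * K"] cs) (auto simp: abs_Re_le_cmod abs_Im_le_cmod)
    then show ?thesis by (simp add: right_diff_distrib mult.assoc)
  qed
  \<comment> \<open>Frequencies bounded away from zero keep the division by their squares uniform in
    \<open>a\<close>.\<close>
  have wlow: "3 / 4 * \<omega>0 \<le> w a" if "a \<in> I" for a
  proof -
    have "\<bar>a * \<xi> a\<bar> \<le> \<omega>0 / 4" using b[OF that] \<delta>0(2) by linarith
    then show ?thesis unfolding w_def by linarith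
  qed
  have ws: "\<bar>1 / (M' * (w a)\<^sup>2)\<bar> \<le> 1 / (M' * (3 / 4 * \<omega>0)\<^sup>2)" if "a \<in> I" "M' > 0" for a M'
  proof -
    have "(3 / 4 * \<omega>0)\<^sup>2 \<le> (w a)\<^sup>2" using wlow[OF that(1)] \<omega>0 by (intro power_mono) auto
    then have "M' * (3 / 4 * \<omega>0)\<^sup>2 \<le> M' * (w a)\<^sup>2" using that(2) by (intro mult_left_mono) auto
    moreover have "0 < M' * (3 / 4 * \<omega>0)\<^sup>2" using that(2) \<omega>0 by simp
    ultimately have "1 / (M' * (w a)\<^sup>2) \<le> 1 / (M' * (3 / 4 * \<omega>0)\<^sup>2)" by (intro frac_le) auto
    moreover have "0 \<le> 1 / (M' * (w a)\<^sup>2)" using that(2) by simp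
    ultimately show ?thesis by linarith
  qed
  have c2: "c\<^sup>2 > 0" "m * c\<^sup>2 > 0" using c m by auto
  let ?R1 = "\<lambda>a x. (p2 a (x + w a) + \<kappa> * p2 a (x - w a) - (1 + \<kappa>) * p1 a x +
        (NL n1 n2 a (w a) (\<lambda>x. nu1 x + a * p1 a x) (\<lambda>x. nu2 x + a * p2 a x) x
          - (Nn / a) * Re (k1 (w a) * cis x))) / (c\<^sup>2 * (w a)\<^sup>2)"
  let ?R2 = "\<lambda>a x. (\<kappa> * p1 a (x + w a) + p1 a (x - w a) - (1 + \<kappa>) * p2 a x +
        (NL n2 n1 a (w a) (\<lambda>x. nu2 x + a * p2 a x) (\<lambda>x. nu1 x + a * p1 a x) x
          - (Nn / a) * Re (k2 (w a) * cis x))) / (m * c\<^sup>2 * (w a)\<^sup>2)"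
  have d: "(p1 a has_real_derivative q1 a x) (at x)" "(p2 a has_real_derivative q2 a x) (at x)"
    "(q1 a has_real_derivative ?R1 a x) (at x)" "(q2 a has_real_derivative ?R2 a x) (at x)"
    if "a \<in> I" for a x using b[OF that] by blast+
  have u0: "ubd 0 I p1" "ubd 0 I p2" by (rule ubd_0I[OF pb(1)], assumption, rule ubd_0I[OF pb(2)], assumption)
  show ?thesis
  proof (induction n)
    case 0 show ?case using u0 by blast
  next
    case (Suc n)
    then have p: "ubd n I p1" "ubd n I p2" by blast+
    have sc: "ubd n I (\<lambda>a x. k * f a x)" if "ubd n I f" for k f
      by (rule ubd_cscale[OF that])
    have sa: "ubd n I (\<lambda>a x. a * f a x)" if "ubd n I f" for f
      by (rule ubd_scale[OF _ that, of _ 1]) (use A(1) in force)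
    have sh: "ubd n I (\<lambda>a x. f a (x + w a))" "ubd n I (\<lambda>a x. f a (x - w a))" if "ubd n I f" for f
      using ubd_shift[OF that, of w] ubd_shift[OF that, of "\<lambda>a. - w a"] by simp_all
    have u: "ubd n I (\<lambda>a x. nu1 x + a * p1 a x)" "ubd n I (\<lambda>a x. nu2 x + a * p2 a x)"
      by (rule ubd_add[OF ubd_nu(1) sa[OF p(1)]], rule ubd_add[OF ubd_nu(2) sa[OF p(2)]])
    have nl: "ubd n I (\<lambda>a x. NL n1 n2 a (w a) (\<lambda>x. nu1 x + a * p1 a x) (\<lambda>x. nu2 x + a * p2 a x) x)"
      "ubd n I (\<lambda>a x. NL n2 n1 a (w a) (\<lambda>x. nu2 x + a * p2 a x) (\<lambda>x. nu1 x + a * p1 a x) x)"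
      using ubd_NL[OF N(1-3) M(1-3) A(1) u(1) ub(1) u(2) ub(2), of w] ubd_NL[OF M(1-3) N(1-3) A(1) u(2) ub(2) u(1) ub(1), of w]
      unfolding N(4) M(4) by blast+
    have k: "norm (k1 (w a)) \<le> K * \<bar>a\<bar>" "norm (k2 (w a)) \<le> K * \<bar>a\<bar>" if "a \<in> I" for a using b[OF that] by blast+
    have "ubd n I (\<lambda>a x. 1 / (c\<^sup>2 * (w a)\<^sup>2) * (p2 a (x + w a) + \<kappa> * p2 a (x - w a) - (1 + \<kappa>) * p1 a x +
        (NL n1 n2 a (w a) (\<lambda>x. nu1 x + a * p1 a x) (\<lambda>x. nu2 x + a * p2 a x) x
          - (Nn / a) * Re (k1 (w a) * cis x))))"
      by (rule ubd_scale[OF ws[OF _ c2(1)]], assumption)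
         (rule ubd_add[OF ubd_diff[OF ubd_add[OF sh(1)[OF p(2)] sc[OF sh(2)[OF p(2)]]] sc[OF p(1)]] ubd_diff[OF nl(1) e[OF k(1)]]])
    then have R1: "ubd n I ?R1" by simp
    have "ubd n I (\<lambda>a x. 1 / (m * c\<^sup>2 * (w a)\<^sup>2) * (\<kappa> * p1 a (x + w a) + p1 a (x - w a) - (1 + \<kappa>) * p2 a x +
        (NL n2 n1 a (w a) (\<lambda>x. nu2 x + a * p2 a x) (\<lambda>x. nu1 x + a * p1 a x) x
          - (Nn / a) * Re (k2 (w a) * cis x))))"
      by (rule ubd_scale[OF ws[OF _ c2(2)]], assumption)
         (rule ubd_add[OF ubd_diff[OF ubd_add[OF sc[OF sh(1)[OF p(1)]] sh(2)[OF p(1)]] sc[OF p(2)]] ubd_diff[OF nl(2) e[OF k(2)]]])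
    then have R2: "ubd n I ?R2" by simp
    show ?case
      using ubd_Suc_imp[OF ubd_second[OF d(1,3) u0(1) R1]] ubd_Suc_imp[OF ubd_second[OF d(2,4) u0(2) R2]] by blast
  qed
qed

section \<open>Returning from the scaled branch to the traveling wave system\<close>

lemma branch_solves_tw:
  assumes br: "is_branch \<rho> K a \<xi> p1 p2 q1 q2" and a: "a \<noteq> 0"
    and V1: "\<And>t. deriv V1 t = t + n1 t" and V2: "\<And>t. deriv V2 t = \<kappa> * t + n2 t"
  shows "solves_tw m V1 V2 c (\<lambda>X. a *\<^sub>R vec2 (nu1 ((\<omega>0 + a * \<xi>) * X)) (nu2 ((\<omega>0 + a * \<xi>) * X))
    + a\<^sup>2 *\<^sub>R vec2 (p1 ((\<omega>0 + a * \<xi>) * X)) (p2 ((\<omega>0 + a * \<xi>) * X)))"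
proof -
  define w where "w = \<omega>0 + a * \<xi>"
  note b = br[unfolded is_branch_def, folded w_def]
  have "\<bar>a * \<xi>\<bar> \<le> \<omega>0 / 4" using b \<delta>0(2) by linarith
  then have w0: "w \<noteq> 0" using \<omega>0 unfolding w_def by linarith
  let ?u1 = "\<lambda>x. nu1 x + a * p1 x" and ?u2 = "\<lambda>x. nu2 x + a * p2 x"
  let ?R1 = "\<lambda>x. (p2 (x + w) + \<kappa> * p2 (x - w) - (1 + \<kappa>) * p1 x +
        (NL n1 n2 a w ?u1 ?u2 x - (Nn / a) * Re (k1 w * cis x))) / (c\<^sup>2 * w\<^sup>2)"
  let ?R2 = "\<lambda>x. (\<kappa> * p1 (x + w) + p1 (x - w) - (1 + \<kappa>) * p2 x +
        (NL n2 n1 a w ?u2 ?u1 x - (Nn / a) * Re (k2 w * cis x))) / (m * c\<^sup>2 * w\<^sup>2)"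
  let ?v1 = "\<lambda>x. Nn * Re (\<i> * Ec * cis x) + a * q1 x" and ?v2 = "\<lambda>x. Nn * Re (\<i> * of_real Ac * cis x) + a * q2 x"
  let ?w1 = "\<lambda>x. - nu1 x + a * ?R1 x" and ?w2 = "\<lambda>x. - nu2 x + a * ?R2 x"
  have ode: "(p1 has_real_derivative q1 x) (at x)" "(p2 has_real_derivative q2 x) (at x)"
    "(q1 has_real_derivative ?R1 x) (at x)" "(q2 has_real_derivative ?R2 x) (at x)" for x using b by blast+
  have du: "(?u1 has_real_derivative ?v1 x) (at x)" "(?v1 has_real_derivative ?w1 x) (at x)"
    "(?u2 has_real_derivative ?v2 x) (at x)" "(?v2 has_real_derivative ?w2 x) (at x)" for x
    by (intro DERIV_add DERIV_cmult nu_deriv ode)+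
  have ar: "d * (- y + a * (X / d)) = - (d * y) + a * X" if "d \<noteq> 0" for d y X
    using that by (simp add: field_simps)
  \<comment> \<open>The scaled equation is multiplied by \<open>a\<close> twice to restore the
    original amplitudes; \<open>ar2\<close> and \<open>ar3\<close> cancel the negative powers of
    \<open>a\<close>.\<close>
  have ar2: "a * (a * ((y - X) / a\<^sup>2)) = y - X" for y X using a by (simp add: power2_eq_square)
  have ar3: "a * (X + (y - Nn / a * z)) = a * X + a * y - Nn * z" for X y z using a by (simp add: algebra_simps)
  have eq1: "a * ((c\<^sup>2 * w\<^sup>2) * ?w1 x) = deriv V1 (a * (?u2 (x + w) - ?u1 x)) - deriv V2 (a * (?u1 x - ?u2 (x - w)))" for x
  proof -
    have "(c\<^sup>2 * w\<^sup>2) * ?w1 x = - (c\<^sup>2 * w\<^sup>2 * nu1 x) + a * (p2 (x + w) + \<kappa> * p2 (x - w) - (1 + \<kappa>) * p1 x +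
        (NL n1 n2 a w ?u1 ?u2 x - (Nn / a) * Re (k1 w * cis x)))"
      by (rule ar) (use c w0 in simp)
    from arg_cong[OF this, of "\<lambda>y. a * y"] have "a * ((c\<^sup>2 * w\<^sup>2) * ?w1 x) = a * (- (c\<^sup>2 * w\<^sup>2 * nu1 x))
        + a * (a * (p2 (x + w) + \<kappa> * p2 (x - w) - (1 + \<kappa>) * p1 x) + a * NL n1 n2 a w ?u1 ?u2 x - Nn * Re (k1 w * cis x))"
      unfolding ar3 by (simp only: distrib_left)
    also have "- (c\<^sup>2 * w\<^sup>2 * nu1 x) = (nu2 (x + w) + \<kappa> * nu2 (x - w) - (1 + \<kappa>) * nu1 x) + Nn * Re (k1 w * cis x)"
      using nu_id1[of x w] by linarith
    finally have "a * ((c\<^sup>2 * w\<^sup>2) * ?w1 x) = a * ((nu2 (x + w) + \<kappa> * nu2 (x - w) - (1 + \<kappa>) * nu1 x)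
        + a * (p2 (x + w) + \<kappa> * p2 (x - w) - (1 + \<kappa>) * p1 x)) + a * (a * NL n1 n2 a w ?u1 ?u2 x)"
      by (simp only: distrib_left right_diff_distrib)
    then show ?thesis unfolding NL_def ar2 V1 V2 by (simp add: algebra_simps)
  qed
  have eq2: "a * ((m * c\<^sup>2 * w\<^sup>2) * ?w2 x) = deriv V2 (a * (?u1 (x + w) - ?u2 x)) - deriv V1 (a * (?u2 x - ?u1 (x - w)))" for x
  proof -
    have "(m * c\<^sup>2 * w\<^sup>2) * ?w2 x = - (m * c\<^sup>2 * w\<^sup>2 * nu2 x) + a * (\<kappa> * p1 (x + w) + p1 (x - w) - (1 + \<kappa>) * p2 x +
        (NL n2 n1 a w ?u2 ?u1 x - (Nn / a) * Re (k2 w * cis x)))"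
      by (rule ar) (use c w0 m in simp)
    from arg_cong[OF this, of "\<lambda>y. a * y"] have "a * ((m * c\<^sup>2 * w\<^sup>2) * ?w2 x) = a * (- (m * c\<^sup>2 * w\<^sup>2 * nu2 x))
        + a * (a * (\<kappa> * p1 (x + w) + p1 (x - w) - (1 + \<kappa>) * p2 x) + a * NL n2 n1 a w ?u2 ?u1 x - Nn * Re (k2 w * cis x))"
      unfolding ar3 by (simp only: distrib_left)
    also have "- (m * c\<^sup>2 * w\<^sup>2 * nu2 x) = (\<kappa> * nu1 (x + w) + nu1 (x - w) - (1 + \<kappa>) * nu2 x) + Nn * Re (k2 w * cis x)"
      using nu_id2[of x w] by linarith
    finally have "a * ((m * c\<^sup>2 * w\<^sup>2) * ?w2 x) = a * ((\<kappa> * nu1 (x + w) + nu1 (x - w) - (1 + \<kappa>) * nu2 x)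
        + a * (\<kappa> * p1 (x + w) + p1 (x - w) - (1 + \<kappa>) * p2 x)) + a * (a * NL n2 n1 a w ?u2 ?u1 x)"
      by (simp only: distrib_left right_diff_distrib)
    then show ?thesis unfolding NL_def ar2 V1 V2 by (simp add: algebra_simps)
  qed
  have dw: "((\<lambda>X. a * f (w * X)) has_real_derivative a * (w * g (w * X))) (at X)"
    if "\<And>x. (f has_real_derivative g x) (at x)" for f g :: "real \<Rightarrow> real" and X
  proof -
    have "((\<lambda>X. f (w * X)) has_real_derivative g (w * X) * w) (at X)"
      by (rule DERIV_chain2[OF that]) (auto intro!: derivative_eq_intros)
    from DERIV_cmult[OF this, of a] show ?thesis by (simp add: mult_ac)
  qed
  have dw2: "((\<lambda>X. a * (w * f (w * X))) has_real_derivative a * (w\<^sup>2 * g (w * X))) (at X)"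
    if "\<And>x. (f has_real_derivative g x) (at x)" for f g :: "real \<Rightarrow> real" and X
    using DERIV_cmult[OF dw[OF that], of w X] by (simp add: power2_eq_square mult_ac)
  have comp: "(a *\<^sub>R vec2 (nu1 (w * X)) (nu2 (w * X)) + a\<^sup>2 *\<^sub>R vec2 (p1 (w * X)) (p2 (w * X))) $ 1 = a * ?u1 (w * X)"
    "(a *\<^sub>R vec2 (nu1 (w * X)) (nu2 (w * X)) + a\<^sup>2 *\<^sub>R vec2 (p1 (w * X)) (p2 (w * X))) $ 2 = a * ?u2 (w * X)" for X
    by (simp_all add: power2_eq_square algebra_simps)
  have wX: "w * (X + 1) = w * X + w" "w * (X + - 1) = w * X - w" for X by (simp_all add: algebra_simps)
  have s1: "c\<^sup>2 * (a * (w\<^sup>2 * ?w1 (w * X))) = deriv V1 (a * ?u2 (w * X + w) - a * ?u1 (w * X)) - deriv V2 (a * ?u1 (w * X) - a * ?u2 (w * X - w))" for X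
    using eq1[of "w * X"] unfolding right_diff_distrib[symmetric] by (simp only: mult_ac)
  have s2: "c\<^sup>2 * m * (a * (w\<^sup>2 * ?w2 (w * X))) = deriv V2 (a * ?u1 (w * X + w) - a * ?u2 (w * X)) - deriv V1 (a * ?u2 (w * X) - a * ?u1 (w * X - w))" for X
    using eq2[of "w * X"] unfolding right_diff_distrib[symmetric] by (simp only: mult_ac)
  show ?thesis
    unfolding solves_tw_def Let_def w_def[symmetric] comp shift_def wX
    by (rule exI[of _ "\<lambda>X. a * (w * ?v1 (w * X))"], rule exI[of _ "\<lambda>X. a * (w * ?v2 (w * X))"],
        rule exI[of _ "\<lambda>X. a * (w\<^sup>2 * ?w1 (w * X))"], rule exI[of _ "\<lambda>X. a * (w\<^sup>2 * ?w2 (w * X))"])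
       (use dw[OF du(1)] dw2[OF du(2)] dw[OF du(3)] dw2[OF du(4)] s1 s2 in blast)
qed

text \<open>Only the first mode of \<psi> meets \<nu>, so the inner product is the real part of the
  complex orthogonality relation to \<mu>.\<close>

lemma inner_per_nu:
  assumes p: "continuous_on UNIV p1" "continuous_on UNIV p2" and z: "cnj Ec * fc p1 1 + Ac * fc p2 1 = 0"
  shows "inner_per (\<lambda>x. vec2 (nu1 x) (nu2 x)) (\<lambda>x. vec2 (p1 x) (p2 x)) = 0"
proof -
  have ci: "(\<lambda>x. Re (z * cis x) * v x) integrable_on {- pi..pi}" if "continuous_on UNIV v" for z v
    by (rule integrable_continuous_real, rule continuous_on_subset[of UNIV], intro continuous_intros that) simp
  have "integral {- pi..pi} (\<lambda>x. vec2 (nu1 x) (nu2 x) \<bullet> vec2 (p1 x) (p2 x)) =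
    integral {- pi..pi} (\<lambda>x. Re ((Nn * Ec) * cis x) * p1 x + Re ((Nn * Ac) * cis x) * p2 x)"
    by (intro integral_cong) (simp add: inner_vec_def UNIV_2 nu1_def nu2_def algebra_simps)
  also have "\<dots> = 2 * pi * Re ((Nn * Ec) * cnj (fc p1 1)) + 2 * pi * Re ((Nn * Ac) * cnj (fc p2 1))"
    unfolding integral_add[OF ci[OF p(1)] ci[OF p(2)]] integral_Re_cis[OF p(1)] integral_Re_cis[OF p(2)] ..
  also have "\<dots> = 2 * pi * Re (Nn * cnj (cnj Ec * fc p1 1 + Ac * fc p2 1))"
    by (simp add: algebra_simps)
  finally show ?thesis unfolding z by (simp add: inner_per_def)
qed

lemma smooth_nu: "smooth nu1" "smooth nu2"
  using ubd_smooth[OF ubd_nu(1), of "0 :: nat" "{0}"] ubd_smooth[OF ubd_nu(2), of "0 :: nat" "{0}"] by simp_all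

end

lemma (in dimer_nl) nu_eq:
  assumes \<omega>: "\<omega>0 = omega_crit \<kappa> w c"
  shows "nu \<kappa> w c x = vec2 (nu1 x) (nu2 x)"
proof -
  have mu: "mu \<kappa> w c $ 1 = Ec" "mu \<kappa> w c $ 2 = of_real Ac"
    by (simp_all add: mu_def Let_def \<omega>[symmetric] symE_def symA_def cis_conv_exp)
  have n: "norm (mu \<kappa> w c) = muN"
    by (simp add: norm_vec_def L2_set_def UNIV_2 mu muN_def)
  have c: "exp (- \<i> * of_real x) = cis (- x)" "exp (\<i> * of_real x) = cis x"
    by (simp_all add: cis_conv_exp)
  have N: "1 / (sqrt 2 * muN) * 2 = Nn"
    using muN_pos real_sqrt_mult_self[of 2] by (simp add: Nn_def field_simps)
  have "Re ((1 / (sqrt 2 * muN)) *\<^sub>R (cis (- x) * cnj z + cis x * z)) = Nn * Re (z * cis x)" for z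
    unfolding N[symmetric] by (simp add: algebra_simps)
  then have "nu \<kappa> w c x $ 1 = nu1 x" "nu \<kappa> w c x $ 2 = nu2 x"
    by (simp_all only: nu_def nu_complex_def vec_lambda_beta vector_scaleR_component vector_add_component
        vector_smult_component mu n c nu1_def nu2_def)
  then show ?thesis by (simp add: vec_eq_iff forall_2)
qed

theorem theorem1p1:
  fixes m \<kappa> \<beta> w c :: real and V1 V2 :: "real \<Rightarrow> real"
  assumes "m > 0" and "\<kappa> > 0" and "w = 1 / m" and "w > 1 \<or> \<kappa> > 1"
    and "smooth V1" and "smooth V2"
    and "(\<lambda>r. deriv V1 r - (r + r\<^sup>2)) \<in> O[at 0](\<lambda>r. r ^ 3)"
    and "(\<lambda>r. deriv V2 r - (\<kappa> * r + \<beta> * r\<^sup>2)) \<in> O[at 0](\<lambda>r. r ^ 3)"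
    and "\<bar>c\<bar> > c_star \<kappa> w"
  shows "\<exists>a\<^sub>c>0. \<exists>(\<psi> :: real \<Rightarrow> real \<Rightarrow> real ^ 2) (\<omega> :: real \<Rightarrow> real) (\<xi> :: real \<Rightarrow> real).
    (\<forall>a. \<bar>a\<bar> \<le> a\<^sub>c \<longrightarrow>
       smooth (\<psi> a) \<and> periodic_2pi (\<psi> a) \<and>
       solves_tw m V1 V2 c
         (\<lambda>X. a *\<^sub>R nu \<kappa> w c (\<omega> a * X) + a\<^sup>2 *\<^sub>R \<psi> a (\<omega> a * X))) \<and>
    smooth (nu \<kappa> w c) \<and> periodic_2pi (nu \<kappa> w c) \<and>
    (\<forall>a. \<bar>a\<bar> \<le> a\<^sub>c \<longrightarrow> inner_per (nu \<kappa> w c) (\<psi> a) = 0) \<and>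
    (\<forall>r\<ge>0. (\<forall>a. \<bar>a\<bar> \<le> a\<^sub>c \<longrightarrow> finite_sobolev r (\<psi> a)) \<and>
       bdd_above ((\<lambda>a. sobolev_norm r (\<psi> a)) ` {a. \<bar>a\<bar> \<le> a\<^sub>c})) \<and>
    (\<forall>a. \<bar>a\<bar> \<le> a\<^sub>c \<longrightarrow> \<omega> a = omega_crit \<kappa> w c + a * \<xi> a) \<and>
    bdd_above ((\<lambda>a. \<bar>\<xi> a\<bar>) ` {a. \<bar>a\<bar> \<le> a\<^sub>c})"
proof -
  define \<omega>0 where "\<omega>0 = omega_crit \<kappa> w c"
  have w: "w > 0" "m = 1 / w" using assms(1,3) by simp_all
  have cf: "0 < \<omega>0" "c\<^sup>2 * \<omega>0\<^sup>2 = lambda_plus \<kappa> w \<omega>0"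
    using is_critical_freq_omega_crit[OF assms(2) w(1) assms(9)] unfolding is_critical_freq_def \<omega>0_def by blast+
  have cs0: "c_star \<kappa> w \<ge> 0" using assms(2) w by (simp add: c_star_def)
  have cc: "(c_star \<kappa> w)\<^sup>2 < c\<^sup>2" using assms(9) cs0 by (metis power2_abs power_strict_mono zero_less_numeral)
  have dim: "dimer m \<kappa> c \<omega>0"
  proof
    show "m > 0" "\<kappa> > 0" "\<omega>0 > 0" using assms cf by simp_all
    show "c \<noteq> 0" using assms(9) cs0 by auto
    show "symA \<kappa> c \<omega>0 < 0" unfolding symA_def cf(2) using lambda_plus_gt[OF assms(2) w(1) assms(4)] by simp
    show "symdet m \<kappa> c \<omega>0 = 0" unfolding symdet_factor[OF assms(2) w] cf(2) by simp
    show "\<exists>\<delta>>0. \<forall>K\<ge>\<omega>0. \<delta> * (K\<^sup>2 * (K\<^sup>2 - \<omega>0\<^sup>2)) \<le> symdet m \<kappa> c K"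
      using symdet_lower_bound[OF assms(2) w assms(9) cf] assms(1) cc
      by (intro exI[of _ "m * (c\<^sup>2 - (c_star \<kappa> w)\<^sup>2)\<^sup>2"]) auto
  qed
  have O1: "(\<lambda>r. deriv V1 r - (1 * r + 1 * r\<^sup>2)) \<in> O[at 0](\<lambda>r. r ^ 3)" using assms(7) by simp
  obtain N where N: "N 0 = (\<lambda>r. deriv V1 r - 1 * r)" "\<And>j x. (N j has_real_derivative N (Suc j) x) (at x)"
    "N 0 0 = 0" "N 1 0 = 0" and V1: "\<And>x. (V1 has_real_derivative deriv V1 x) (at x)"
    using nonlinearity_derivatives[OF assms(5) O1] by blast
  obtain M where M: "M 0 = (\<lambda>r. deriv V2 r - \<kappa> * r)" "\<And>j x. (M j has_real_derivative M (Suc j) x) (at x)"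
    "M 0 0 = 0" "M 1 0 = 0" and V2: "\<And>x. (V2 has_real_derivative deriv V2 x) (at x)"
    using nonlinearity_derivatives[OF assms(6,8)] by blast
  obtain L1 where L1: "L1 \<ge> 0" "quad_lipschitz L1 (N 0)" "\<And>t. \<bar>t\<bar> \<le> 1 \<Longrightarrow> \<bar>N 1 t\<bar> \<le> L1 * \<bar>t\<bar>"
    by (rule nonlinearity_bounds[OF N(2-4)], rule that)
  obtain L2 where L2: "L2 \<ge> 0" "quad_lipschitz L2 (M 0)" "\<And>t. \<bar>t\<bar> \<le> 1 \<Longrightarrow> \<bar>M 1 t\<bar> \<le> L2 * \<bar>t\<bar>"
    by (rule nonlinearity_bounds[OF M(2-4)], rule that)
  interpret dimer_nl m \<kappa> c \<omega>0 "N 0" "M 0" "\<lambda>x. V1 x - x\<^sup>2 / 2" "\<lambda>x. V2 x - \<kappa> * x\<^sup>2 / 2" "max L1 L2"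
  proof (intro dimer_nl.intro dim dimer_nl_axioms.intro)
    show "0 \<le> max L1 L2" using L1 by simp
    show "quad_lipschitz (max L1 L2) (N 0)" "quad_lipschitz (max L1 L2) (M 0)"
      using quad_lipschitz_mono[OF L1(2)] quad_lipschitz_mono[OF L2(2)] by simp_all
    show "((\<lambda>x. V1 x - x\<^sup>2 / 2) has_real_derivative N 0 t) (at t)" for t
      unfolding N(1) by (rule DERIV_diff[OF V1]) (auto intro!: derivative_eq_intros)
    show "((\<lambda>x. V2 x - \<kappa> * x\<^sup>2 / 2) has_real_derivative M 0 t) (at t)" for t
      unfolding M(1) by (rule DERIV_diff[OF V2]) (auto intro!: derivative_eq_intros)
    show "continuous_on UNIV (N 0)" "continuous_on UNIV (M 0)"
      using N(2) M(2) by (meson DERIV_continuous_on has_field_derivative_at_within)+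
  qed
  have nu: "nu \<kappa> w c = (\<lambda>x. vec2 (nu1 x) (nu2 x))" using nu_eq[OF \<omega>0_def] by (simp add: fun_eq_iff)
  obtain \<rho> a0 K where \<rho>: "\<rho> \<ge> 0" "a0 > 0" "K \<ge> 0" and br: "\<And>a. a \<noteq> 0 \<Longrightarrow> \<bar>a\<bar> \<le> a0 \<Longrightarrow> \<bar>a\<bar> * \<rho> \<le> 1 \<and> 6 * \<bar>a\<bar> \<le> 1 \<and>
      (\<exists>\<xi> p1 p2 q1 q2. is_branch \<rho> K a \<xi> p1 p2 q1 q2)"
    using ex_branch by blast
  let ?I = "{a. a \<noteq> 0 \<and> \<bar>a\<bar> \<le> a0}"
  have "\<forall>a. \<exists>\<xi> p1 p2 q1 q2. a \<in> ?I \<longrightarrow> is_branch \<rho> K a \<xi> p1 p2 q1 q2" using br by blast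
  then obtain x' p1' p2' q1 q2 where b': "\<And>a. a \<in> ?I \<Longrightarrow> is_branch \<rho> K a (x' a) (p1' a) (p2' a) (q1 a) (q2 a)" by metis
  \<comment> \<open>At amplitude 0 the profile correction and \<xi> are set to zero; the zero
    function solves the system because both forces vanish at 0.\<close>
  define x where "x a = (if a = 0 then 0 else x' a)" for a
  define p1 where "p1 a = (if a = 0 then (\<lambda>_. 0) else p1' a)" for a
  define p2 where "p2 a = (if a = 0 then (\<lambda>_. 0) else p2' a)" for a
  have b: "is_branch \<rho> K a (x a) (p1 a) (p2 a) (q1 a) (q2 a)" if "a \<in> ?I" for a
    using b'[OF that] that by (simp add: x_def p1_def p2_def)
  have zero: "x 0 = 0" "p1 0 = (\<lambda>_. 0)" "p2 0 = (\<lambda>_. 0)" by (simp_all add: x_def p1_def p2_def)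
  let ?J = "{a. \<bar>a\<bar> \<le> a0}"
  have J: "?J = insert 0 ?I" using \<rho>(2) by auto
  have "ubd n ?I p1 \<and> ubd n ?I p2" for n
    by (rule ubd_branch[OF N(2-4) refl M(2-4) refl _ _ \<rho>(3) b]) (use br in auto)
  then have u: "ubd n ?J p1" "ubd n ?J p2" for n
    unfolding J using ubd_insert_zero[of p1 0 n ?I] ubd_insert_zero[of p2 0 n ?I] zero by simp_all
  have per: "p1 a (y + 2 * pi) = p1 a y" "p2 a (y + 2 * pi) = p2 a y" if "a \<in> ?J" for a y
  proof -
    have "p1 a (y + 2 * pi) = p1 a y \<and> p2 a (y + 2 * pi) = p2 a y"
    proof (cases "a = 0")
      case False
      then have "a \<in> ?I" using that by simp
      from b[OF this] show ?thesis unfolding is_branch_def by blast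
    qed (simp add: zero)
    then show "p1 a (y + 2 * pi) = p1 a y" "p2 a (y + 2 * pi) = p2 a y" by blast+
  qed
  have orth: "cnj (symE \<kappa> \<omega>0) * fc (p1 a) 1 + symA \<kappa> c \<omega>0 * fc (p2 a) 1 = 0" if "a \<in> ?J" for a
  proof (cases "a = 0")
    case True
    then show ?thesis using fc_const[of 0 1] by (simp add: zero)
  next
    case False
    then have "a \<in> ?I" using that by simp
    from b[OF this] show ?thesis unfolding is_branch_def by blast
  qed
  have xK: "\<bar>x a\<bar> \<le> K" if "a \<in> ?J" for a
  proof (cases "a = 0")
    case False
    then have "a \<in> ?I" using that by simp
    from b[OF this] show ?thesis unfolding is_branch_def by blast
  qed (simp add: zero \<rho>)
  have dV: "deriv V1 t = t + N 0 t" "deriv V2 t = \<kappa> * t + M 0 t" for t by (simp_all add: N(1) M(1))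
  have V0: "deriv V1 0 = 0" "deriv V2 0 = 0" unfolding dV using N(3) M(3) by simp_all
  have tw: "solves_tw m V1 V2 c (\<lambda>X. a *\<^sub>R nu \<kappa> w c ((\<omega>0 + a * x a) * X) +
      a\<^sup>2 *\<^sub>R vec2 (p1 a ((\<omega>0 + a * x a) * X)) (p2 a ((\<omega>0 + a * x a) * X)))" if "a \<in> ?J" for a
  proof (cases "a = 0")
    case True
    show ?thesis unfolding True solves_tw_def Let_def
      by (rule exI[of _ "\<lambda>_. 0"], rule exI[of _ "\<lambda>_. 0"], rule exI[of _ "\<lambda>_. 0"], rule exI[of _ "\<lambda>_. 0"])
         (simp add: shift_def V0)
  next
    case False
    then have "a \<in> ?I" using that by simp
    from branch_solves_tw[OF b[OF this] False dV] show ?thesis unfolding nu .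
  qed
  have cont: "continuous_on UNIV (p1 a)" "continuous_on UNIV (p2 a)" if "a \<in> ?J" for a
    using ubd_deriv(2)[OF u(1) that] ubd_deriv(2)[OF u(2) that]
    by (meson DERIV_continuous_on has_field_derivative_at_within)+
  show ?thesis
  proof (rule exI[of _ a0], rule conjI[OF \<rho>(2)], rule exI[of _ "\<lambda>a y. vec2 (p1 a y) (p2 a y)"],
      rule exI[of _ "\<lambda>a. \<omega>0 + a * x a"], rule exI[of _ x], intro conjI allI impI)
    show "smooth (nu \<kappa> w c)" unfolding nu by (intro smooth_vec2 smooth_nu)
    show "periodic_2pi (nu \<kappa> w c)" unfolding nu periodic_2pi_def by (simp add: nu_periodic)
    show "bdd_above ((\<lambda>a. \<bar>x a\<bar>) ` ?J)" using xK by (intro bdd_aboveI[of _ K]) auto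
  next
    fix r :: real
    show "finite_sobolev r (\<lambda>y. vec2 (p1 a y) (p2 a y))" if "\<bar>a\<bar> \<le> a0" for a
      using sobolev_bounded(1)[OF u(1) per(1) u(2) per(2)] that by simp
    show "bdd_above ((\<lambda>a. sobolev_norm r (\<lambda>y. vec2 (p1 a y) (p2 a y))) ` ?J)"
      by (rule sobolev_bounded(2)[OF u(1) per(1) u(2) per(2)])
  next
    fix a assume "\<bar>a\<bar> \<le> a0"
    then have a: "a \<in> ?J" by simp
    show "smooth (\<lambda>y. vec2 (p1 a y) (p2 a y))" by (intro smooth_vec2 ubd_smooth[OF u(1) a] ubd_smooth[OF u(2) a])
    show "periodic_2pi (\<lambda>y. vec2 (p1 a y) (p2 a y))" unfolding periodic_2pi_def using per[OF a] by simp
    show "solves_tw m V1 V2 c (\<lambda>X. a *\<^sub>R nu \<kappa> w c ((\<omega>0 + a * x a) * X) +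
      a\<^sup>2 *\<^sub>R vec2 (p1 a ((\<omega>0 + a * x a) * X)) (p2 a ((\<omega>0 + a * x a) * X)))" by (rule tw[OF a])
    show "inner_per (nu \<kappa> w c) (\<lambda>y. vec2 (p1 a y) (p2 a y)) = 0"
      unfolding nu by (rule inner_per_nu[OF cont[OF a] orth[OF a]])
    show "\<omega>0 + a * x a = omega_crit \<kappa> w c + a * x a" by (simp add: \<omega>0_def)
  qed
qed

end
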